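(* (Prime Orbit Theorem for nonlattice self-similar flows.) Let $\mathcal F_{\mathfrak w}$ be a nonlattice self-similar flow of dimension $D$. Then there exist $\delta>0$ and a screen $S$ lying to the left of the vertical line $\operatorname{Re}s=D-\delta$ such that $-\zeta_{\mathfrak w}'/\zeta_{\mathfrak w}$ is bounded on $S$, all complex dimensions $\omega$ to the right of $S$ satisfy $\operatorname{res}(-\zeta_{\mathfrak w}'/\zeta_{\mathfrak w};\omega)=1$, and, in the sense of distributions on $(0,\infty)$, $$\psi_{\mathfrak w}(x)=\frac{x^D}{D}+\sum_{\omega\in\mathcal D_{\mathfrak w}\setminus\{D\}}\frac{x^\omega}{\omega}+O\left(x^{D-\delta}\right)\quad\text{as }x\to\infty,$$ where $\mathcal D_{\mathfrak w}$ is the set of complex dimensions in the window $W$ to the right of $S$. Moreover, $$\psi_{\mathfrak w}(x)=\frac{x^D}{D}+o\left(x^D\right)\quad\text{as }x\to\infty.$$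
   Context: Self-similar flow: $N\ge2$, $\Omega=\{1,\dots,N\}^{\mathbb N}$ with left shift $\sigma$, and a weight function $\mathfrak w:\Omega\to(0,\infty)$ depending only on the first letter: $\mathfrak w(a)=w_{a_1}$, where $0<w_1\le\dots\le w_N$. The flow is nonlattice if $\sum_{j=1}^N\mathbb Zw_j$ is dense in $\mathbb R$. The dynamical zeta function is $\zeta_{\mathfrak w}(s)=\left(1-\sum_{j=1}^Ne^{-w_js}\right)^{-1}$, $s\in\mathbb C$; the complex dimensions are the poles of $-\zeta_{\mathfrak w}'/\zeta_{\mathfrak w}$; the dimension $D>0$ is the unique real solution of $\sum_je^{-w_js}=1$. A screen is the curve $\{S(t)+it:t\in\mathbb R\}$ for a bounded Lipschitz continuous function $S:\mathbb R\to\mathbb R$ with $S(t)<D$ for all $t$; its window is $W=\{\sigma+it:\sigma\ge S(t)\}$. For a periodic orbit $\mathfrak p$ of $\sigma$ (a finite set $\{a,\sigma a,\dots\}\subset\Omega$), $\mathfrak w_t(\mathfrak p)=\sum_{a\in\mathfrak p}\mathfrak w(a)$, and $$\psi_{\mathfrak w}(x)=\sum_{k\mathfrak w_t(\mathfrak p)\le\log x}\mathfrak w_t(\mathfrak p),$$ the sum over all pairs of a periodic orbit $\mathfrak p$ and an integer $k\ge1$ with $k\mathfrak w_t(\mathfrak p)\le\log x$. Functions act on test functions $\varphi\in C_c^\infty(0,\infty)$ by integration against $\varphi(x)\,dx$, and the sum over $\omega$ is taken termwise on test functions. A distribution $F$ is $O(x^\beta)$ as $x\to\infty$ if for every test function $\varphi$,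 with $\varphi_a(x)=a^{-1}\varphi(x/a)$, $\langle F,\varphi_a\rangle=O(a^\beta)$ as $a\to\infty$. *)

theory Defs
  imports "HOL-Complex_Analysis.Complex_Analysis" "HOL-Library.Landau_Symbols"
begin

section \<open>Self-similar flows\<close>

text \<open>The alphabet is \<open>{1..N}\<close> and words are indexed from \<open>0\<close>, so that \<open>a 0\<close> is the first
  letter \<open>a\<^sub>1\<close>. Only the values \<open>w 1, \<dots>, w N\<close> of \<open>w\<close> are relevant.\<close>

definition self_similar_flow :: "nat \<Rightarrow> (nat \<Rightarrow> real) \<Rightarrow> bool" where
  "self_similar_flow N w \<longleftrightarrow> N \<ge> 2 \<and> 0 < w 1 \<and> mono_on {1..N} w"

definition nonlattice :: "nat \<Rightarrow> (nat \<Rightarrow> real) \<Rightarrow> bool" where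
  "nonlattice N w \<longleftrightarrow>
     closure (range (\<lambda>c :: nat \<Rightarrow> int. \<Sum>j=1..N. of_int (c j) * w j)) = UNIV"

definition word_space :: "nat \<Rightarrow> (nat \<Rightarrow> nat) set" where
  "word_space N = {a. \<forall>i. a i \<in> {1..N}}"

definition left_shift :: "(nat \<Rightarrow> nat) \<Rightarrow> (nat \<Rightarrow> nat)" where
  "left_shift a = (\<lambda>i. a (Suc i))"

definition word_weight :: "(nat \<Rightarrow> real) \<Rightarrow> (nat \<Rightarrow> nat) \<Rightarrow> real" where
  "word_weight w a = w (a 0)"

definition periodic_orbits :: "nat \<Rightarrow> (nat \<Rightarrow> nat) set set" where
  "periodic_orbits N =
     {range (\<lambda>k. (left_shift ^^ k) a) | a. a \<in> word_space N \<and> (\<exists>n\<ge>1. (left_shift ^^ n) a = a)}"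

definition total_weight :: "(nat \<Rightarrow> real) \<Rightarrow> (nat \<Rightarrow> nat) set \<Rightarrow> real" where
  "total_weight w \<pp> = (\<Sum>a\<in>\<pp>. word_weight w a)"

text \<open>The index set is finite for a self-similar flow, since the weights are bounded below by
  \<open>w 1 > 0\<close>. Only \<open>x > 0\<close> is relevant.\<close>

definition psi :: "nat \<Rightarrow> (nat \<Rightarrow> real) \<Rightarrow> real \<Rightarrow> real" where
  "psi N w x =
     (\<Sum>(\<pp>, k) \<in> {(\<pp>, k :: nat). \<pp> \<in> periodic_orbits N \<and> k \<ge> 1 \<and>
        real k * total_weight w \<pp> \<le> ln x}. total_weight w \<pp>)"

definition zeta :: "nat \<Rightarrow> (nat \<Rightarrow> real) \<Rightarrow> complex \<Rightarrow> complex" where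
  "zeta N w s = inverse (1 - (\<Sum>j=1..N. exp (- (of_real (w j) * s))))"

definition neg_logderiv_zeta :: "nat \<Rightarrow> (nat \<Rightarrow> real) \<Rightarrow> complex \<Rightarrow> complex" where
  "neg_logderiv_zeta N w s = - deriv (zeta N w) s / zeta N w s"

definition complex_dimensions :: "nat \<Rightarrow> (nat \<Rightarrow> real) \<Rightarrow> complex set" where
  "complex_dimensions N w = {\<omega>. is_pole (neg_logderiv_zeta N w) \<omega>}"

definition flow_dimension :: "nat \<Rightarrow> (nat \<Rightarrow> real) \<Rightarrow> real" where
  "flow_dimension N w = (THE s. (\<Sum>j=1..N. exp (- (w j * s))) = 1)"

lemma self_similar_flow_weight_pos:
  assumes "self_similar_flow N w" "j \<in> {1..N}"
  shows "0 < w j"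
proof -
  have "w 1 \<le> w j"
    using assms by (intro mono_onD[of "{1..N}" w]) (auto simp: self_similar_flow_def)
  then show ?thesis
    using assms by (simp add: self_similar_flow_def)
qed

lemma flow_dimension_exists_unique:
  assumes flow: "self_similar_flow N w"
  shows "\<exists>!s. (\<Sum>j=1..N. exp (- (w j * s))) = 1"
proof -
  define h where "h = (\<lambda>s. \<Sum>j=1..N. exp (- (w j * s)))"
  have N: "N \<ge> 2" using flow by (simp add: self_similar_flow_def)
  have pos: "0 < w j" if "j \<in> {1..N}" for j
    using self_similar_flow_weight_pos[OF flow that] .
  have anti: "h t < h s" if "s < t" for s t
    unfolding h_def using N that pos by (intro sum_strict_mono) auto
  have "((\<lambda>s. exp (- (w j * s))) \<longlongrightarrow> 0) at_top" if "j \<in> {1..N}" for j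
    by (intro filterlim_compose[OF exp_at_bot] filterlim_compose[OF filterlim_uminus_at_bot_at_top]
        filterlim_tendsto_pos_mult_at_top[OF tendsto_const pos[OF that]] filterlim_ident)
  then have "(h \<longlongrightarrow> (\<Sum>j=1..N. 0)) at_top"
    unfolding h_def by (intro tendsto_sum) auto
  then have "eventually (\<lambda>s. h s < 1) at_top"
    by (intro order_tendstoD(2)[of h 0]) auto
  then obtain s1 where s1: "h s < 1" if "s \<ge> s1" for s
    by (auto simp: eventually_at_top_linorder)
  have "\<exists>s\<ge>0. s \<le> max 0 s1 \<and> h s = 1"
  proof (rule IVT2')
    show "h (max 0 s1) \<le> 1" using s1[of "max 0 s1"] by simp
    show "1 \<le> h 0" using N by (simp add: h_def)
    show "continuous_on {0..max 0 s1} h" unfolding h_def by (intro continuous_intros)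
  qed auto
  then obtain s where "h s = 1" by blast
  moreover have "t = s" if "h t = 1" for t
    using anti[of s t] anti[of t s] that \<open>h s = 1\<close> by (cases t s rule: linorder_cases) auto
  ultimately show ?thesis unfolding h_def by blast
qed

section \<open>Screens and windows\<close>

definition is_screen :: "nat \<Rightarrow> (nat \<Rightarrow> real) \<Rightarrow> (real \<Rightarrow> real) \<Rightarrow> bool" where
  "is_screen N w S \<longleftrightarrow>
     bounded (range S) \<and> (\<exists>L. L-lipschitz_on UNIV S) \<and> (\<forall>t. S t < flow_dimension N w)"

definition screen_curve :: "(real \<Rightarrow> real) \<Rightarrow> complex set" where
  "screen_curve S = range (\<lambda>t. Complex (S t) t)"

definition window :: "(real \<Rightarrow> real) \<Rightarrow> complex set" where
  "window S = {s. S (Im s) \<le> Re s}"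

section \<open>Distributions on the positive half-line\<close>

text \<open>Test functions are complex-valued elements of \<open>C\<^sub>c\<^sup>\<infinity>(0,\<infinity>)\<close>, extended by zero to the real
  line; \<open>d n\<close> is the \<open>n\<close>-th derivative.\<close>

definition test_function :: "(real \<Rightarrow> complex) \<Rightarrow> bool" where
  "test_function \<phi> \<longleftrightarrow>
     (\<exists>d :: nat \<Rightarrow> real \<Rightarrow> complex. d 0 = \<phi> \<and>
        (\<forall>n x. (d n has_vector_derivative d (Suc n) x) (at x))) \<and>
     compact (closure {x. \<phi> x \<noteq> 0}) \<and> closure {x. \<phi> x \<noteq> 0} \<subseteq> {0<..}"

definition pairing :: "(real \<Rightarrow> complex) \<Rightarrow> (real \<Rightarrow> complex) \<Rightarrow> complex" where
  "pairing F \<phi> = (LINT x:{0<..}|lborel. F x * \<phi> x)"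

definition dilate :: "real \<Rightarrow> (real \<Rightarrow> complex) \<Rightarrow> real \<Rightarrow> complex" where
  "dilate a \<phi> = (\<lambda>x. \<phi> (x / a) / of_real a)"

definition distribution_bigo :: "((real \<Rightarrow> complex) \<Rightarrow> complex) \<Rightarrow> real \<Rightarrow> bool" where
  "distribution_bigo F \<beta> \<longleftrightarrow>
     (\<forall>\<phi>. test_function \<phi> \<longrightarrow> (\<lambda>a. norm (F (dilate a \<phi>))) \<in> O[at_top](\<lambda>a. a powr \<beta>))"

end

theory Submission
  imports Defs "HOL-Real_Asymp.Real_Asymp"
begin

text \<open>
  Why the theorem holds. Write \<open>\<zeta> = 1/denom\<close>, so that the complex dimensions are zeros of \<open>denom\<close>. A
  pair of a periodic orbit and a multiplicity, together with a starting point, is a nonempty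
  finite word; therefore \<open>\<psi>(e\<^sup>y)\<close> is the sum over words of total weight at most \<open>y\<close> of the weight of the
  first letter (\<open>psi_eq_sum_words\<close>). It satisfies a renewal equation, whose Laplace transform is
  governed by \<open>denom'/denom\<close>.

  The decisive point is the geometry of the zeros close to the line \<open>Re s = D\<close>. If \<open>denom\<close> is small at
  a point close to this line, all the phases \<open>w\<^sub>j t\<close> are almost multiples of \<open>2\<pi>\<close>, and the derivative of
  \<open>denom\<close> is bounded away from zero (\<open>denom'_Re_lower_bound\<close>). Hence in a narrow strip the zeros are
  simple with residue \<open>1\<close>, they are separated vertically by a fixed distance, and \<open>denom'/denom\<close> is
  bounded away from them (\<open>zero_control\<close>). A screen runs through this strip and avoids the zeros by
  tent-shaped detours (\<open>screen_exists\<close>).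

  By separation \<open>\<Sum>1/|\<omega>|\<^sup>2\<close> converges over the zeros of the strip. So it pays to work with the primitive of
  \<open>\<psi>\<close>, whose expansion \<open>\<Sum>x\<^bsup>\<omega> + 1\<^esup> / (\<omega> (\<omega> + 1))\<close> converges absolutely. It is obtained pointwise by Laplace
  inversion (\<open>log_integrand_inversion\<close>): for each zero an explicit kernel with the same pole is
  subtracted, the remainder is holomorphic and decays quadratically (\<open>remainder_bound\<close>), and its
  integral moves to the left of the zeros, where it is \<open>O(x\<^bsup>D - 4e + 1\<^esup>)\<close>. Zeros further left than
  \<open>D - 2 * e\<close> may be kept or dropped at the cost of an admissible error, which decouples the formula
  from the precise course of the screen (\<open>explicit_formula\<close>).

  Both assertions follow. Integration by parts against a test function differentiates the pointwise
  formula in the sense of distributions (\<open>distributional_formula\<close>). In the nonlattice case \<open>D\<close> is the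
  only zero on its vertical line (\<open>nonlattice_zero\<close>), so the primitive is asymptotic to
  \<open>x\<^bsup>D + 1\<^esup> / (D (D + 1))\<close>, and as \<open>\<psi>\<close> is monotone this may be differentiated (\<open>monotone_density\<close>).
\<close>


section \<open>Integrals along vertical lines and the Perron kernel\<close>

text \<open>Integrals over a whole vertical line are handled as limits of integrals over symmetric segments,
  so that Cauchy's theorem on rectangles moves them from one line to another.\<close>

abbreviation vertical_integral :: "(complex \<Rightarrow> complex) \<Rightarrow> real \<Rightarrow> real \<Rightarrow> complex" where
  "vertical_integral F c T \<equiv> integral {-T..T} (\<lambda>t. F (Complex c t))"

lemma rectangle_contour_estimate:
  fixes F :: "complex \<Rightarrow> complex"
  assumes ab: "a < b" and T: "0 < T"
    and cont: "continuous_on (path_image (rectpath (Complex a (-T)) (Complex b T))) F"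
    and J: "(F has_contour_integral J) (rectpath (Complex a (-T)) (Complex b T))"
    and M: "\<And>s. \<bar>Im s\<bar> = T \<Longrightarrow> a \<le> Re s \<Longrightarrow> Re s \<le> b \<Longrightarrow> norm (F s) \<le> M"
  shows "norm (vertical_integral F b T - vertical_integral F a T
            + \<i> * J) \<le> 2 * (b - a) * M"
proof -
  let ?p1 = "Complex a (-T)" and ?p2 = "Complex b (-T)" and ?p3 = "Complex b T" and ?p4 = "Complex a T"
  have rect: "rectpath ?p1 ?p3 = linepath ?p1 ?p2 +++ linepath ?p2 ?p3 +++ linepath ?p3 ?p4 +++ linepath ?p4 ?p1"
    by (simp add: rectpath_def Let_def)
  have img: "path_image (rectpath ?p1 ?p3) =
      closed_segment ?p1 ?p2 \<union> closed_segment ?p2 ?p3 \<union> closed_segment ?p3 ?p4 \<union> closed_segment ?p4 ?p1"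
    unfolding rect by (simp add: path_image_join Un_assoc)
  have ci: "F contour_integrable_on linepath ?p1 ?p2" "F contour_integrable_on linepath ?p2 ?p3"
      "F contour_integrable_on linepath ?p3 ?p4" "F contour_integrable_on linepath ?p4 ?p1"
    by (intro contour_integrable_continuous_linepath continuous_on_subset[OF cont], use img in blast)+
  have J_eq: "J = contour_integral (linepath ?p1 ?p2) F + contour_integral (linepath ?p2 ?p3) F
      + contour_integral (linepath ?p3 ?p4) F + contour_integral (linepath ?p4 ?p1) F"
    using contour_integral_unique[OF J] ci unfolding rect
    by (simp add: contour_integral_join contour_integrable_join add_ac)
  have right: "contour_integral (linepath ?p2 ?p3) F = \<i> * vertical_integral F b T"
    using T by (intro contour_integral_linepath_same_Re) auto
  have "contour_integral (linepath ?p1 ?p4) F = \<i> * vertical_integral F a T"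
    using T by (intro contour_integral_linepath_same_Re) auto
  then have left: "contour_integral (linepath ?p4 ?p1) F = - \<i> * vertical_integral F a T"
    using contour_integral_reverse_linepath[of ?p1 ?p4 F] continuous_on_subset[OF cont, of "closed_segment ?p1 ?p4"]
      img closed_segment_commute[of ?p1 ?p4] by simp
  have seg: "norm (F s) \<le> M"
    if "s \<in> closed_segment ?p1 ?p2 \<or> s \<in> closed_segment ?p3 ?p4" for s
  proof -
    have "closed_segment ?p1 ?p2 \<subseteq> cbox ?p1 ?p2" "closed_segment ?p3 ?p4 \<subseteq> cbox ?p4 ?p3"
      using ab by (intro closed_segment_subset convex_box; simp add: in_cbox_complex_iff)+
    with that have "s \<in> cbox ?p1 ?p2 \<or> s \<in> cbox ?p4 ?p3" by blast
    then show ?thesis using T by (intro M) (auto simp: in_cbox_complex_iff)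
  qed
  have "0 \<le> M" using seg[of ?p1] order_trans[OF norm_ge_zero[of "F ?p1"]] by simp
  have bottom: "norm (contour_integral (linepath ?p1 ?p2) F) \<le> M * (b - a)"
    using contour_integral_bound_linepath[OF ci(1) \<open>0 \<le> M\<close>] seg ab
    by (simp add: cmod_def)
  have top: "norm (contour_integral (linepath ?p3 ?p4) F) \<le> M * (b - a)"
    using contour_integral_bound_linepath[OF ci(3) \<open>0 \<le> M\<close>] seg ab
    by (simp add: cmod_def)
  have "vertical_integral F b T - vertical_integral F a T + \<i> * J
      = \<i> * (contour_integral (linepath ?p1 ?p2) F + contour_integral (linepath ?p3 ?p4) F)"
    unfolding J_eq right left by (simp add: algebra_simps)
  also have "norm \<dots> \<le> M * (b - a) + M * (b - a)"
    unfolding norm_mult norm_ii mult_1 by (rule norm_triangle_le[OF add_mono[OF bottom top]])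
  finally show ?thesis by (simp add: algebra_simps)
qed

corollary vertical_shift_estimate:
  fixes F :: "complex \<Rightarrow> complex"
  assumes ab: "a < b" and T: "0 < T"
    and hol: "F holomorphic_on cbox (Complex a (-T)) (Complex b T)"
    and M: "\<And>s. \<bar>Im s\<bar> = T \<Longrightarrow> a \<le> Re s \<Longrightarrow> Re s \<le> b \<Longrightarrow> norm (F s) \<le> M"
  shows "norm (vertical_integral F b T - vertical_integral F a T)
          \<le> 2 * (b - a) * M"
proof -
  have sub: "path_image (rectpath (Complex a (-T)) (Complex b T)) \<subseteq> cbox (Complex a (-T)) (Complex b T)"
    using ab T by (intro path_image_rectpath_subset_cbox) auto
  have "(F has_contour_integral 0) (rectpath (Complex a (-T)) (Complex b T))"
    by (rule Cauchy_theorem_convex_simple[OF hol]) (use sub in auto)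
  from rectangle_contour_estimate[OF ab T _ this M]
  show ?thesis
    using continuous_on_subset[OF holomorphic_on_imp_continuous_on[OF hol] sub] by simp
qed

lemma vertical_integral_bound:
  fixes F :: "complex \<Rightarrow> complex"
  assumes "0 < T" "continuous_on {-T..T} (\<lambda>t. F (Complex a t))"
    and "\<And>t. \<bar>t\<bar> \<le> T \<Longrightarrow> norm (F (Complex a t)) \<le> M"
  shows "norm (vertical_integral F a T) \<le> 2 * T * M"
proof -
  have "norm (vertical_integral F a T) \<le> M * (T - (-T))"
    using assms by (intro integral_bound) auto
  then show ?thesis by (simp add: mult.commute)
qed

text \<open>The contour is closed to the right, where the integrand decays quadratically.\<close>

lemma vertical_integral_tendsto_0:
  fixes F :: "complex \<Rightarrow> complex"
  assumes c: "0 < c" and hol: "F holomorphic_on {s. c \<le> Re s}"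
    and bound: "\<And>s. c \<le> Re s \<Longrightarrow> norm (F s) \<le> C / (norm s)\<^sup>2"
  shows "((\<lambda>T. vertical_integral F c T) \<longlongrightarrow> 0) at_top"
proof (rule Lim_null_comparison)
  have Cpos: "0 \<le> C"
    using bound[of "of_real c"] c order_trans[OF norm_ge_zero]
    by (fastforce simp: zero_le_divide_iff)
  show "eventually (\<lambda>T. norm (vertical_integral F c T) \<le> 4 * C / T) at_top"
    using eventually_gt_at_top[of 0]
  proof eventually_elim
    case (elim T)
    have norm_ge: "norm (F s) \<le> C / T\<^sup>2" if "c \<le> Re s" "T \<le> norm s" for s
    proof -
      have "C / (norm s)\<^sup>2 \<le> C / T\<^sup>2"
        using that(2) elim Cpos by (intro divide_left_mono power_mono mult_pos_pos) auto
      then show ?thesis using bound[OF that(1)] by simp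
    qed
    have cont: "continuous_on {-T..T} (\<lambda>t. F (Complex (c + T) t))"
      by (rule continuous_on_compose2[OF holomorphic_on_imp_continuous_on[OF hol]])
         (use elim in \<open>auto simp: Complex_eq intro!: continuous_intros\<close>)
    have "norm (vertical_integral F (c + T) T - vertical_integral F c T)
          \<le> 2 * ((c + T) - c) * (C / T\<^sup>2)"
    proof (rule vertical_shift_estimate)
      show "F holomorphic_on cbox (Complex c (- T)) (Complex (c + T) T)"
        by (rule holomorphic_on_subset[OF hol]) (auto simp: in_cbox_complex_iff)
      show "norm (F s) \<le> C / T\<^sup>2" if "\<bar>Im s\<bar> = T" "c \<le> Re s" for s
        using that abs_Im_le_cmod[of s] by (intro norm_ge) auto
    qed (use elim in auto)
    moreover have "norm (vertical_integral F (c + T) T) \<le> 2 * T * (C / T\<^sup>2)"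
    proof (rule vertical_integral_bound[OF elim cont])
      show "norm (F (Complex (c + T) t)) \<le> C / T\<^sup>2" for t
        using abs_Re_le_cmod[of "Complex (c + T) t"] c elim by (intro norm_ge) auto
    qed
    ultimately have "norm (vertical_integral F c T) \<le> 2 * T * (C / T\<^sup>2) + 2 * T * (C / T\<^sup>2)"
      by (intro order_trans[OF norm_triangle_sub[of _ "vertical_integral F (c + T) T"] add_mono])
         (simp_all add: norm_minus_commute)
    also have "\<dots> = 4 * C / T" using elim by (simp add: power2_eq_square field_simps)
    finally show ?case .
  qed
  show "((\<lambda>T. 4 * C / T) \<longlongrightarrow> 0) at_top"
    by (intro tendsto_divide_0[OF tendsto_const] filterlim_at_top_imp_at_infinity filterlim_ident)
qed

text \<open>Apart from the factor \<open>exp (s * y)\<close> this is the Laplace transform of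
  \<open>u \<mapsto> e\<^bsup>a u\<^esup> - e\<^bsup>(a - 1) u\<^esup>\<close> on the positive half-line. The second factor of the denominator provides
  quadratic decay along vertical lines; its price is the exponential with exponent \<open>a - 1\<close>, which
  is smaller by a factor \<open>e\<^sup>u\<close>.\<close>

definition perron_kernel :: "complex \<Rightarrow> real \<Rightarrow> complex \<Rightarrow> complex" where
  "perron_kernel a y s = exp (s * of_real y) / ((s - a) * (s - a + 1))"

text \<open>The contour is closed to the left. The left side recedes at the same speed as the horizontal
  sides, so that each of the three sides contributes \<open>O(1/T)\<close>, and the two poles leave the residues.\<close>

lemma perron_kernel_tendsto_nonneg:
  fixes a :: complex
  assumes c: "Re a < c" and y: "0 \<le> y"
  shows "((\<lambda>T. vertical_integral (perron_kernel a y) c T)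
            \<longlongrightarrow> 2 * pi * (exp (a * y) - exp ((a - 1) * y))) at_top"
proof -
  let ?L = "2 * pi * (exp (a * y) - exp ((a - 1) * y)) :: complex"
  define F where "F = perron_kernel a y"
  define E where "E = exp (c * y)"
  have lim: "((\<lambda>T. 2 * (c - (Re a - 1 - T)) * (4 * E / T\<^sup>2) + 2 * T * (E / T\<^sup>2)) \<longlongrightarrow> 0) at_top"
    by real_asymp
  have "((\<lambda>T. ?L - vertical_integral F c T) \<longlongrightarrow> 0) at_top"
  proof (rule Lim_null_comparison[OF _ lim])
    show "eventually (\<lambda>T. norm (?L - vertical_integral F c T)
            \<le> 2 * (c - (Re a - 1 - T)) * (4 * E / T\<^sup>2) + 2 * T * (E / T\<^sup>2)) at_top"
      using eventually_gt_at_top[of "2 * \<bar>Im a\<bar>"] eventually_gt_at_top[of 0]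
    proof eventually_elim
      case (elim T)
      define l where "l = Re a - 1 - T"
      let ?R = "rectpath (Complex l (-T)) (Complex c T)"
      have lc: "l < c" using c elim by (simp add: l_def)
      have sub: "path_image ?R \<subseteq> cbox (Complex l (-T)) (Complex c T)"
        using lc elim by (intro path_image_rectpath_subset_cbox) auto
      have inbox: "a \<in> box (Complex l (-T)) (Complex c T)" "a - 1 \<in> box (Complex l (-T)) (Complex c T)"
        using c elim by (auto simp: in_box_complex_iff l_def)
      have notin: "a \<notin> path_image ?R" "a - 1 \<notin> path_image ?R"
        using inbox path_image_rectpath_inter_box[of "Complex l (-T)" "Complex c T"] lc elim by auto
      have cauchy: "((\<lambda>s. exp (s * of_real y) / (s - z)) has_contour_integral
                (2 * pi * \<i> * exp (z * y))) ?R"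
        if "z \<in> box (Complex l (-T)) (Complex c T)" "z \<notin> path_image ?R" for z :: complex
      proof -
        have "((\<lambda>s. exp (s * of_real y) / (s - z)) has_contour_integral
                (2 * pi * \<i> * winding_number ?R z * exp (z * y))) ?R"
          by (rule Cauchy_integral_formula_convex_simple[of UNIV])
             (use that in \<open>auto intro!: holomorphic_intros\<close>)
        then show ?thesis using winding_number_rectpath[OF that(1)] by simp
      qed
      have split: "F s = exp (s * of_real y) / (s - a) - exp (s * of_real y) / (s - (a - 1))"
        if "s \<noteq> a" "s \<noteq> a - 1" for s
      proof -
        have "s - a + 1 \<noteq> 0" using that(2) by (auto simp: complex_eq_iff)
        moreover have "s - a \<noteq> 0" using that by simp
        moreover have "e / (u * (u + 1)) = e / u - e / (u + 1)" if "u \<noteq> 0" "u + 1 \<noteq> 0" for e u :: complex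
          using that by (simp add: field_simps)
        ultimately show ?thesis
          unfolding F_def perron_kernel_def by (simp add: diff_diff_eq2)
      qed
      have "((\<lambda>s. exp (s * of_real y) / (s - a) - exp (s * of_real y) / (s - (a - 1)))
              has_contour_integral (2 * pi * \<i> * exp (a * y) - 2 * pi * \<i> * exp ((a - 1) * y))) ?R"
        using has_contour_integral_diff[OF cauchy[OF inbox(1) notin(1)] cauchy[OF inbox(2) notin(2)]] by simp
      then have "(F has_contour_integral (2 * pi * \<i> * exp (a * y) - 2 * pi * \<i> * exp ((a - 1) * y))) ?R"
        proof (rule has_contour_integral_eq)
          fix s assume "s \<in> path_image ?R"
          then have "s \<noteq> a" "s \<noteq> a - 1" using notin by auto
          from split[OF this] show "exp (s * of_real y) / (s - a) - exp (s * of_real y) / (s - (a - 1)) = F s" by simp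
        qed
      then have J: "(F has_contour_integral (\<i> * ?L)) ?R"
        by (simp add: algebra_simps)
      have cont: "continuous_on (path_image ?R) F"
      proof -
        have "s - a \<noteq> 0 \<and> s - a + 1 \<noteq> 0" if "s \<in> path_image ?R" for s
        proof -
          have "s \<noteq> a" "s \<noteq> a - 1" using that notin by auto
          then show ?thesis by (auto simp: complex_eq_iff)
        qed
        then show ?thesis
          unfolding F_def perron_kernel_def by (intro continuous_intros) auto
      qed
      have bnd: "norm (F s) \<le> E / (m * n)"
        if "Re s \<le> c" "m \<le> norm (s - a)" "n \<le> norm (s - a + 1)" "0 < m" "0 < n" for s m n
      proof -
        have "norm (exp (s * of_real y)) \<le> E"
          unfolding E_def using that(1) y by (auto intro!: mult_right_mono)
        then show ?thesis unfolding F_def perron_kernel_def norm_divide norm_mult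
          using that by (intro frac_le mult_mono) (auto simp: E_def)
      qed
      let ?I = "\<lambda>r. vertical_integral F r T"
      have 1: "norm (?I c - ?I l + \<i> * (\<i> * ?L)) \<le> 2 * (c - l) * (4 * E / T\<^sup>2)"
      proof (rule rectangle_contour_estimate[OF lc _ cont J])
        fix s assume s: "\<bar>Im s\<bar> = T" "Re s \<le> c"
        have "T / 2 \<le> \<bar>Im (s - a)\<bar>" unfolding minus_complex.sel using elim s by linarith
        then have "T / 2 \<le> norm (s - a)" "T / 2 \<le> norm (s - a + 1)"
          using abs_Im_le_cmod[of "s - a"] abs_Im_le_cmod[of "s - a + 1"] by auto
        then show "norm (F s) \<le> 4 * E / T\<^sup>2"
          using bnd[OF s(2), of "T/2" "T/2"] elim by (simp add: power2_eq_square mult.commute)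
      qed (use elim in auto)
      have 2: "norm (?I l) \<le> 2 * T * (E / T\<^sup>2)"
      proof (rule vertical_integral_bound)
        have ne: "Complex l t - a \<noteq> 0 \<and> Complex l t - a + 1 \<noteq> 0" for t
          using elim by (auto simp: l_def complex_eq_iff)
        show "continuous_on {-T..T} (\<lambda>t. F (Complex l t))"
          unfolding F_def perron_kernel_def using ne
          by (auto simp: Complex_eq intro!: continuous_intros)
        show "norm (F (Complex l t)) \<le> E / T\<^sup>2" for t
          using bnd[of "Complex l t" T T] lc elim
            abs_Re_le_cmod[of "Complex l t - a"] abs_Re_le_cmod[of "Complex l t - a + 1"]
          by (auto simp: l_def power2_eq_square)
      qed (use elim in auto)
      have "\<i> * (\<i> * ?L) = - ?L" by (metis i_squared mult.assoc mult_minus1)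
      then have "?L - ?I c = - (?I c - ?I l + \<i> * (\<i> * ?L)) - ?I l" by simp
      then have "norm (?L - ?I c) \<le> norm (?I c - ?I l + \<i> * (\<i> * ?L)) + norm (?I l)"
        by (metis norm_minus_cancel norm_triangle_ineq4)
      from order_trans[OF this add_mono[OF 1 2]] show ?case
        by (simp only: l_def)
    qed
  qed
  from tendsto_diff[OF tendsto_const[of ?L] this] show ?thesis
    by (simp add: F_def)
qed

lemma perron_kernel_tendsto_neg:
  assumes c: "0 < c" and y: "y \<le> 0"
  shows "((\<lambda>T. vertical_integral (perron_kernel 0 y) c T) \<longlongrightarrow> 0) at_top"
proof (rule vertical_integral_tendsto_0[OF c])
  show "perron_kernel 0 y holomorphic_on {s. c \<le> Re s}"
  proof -
    have "s \<noteq> 0 \<and> s + 1 \<noteq> 0" if "c \<le> Re s" for s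
      using that c by (auto simp: complex_eq_iff)
    then show ?thesis
      unfolding perron_kernel_def by (intro holomorphic_intros) auto
  qed
  fix s assume s: "c \<le> Re s"
  have "norm s \<le> norm (s + 1)"
    using s c unfolding cmod_def by (auto intro!: real_sqrt_le_mono power_mono)
  moreover have "norm (exp (s * of_real y)) \<le> 1" using s c y by (auto simp: mult_nonneg_nonpos)
  moreover have "0 < norm s" using s c by auto
  ultimately show "norm (perron_kernel 0 y s) \<le> 1 / (norm s)\<^sup>2"
    unfolding perron_kernel_def norm_divide norm_mult power2_eq_square
    by (intro frac_le mult_mono) auto
qed

section \<open>Zeros close to the line of real part D\<close>

locale self_similar =
  fixes N :: nat and w :: "nat \<Rightarrow> real"
  assumes flow: "self_similar_flow N w"
begin

abbreviation D :: real where "D \<equiv> flow_dimension N w"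

definition denom :: "complex \<Rightarrow> complex" where
  "denom s = 1 - (\<Sum>j=1..N. exp (- (of_real (w j) * s)))"

definition denom' :: "complex \<Rightarrow> complex" where
  "denom' s = (\<Sum>j=1..N. of_real (w j) * exp (- (of_real (w j) * s)))"

lemma w_pos: "j \<in> {1..N} \<Longrightarrow> 0 < w j"
  using self_similar_flow_weight_pos[OF flow] .

lemma w_bounds:
  assumes "j \<in> {1..N}" shows "w 1 \<le> w j" "w j \<le> w N"
proof -
  have "mono_on {1..N} w" using flow by (simp add: self_similar_flow_def)
  then show "w 1 \<le> w j" "w j \<le> w N" using assms by (auto intro: mono_onD)
qed

lemma N_ge_2: "2 \<le> N"
  using flow by (simp add: self_similar_flow_def)

lemma D_eq: "(\<Sum>j=1..N. exp (- (w j * D))) = 1"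
  unfolding flow_dimension_def by (rule theI'[OF flow_dimension_exists_unique[OF flow]])

lemma exp_sum_strict_antimono:
  assumes "s < t"
  shows "(\<Sum>j=1..N. exp (- (w j * t))) < (\<Sum>j=1..N. exp (- (w j * s)))"
  using N_ge_2 assms w_pos by (intro sum_strict_mono) auto

lemma exp_sum_antimono:
  assumes "s \<le> t"
  shows "(\<Sum>j=1..N. exp (- (w j * t))) \<le> (\<Sum>j=1..N. exp (- (w j * s)))"
  using exp_sum_strict_antimono[of s t] assms by (cases "s = t") auto

lemma D_pos: "0 < D"
proof (rule ccontr)
  assume "\<not> 0 < D"
  then have "(\<Sum>j=1..N. exp (- (w j * 0))) \<le> (\<Sum>j=1..N. exp (- (w j * D)))"
    by (intro exp_sum_antimono) auto
  then show False using N_ge_2 D_eq by simp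
qed

lemma denom_has_deriv [derivative_intros]:
  "(denom has_field_derivative denom' s) (at s within X)"
  unfolding denom_def denom'_def
  by (auto intro!: derivative_eq_intros sum.cong simp: sum_negf[symmetric])

lemma denom_holomorphic: "denom holomorphic_on X"
  unfolding denom_def by (intro holomorphic_intros)

lemma denom'_holomorphic: "denom' holomorphic_on X"
  unfolding denom'_def by (intro holomorphic_intros)

lemma denom_right_bound:
  "1 - (\<Sum>j=1..N. exp (- (w j * Re s))) \<le> norm (denom s)"
proof -
  have "norm (\<Sum>j=1..N. exp (- (of_real (w j) * s))) \<le> (\<Sum>j=1..N. exp (- (w j * Re s)))"
    by (intro sum_norm_le) simp
  then show ?thesis
    unfolding denom_def using norm_triangle_ineq2[of 1 "\<Sum>j=1..N. exp (- (of_real (w j) * s))"] by simp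
qed

lemma denom_zero_Re_le:
  assumes "denom s = 0" shows "Re s \<le> D"
  using denom_right_bound[of s] exp_sum_strict_antimono[of D "Re s"] D_eq assms by fastforce

lemma denom'_bound:
  assumes "\<sigma> \<le> Re s"
  shows "norm (denom' s) \<le> (\<Sum>j=1..N. w j * exp (- (w j * \<sigma>)))"
  unfolding denom'_def
proof (intro sum_norm_le)
  fix j assume j: "j \<in> {1..N}"
  show "norm (of_real (w j) * exp (- (of_real (w j) * s))) \<le> w j * exp (- (w j * \<sigma>))"
    using w_pos[OF j] assms by (simp add: norm_mult)
qed

text \<open>If \<open>|denom s|\<close> is small and \<open>Re s\<close> is close to \<open>D\<close>, then \<open>\<Sum>e\<^bsup>-w\<^sub>j \<sigma>\<^esup> (1 - cos (w\<^sub>j t))\<close>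
  is small, that is, all the phases \<open>w\<^sub>j t\<close> are close to multiples of \<open>2\<pi>\<close>, so that the derivative
  is close to its positive value at a real point.\<close>

lemma denom'_Re_lower_bound:
  assumes eta: "(w 1 + 2 * w N) * \<eta> \<le> w 1 / 2" "0 \<le> \<eta>"
    and sum: "(\<Sum>j=1..N. exp (- (w j * Re s))) \<le> 1 + \<eta>"
    and small: "norm (denom s) \<le> \<eta>"
  shows "w 1 / 2 \<le> Re (denom' s)"
proof -
  define E where "E j = exp (- (w j * Re s))" for j
  define c where "c j = cos (w j * Im s)" for j
  have Re_exp: "Re (exp (- (of_real (w j) * s))) = E j * c j" for j
    by (simp add: Re_exp E_def c_def)
  have w1: "0 < w 1" using w_pos[of 1] N_ge_2 by simp
  have wN: "0 < w N" using w_pos[of N] N_ge_2 by simp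
  have "1 - Re (denom s) = (\<Sum>j=1..N. E j * c j)"
    by (simp add: denom_def Re_exp)
  then have lower: "1 - \<eta> \<le> (\<Sum>j=1..N. E j * c j)"
    using small abs_Re_le_cmod[of "denom s"] by linarith
  have Ec: "E j * c j \<le> E j" for j by (simp add: E_def c_def)
  have total: "1 - \<eta> \<le> (\<Sum>j=1..N. E j)"
    using lower sum_mono[of "{1..N}" "\<lambda>j. E j * c j" E] Ec by simp
  have defect: "(\<Sum>j=1..N. E j - E j * c j) \<le> 2 * \<eta>"
    using lower sum unfolding sum_subtractf E_def[symmetric] by linarith
  have "w 1 * (1 - \<eta>) - w N * (2 * \<eta>)
      \<le> w 1 * (\<Sum>j=1..N. E j) - w N * (\<Sum>j=1..N. E j - E j * c j)"
    using total defect w1 wN by (intro diff_mono mult_left_mono) auto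
  also have "\<dots> = (\<Sum>j=1..N. w 1 * E j - w N * (E j - E j * c j))"
    by (simp only: sum_distrib_left sum_subtractf[symmetric])
  also have "\<dots> \<le> (\<Sum>j=1..N. w j * E j - w j * (E j - E j * c j))"
    using w_bounds Ec by (intro sum_mono diff_mono mult_right_mono) (auto simp: E_def)
  also have "\<dots> = Re (denom' s)"
    by (simp add: denom'_def Re_exp right_diff_distrib)
  finally show ?thesis using eta by (simp add: algebra_simps)
qed

lemma denom_Taylor:
  obtains B where "B > 0" "\<And>s. D - 1 \<le> Re s \<Longrightarrow> norm (denom' s) \<le> B"
    "\<And>s z. D - 1 \<le> Re s \<Longrightarrow> D - 1 \<le> Re z \<Longrightarrow>
        norm (denom z - denom s - denom' s * (z - s)) \<le> B * (norm (z - s))\<^sup>2"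
proof -
  define B1 where "B1 = (\<Sum>j=1..N. w j * exp (- (w j * (D - 1))))"
  define B2 where "B2 = (\<Sum>j=1..N. (w j)\<^sup>2 * exp (- (w j * (D - 1))))"
  define f2 where "f2 s = - (\<Sum>j=1..N. of_real ((w j)\<^sup>2) * exp (- (of_real (w j) * s)))" for s :: complex
  define ds where "ds n = (if n = 0 then denom else if n = Suc 0 then denom' else f2)" for n :: nat
  have "0 \<le> B1" "0 \<le> B2"
    unfolding B1_def B2_def using w_pos by (auto intro!: sum_nonneg simp: less_imp_le)
  have deriv': "(denom' has_field_derivative f2 s) (at s within X)" for s X
    unfolding denom'_def f2_def
    by (auto intro!: derivative_eq_intros sum.cong simp: sum_negf[symmetric] power2_eq_square)
  have bound2: "norm (f2 s) \<le> B2" if "D - 1 \<le> Re s" for s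
    unfolding f2_def B2_def norm_minus_cancel
  proof (intro sum_norm_le)
    fix j assume j: "j \<in> {1..N}"
    show "norm (of_real ((w j)\<^sup>2) * exp (- (of_real (w j) * s))) \<le> (w j)\<^sup>2 * exp (- (w j * (D - 1)))"
      using w_pos[OF j] that by (simp add: norm_mult norm_power)
  qed
  have Taylor: "norm (denom z - denom s - denom' s * (z - s)) \<le> B2 * (norm (z - s))\<^sup>2"
    if "D - 1 \<le> Re s" "D - 1 \<le> Re z" for s z
  proof -
    have "norm (ds 0 z - (\<Sum>i\<le>1. ds i s * (z - s) ^ i / fact i)) \<le> B2 * norm (z - s) ^ Suc 1 / fact 1"
    proof (rule complex_Taylor[of "{s. D - 1 \<le> Re s}"])
      show "convex {s. D - 1 \<le> Re s}" using convex_halfspace_Re_ge[of "D - 1"] by simp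
      show "(ds i has_field_derivative ds (Suc i) x) (at x within {s. D - 1 \<le> Re s})" if "i \<le> 1" for i x
        using that deriv' denom_has_deriv by (cases "i = 0") (auto simp: ds_def)
      show "norm (ds (Suc 1) x) \<le> B2" if "x \<in> {s. D - 1 \<le> Re s}" for x
        using that bound2 by (simp add: ds_def)
    qed (use that in auto)
    then show ?thesis by (simp add: ds_def power2_eq_square diff_diff_eq)
  qed
  show ?thesis
  proof
    show "0 < B1 + B2 + 1" using \<open>0 \<le> B1\<close> \<open>0 \<le> B2\<close> by simp
    show "norm (denom' s) \<le> B1 + B2 + 1" if "D - 1 \<le> Re s" for s
      using denom'_bound[OF that] \<open>0 \<le> B2\<close> by (simp add: B1_def)
    show "norm (denom z - denom s - denom' s * (z - s)) \<le> (B1 + B2 + 1) * (norm (z - s))\<^sup>2"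
      if "D - 1 \<le> Re s" "D - 1 \<le> Re z" for s z
      using Taylor[OF that] mult_right_mono[of B2 "B1 + B2 + 1" "(norm (z - s))\<^sup>2"] \<open>0 \<le> B1\<close> by simp
  qed
qed

end

text \<open>This is the minimum modulus principle, read off from Cauchy's estimate for \<open>1/f\<close>.\<close>

lemma zero_free_disc_lower_bound:
  fixes f :: "complex \<Rightarrow> complex"
  assumes hol: "f holomorphic_on cball s \<rho>" and rho: "0 < \<rho>" and m: "0 < m"
    and nz: "\<And>z. z \<in> cball s \<rho> \<Longrightarrow> f z \<noteq> 0"
    and sphere: "\<And>z. norm (s - z) = \<rho> \<Longrightarrow> m \<le> norm (f z)"
  shows "m \<le> norm (f s)"
proof -
  have h: "(\<lambda>z. inverse (f z)) holomorphic_on cball s \<rho>"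
    using nz by (intro holomorphic_intros hol) auto
  have "norm ((deriv ^^ 0) (\<lambda>z. inverse (f z)) s) \<le> fact 0 * (1 / m) / \<rho> ^ 0"
  proof (rule Cauchy_inequality[OF _ _ rho])
    show "norm (inverse (f x)) \<le> 1 / m" if "norm (s - x) = \<rho>" for x
      using sphere[OF that] m by (simp add: norm_divide inverse_eq_divide frac_le)
  qed (use h holomorphic_on_subset[OF h ball_subset_cball] holomorphic_on_imp_continuous_on in auto)
  then have "1 / norm (f s) \<le> 1 / m" by (simp add: norm_divide inverse_eq_divide)
  moreover have "0 < norm (f s)" using nz[of s] rho by simp
  ultimately show ?thesis using m by (simp add: field_simps)
qed

text \<open>Quantitative control of the zeros close to the line of real part \<open>D\<close>: \<open>e\<close> is the unit of
  length in which the geometry of the strip is measured, and \<open>24 * e\<close> is a radius on which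
  \<open>denom\<close> is close to linear around each zero. The zeros in question lie in a strip of width
  \<open>6 * e\<close>, which is narrow compared with this radius; hence their imaginary parts are separated.\<close>

locale zero_control = self_similar +
  fixes e A B :: real
  assumes pos: "0 < e" "0 < A" "0 < B" and e_small: "6 * e < D" "30 * e \<le> 1"
    and denom'_le: "D - 1 \<le> Re s \<Longrightarrow> norm (denom' s) \<le> B"
    and zero_simple: "denom \<omega> = 0 \<Longrightarrow> D - 6 * e \<le> Re \<omega> \<Longrightarrow> denom' \<omega> \<noteq> 0"
    and zero_lower: "denom \<omega> = 0 \<Longrightarrow> D - 6 * e \<le> Re \<omega> \<Longrightarrow> D - 1 \<le> Re s \<Longrightarrow> norm (s - \<omega>) \<le> 24 * e \<Longrightarrow>
        A * norm (s - \<omega>) \<le> norm (denom s)"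
    and zero_linear: "denom \<omega> = 0 \<Longrightarrow> D - 6 * e \<le> Re \<omega> \<Longrightarrow> D - 1 \<le> Re s \<Longrightarrow>
        norm (denom' s * (s - \<omega>) - denom s) \<le> B * (norm (s - \<omega>))\<^sup>2"
    and zero_free_lower: "D - 5 * e \<le> Re s \<Longrightarrow> 0 < \<rho> \<Longrightarrow> \<rho> \<le> e \<Longrightarrow>
        (\<And>z. norm (s - z) \<le> \<rho> \<Longrightarrow> denom z \<noteq> 0) \<Longrightarrow> A * \<rho> \<le> norm (denom s)"

text \<open>The strip is chosen so narrow that the exponential sum stays below \<open>1 + \<eta>\<close> on it; then
  \<open>|denom s| \<le> \<eta>\<close> forces \<open>|denom' s| \<ge> 2a\<close>. The radius \<open>24 * e\<close> is chosen so small that the quadratic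
  term of Taylor's formula, at most \<open>B |s - \<omega>|\<^sup>2\<close>, costs at most half of the linear one. A disc without
  zeros is treated by the minimum modulus principle: if \<open>|denom|\<close> were small at the centre, the linear
  term would make it large on the boundary.\<close>

lemma (in self_similar) ex_zero_control: "\<exists>e A B. zero_control N w e A B"
proof -
  obtain B where B: "B > 0" "\<And>s. D - 1 \<le> Re s \<Longrightarrow> norm (denom' s) \<le> B"
    and Taylor: "\<And>s z. D - 1 \<le> Re s \<Longrightarrow> D - 1 \<le> Re z \<Longrightarrow>
        norm (denom z - denom s - denom' s * (z - s)) \<le> B * (norm (z - s))\<^sup>2"
    using denom_Taylor by blast
  have w1: "0 < w 1" and wN: "0 < w N" using w_pos N_ge_2 by auto
  define \<eta> where "\<eta> = (w 1 / 2) / (w 1 + 2 * w N)"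
  define a where "a = w 1 / 4"
  have "w 1 + 2 * w N \<noteq> 0" using w1 wN by simp
  then have "(w 1 + 2 * w N) * \<eta> = w 1 / 2"
    unfolding \<eta>_def by (rule nonzero_mult_div_cancel_left[THEN trans[OF times_divide_eq_right]])
  then have eta: "0 < \<eta>" "(w 1 + 2 * w N) * \<eta> \<le> w 1 / 2" and a: "0 < a"
    using w1 wN by (auto simp: \<eta>_def a_def)
  have "isCont (\<lambda>s. \<Sum>j=1..N. exp (- (w j * s))) D" by (intro continuous_intros)
  then obtain d where d: "d > 0" "\<And>x. dist x D < d \<Longrightarrow>
      dist (\<Sum>j=1..N. exp (- (w j * x))) (\<Sum>j=1..N. exp (- (w j * D))) < \<eta>"
    using eta(1) unfolding continuous_at_eps_delta by blast
  \<comment> \<open>The four bounds serve the strip, \<open>6 * e < D\<close>, \<open>30 * e \<le> 1\<close> and the quadratic term, respectively.\<close>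
  define e where "e = Min {d / 7, D / 7, 1 / 30, a / (24 * B)}"
  have e: "0 < e" "e \<le> d / 7" "e \<le> D / 7" "e \<le> 1 / 30" "e \<le> a / (24 * B)"
    using d(1) D_pos a B(1) by (auto simp: e_def)
  have Be: "B * (24 * e) \<le> a" using e(5) B(1) by (simp add: field_simps)
  have sum_le: "(\<Sum>j=1..N. exp (- (w j * Re s))) \<le> 1 + \<eta>" if "D - 6 * e \<le> Re s" for s
  proof -
    have "dist (D - 6 * e) D < d" using e by (simp add: dist_real_def)
    then have "(\<Sum>j=1..N. exp (- (w j * (D - 6 * e)))) \<le> 1 + \<eta>"
      using d(2)[of "D - 6 * e"] D_eq by (simp add: dist_real_def)
    with exp_sum_antimono[OF that] show ?thesis by simp
  qed
  have deriv_lower: "2 * a \<le> norm (denom' s)" if "D - 6 * e \<le> Re s" "norm (denom s) \<le> \<eta>" for s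
  proof -
    have "w 1 / 2 \<le> Re (denom' s)"
      using denom'_Re_lower_bound[OF eta(2) less_imp_le[OF eta(1)] sum_le[OF that(1)] that(2)] .
    then show ?thesis using complex_Re_le_cmod[of "denom' s"] by (simp add: a_def)
  qed
  have lower: "a * norm (s - \<omega>) - norm (denom \<omega>) \<le> norm (denom s)"
    if "norm (denom \<omega>) \<le> \<eta>" "D - 6 * e \<le> Re \<omega>" "D - 1 \<le> Re s" "norm (s - \<omega>) \<le> 24 * e" for \<omega> s
  proof -
    have "2 * a * norm (s - \<omega>) \<le> norm (denom' \<omega>) * norm (s - \<omega>)"
      using deriv_lower[OF that(2,1)] by (intro mult_right_mono) auto
    moreover have "norm (denom' \<omega> * (s - \<omega>)) \<le> norm (denom s) + norm (denom \<omega>) + B * (norm (s - \<omega>))\<^sup>2"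
    proof -
      have "denom' \<omega> * (s - \<omega>) = denom s - denom \<omega> - (denom s - denom \<omega> - denom' \<omega> * (s - \<omega>))" by simp
      also have "norm \<dots> \<le> norm (denom s) + norm (denom \<omega>) + norm (denom s - denom \<omega> - denom' \<omega> * (s - \<omega>))"
        by (meson norm_triangle_le_diff norm_triangle_ineq4 add_right_mono order_trans)
      finally show ?thesis using Taylor[of \<omega> s] that e by simp
    qed
    moreover have "B * (norm (s - \<omega>))\<^sup>2 \<le> a * norm (s - \<omega>)"
      using mult_right_mono[OF order_trans[OF mult_left_mono[OF that(4), of B] Be], of "norm (s - \<omega>)"] B(1)
      by (simp add: power2_eq_square mult.assoc)
    ultimately show ?thesis by (simp add: norm_mult)
  qed
  define A where "A = min (a / 2) (\<eta> / e)"
  have A: "0 < A" "A \<le> a / 2" "A * e \<le> \<eta>"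
    using a eta e(1) by (auto simp: A_def min_def field_simps split: if_splits)
  have "zero_control N w e A B"
  proof unfold_locales
    fix \<omega> s assume z: "denom \<omega> = 0" "D - 6 * e \<le> Re \<omega>"
    show "denom' \<omega> \<noteq> 0" using deriv_lower[of \<omega>] z eta a by auto
    assume s: "D - 1 \<le> Re s"
    show "norm (denom' s * (s - \<omega>) - denom s) \<le> B * (norm (s - \<omega>))\<^sup>2"
    proof -
      have eq: "denom' s * (s - \<omega>) - denom s = denom \<omega> - denom s - denom' s * (\<omega> - s)"
        using z by (simp add: algebra_simps)
      show ?thesis
        unfolding eq norm_minus_commute[of s \<omega>] by (rule Taylor[OF s]) (use z e in simp)
    qed
    assume "norm (s - \<omega>) \<le> 24 * e"
    then have "a * norm (s - \<omega>) \<le> norm (denom s)" using lower[of \<omega> s] z eta s by simp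
    then show "A * norm (s - \<omega>) \<le> norm (denom s)"
      using A a mult_right_mono[of A a "norm (s - \<omega>)"] by simp
  next
    fix s \<rho> assume s: "D - 5 * e \<le> Re s" and rho: "0 < \<rho>" "\<rho> \<le> e"
      and nz: "\<And>z. norm (s - z) \<le> \<rho> \<Longrightarrow> denom z \<noteq> 0"
    show "A * \<rho> \<le> norm (denom s)"
    proof (rule ccontr)
      assume "\<not> ?thesis"
      then have small: "norm (denom s) < A * \<rho>" by simp
      have "A * \<rho> \<le> A * e" using A rho by (intro mult_left_mono) auto
      then have le_eta: "norm (denom s) \<le> \<eta>" using small A by linarith
      have "A * \<rho> \<le> a / 2 * \<rho>" using A rho by (intro mult_right_mono) auto
      then have gap: "norm (denom s) < a * \<rho> - norm (denom s)" using small by linarith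
      have "a * \<rho> - norm (denom s) \<le> norm (denom s)"
      proof (rule zero_free_disc_lower_bound[OF denom_holomorphic rho(1)])
        show "0 < a * \<rho> - norm (denom s)" using gap norm_ge_zero[of "denom s"] by linarith
        show "denom z \<noteq> 0" if "z \<in> cball s \<rho>" for z using nz that by (simp add: dist_norm)
        show "a * \<rho> - norm (denom s) \<le> norm (denom z)" if z: "norm (s - z) = \<rho>" for z
        proof -
          have "\<bar>Re (s - z)\<bar> \<le> \<rho>" using abs_Re_le_cmod[of "s - z"] z by simp
          then have "D - 1 \<le> Re z" using s e rho by simp
          then show ?thesis
            using lower[OF le_eta _ \<open>D - 1 \<le> Re z\<close>] s e rho z by (simp add: norm_minus_commute)
        qed
      qed
      with gap show False by simp
    qed
  qed (use e a B A in auto)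
  then show ?thesis by blast
qed

section \<open>Sums over vertically separated sets\<close>

lemma sum_int_inverse_square_bounded:
  obtains K where "K > 0" "\<And>M :: int set. finite M \<Longrightarrow> (\<Sum>m\<in>M. 1 / (1 + (real_of_int m)\<^sup>2)) \<le> K"
proof -
  define g where "g n = 1 / (1 + (real n)\<^sup>2)" for n :: nat
  have "summable (\<lambda>n. 1 / real ((n + 1)\<^sup>2))"
    using inverse_squares_sums by (simp add: sums_iff)
  moreover have "g \<in> O(\<lambda>n. 1 / real ((n + 1)\<^sup>2))" unfolding g_def by real_asymp
  ultimately have summ: "summable g"
    by (intro summable_comparison_test_bigo[of "\<lambda>n. 1 / real ((n + 1)\<^sup>2)" g]) auto
  have g_nonneg: "0 \<le> g n" for n by (simp add: g_def)
  have "(\<Sum>m\<in>M. 1 / (1 + (real_of_int m)\<^sup>2)) \<le> 2 * suminf g + 1" if M: "finite M" for M :: "int set"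
  proof -
    let ?P = "M \<inter> {0..}" and ?Q = "M \<inter> {..<0}"
    have side: "(\<Sum>m\<in>S. 1 / (1 + (real_of_int m)\<^sup>2)) \<le> suminf g"
      if "finite S" "inj_on (\<lambda>m. nat \<bar>m\<bar>) S" for S
    proof -
      have "(\<Sum>m\<in>S. 1 / (1 + (real_of_int m)\<^sup>2)) = (\<Sum>m\<in>S. g (nat \<bar>m\<bar>))"
        by (simp add: g_def)
      also have "\<dots> = sum g ((\<lambda>m. nat \<bar>m\<bar>) ` S)"
        using that(2) by (simp add: sum.reindex)
      also have "\<dots> \<le> suminf g"
        using that(1) by (intro sum_le_suminf summ) (auto simp: g_nonneg)
      finally show ?thesis .
    qed
    have "M = ?P \<union> ?Q" by auto
    then have "(\<Sum>m\<in>M. 1 / (1 + (real_of_int m)\<^sup>2)) =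
       (\<Sum>m\<in>?P. 1 / (1 + (real_of_int m)\<^sup>2)) + (\<Sum>m\<in>?Q. 1 / (1 + (real_of_int m)\<^sup>2))"
      using M by (subst \<open>M = _\<close>, subst sum.union_disjoint) auto
    moreover have "inj_on (\<lambda>m. nat \<bar>m\<bar>) ?P" "inj_on (\<lambda>m. nat \<bar>m\<bar>) ?Q"
      by (auto simp: inj_on_def)
    ultimately show ?thesis
      using side[of ?P] side[of ?Q] M by auto
  qed
  moreover have "0 < 2 * suminf g + 1" using suminf_nonneg[OF summ g_nonneg] by simp
  ultimately show ?thesis using that by blast
qed

text \<open>The integer part of \<open>(Im \<omega> - Im z) / h\<close> enumerates a separated set, and the distance to \<open>z\<close>
  grows at least linearly in it.\<close>

lemma separated_inverse_square_sum:
  fixes h \<rho> :: real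
  assumes h: "0 < h" and rho: "0 < \<rho>"
  obtains K where "K > 0"
    "\<And>F z. finite F \<Longrightarrow>
       (\<And>\<omega> \<omega>'. \<omega> \<in> F \<Longrightarrow> \<omega>' \<in> F \<Longrightarrow> \<omega> \<noteq> \<omega>' \<Longrightarrow> h \<le> \<bar>Im \<omega> - Im \<omega>'\<bar>) \<Longrightarrow>
       (\<And>\<omega>. \<omega> \<in> F \<Longrightarrow> \<rho> \<le> norm (z - \<omega>)) \<Longrightarrow>
       (\<Sum>\<omega>\<in>F. 1 / (norm (z - \<omega>))\<^sup>2) \<le> K"
proof -
  obtain K0 where K0: "K0 > 0" "\<And>M :: int set. finite M \<Longrightarrow> (\<Sum>m\<in>M. 1 / (1 + (real_of_int m)\<^sup>2)) \<le> K0"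
    using sum_int_inverse_square_bounded by blast
  define k where "k = (1 / \<rho>)\<^sup>2 + (1 / h + 1 / \<rho>)\<^sup>2"
  have k: "k > 0" using rho by (auto simp: k_def intro!: add_pos_nonneg)
  have "(\<Sum>\<omega>\<in>F. 1 / (norm (z - \<omega>))\<^sup>2) \<le> k * K0"
    if fin: "finite F"
      and sep: "\<And>\<omega> \<omega>'. \<omega> \<in> F \<Longrightarrow> \<omega>' \<in> F \<Longrightarrow> \<omega> \<noteq> \<omega>' \<Longrightarrow> h \<le> \<bar>Im \<omega> - Im \<omega>'\<bar>"
      and far: "\<And>\<omega>. \<omega> \<in> F \<Longrightarrow> \<rho> \<le> norm (z - \<omega>)" for F z
  proof -
    define m where "m \<omega> = \<lfloor>(Im \<omega> - Im z) / h\<rfloor>" for \<omega>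
    have inj: "inj_on m F"
    proof (rule inj_onI, rule ccontr)
      fix \<omega> \<omega>' assume F: "\<omega> \<in> F" "\<omega>' \<in> F" and eq: "m \<omega> = m \<omega>'" and ne: "\<omega> \<noteq> \<omega>'"
      have "\<bar>(Im \<omega> - Im z) / h - (Im \<omega>' - Im z) / h\<bar> < 1"
        using eq unfolding m_def by linarith
      then have "\<bar>Im \<omega> - Im \<omega>'\<bar> < h"
        using h by (simp add: diff_divide_distrib[symmetric] field_simps)
      with sep[OF F ne] show False by simp
    qed
    have summand: "1 / (norm (z - \<omega>))\<^sup>2 \<le> k * (1 / (1 + (real_of_int (m \<omega>))\<^sup>2))" if "\<omega> \<in> F" for \<omega>
    proof -
      let ?d = "norm (z - \<omega>)"
      have d: "\<rho> \<le> ?d" "0 < ?d" using far[OF that] rho by auto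
      have "\<bar>real_of_int (m \<omega>)\<bar> \<le> \<bar>(Im \<omega> - Im z) / h\<bar> + 1" unfolding m_def by linarith
      also have "\<bar>(Im \<omega> - Im z) / h\<bar> \<le> ?d / h"
        using abs_Im_le_cmod[of "z - \<omega>"] h by (simp add: divide_right_mono)
      also have "?d / h + 1 \<le> ?d * (1 / h + 1 / \<rho>)"
        using d rho by (simp add: field_simps)
      finally have "(real_of_int (m \<omega>))\<^sup>2 \<le> (?d * (1 / h + 1 / \<rho>))\<^sup>2"
        using power_mono[OF _ abs_ge_zero, of "real_of_int (m \<omega>)" _ 2] by simp
      moreover have "1 \<le> (?d * (1 / \<rho>))\<^sup>2"
        using d rho by (simp add: field_simps)
      ultimately have "1 + (real_of_int (m \<omega>))\<^sup>2 \<le> (?d * (1 / \<rho>))\<^sup>2 + (?d * (1 / h + 1 / \<rho>))\<^sup>2"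
        by linarith
      also have "\<dots> = k * ?d\<^sup>2"
        by (simp only: k_def power_mult_distrib distrib_right mult.commute[of "?d\<^sup>2"])
      finally have "1 + (real_of_int (m \<omega>))\<^sup>2 \<le> k * ?d\<^sup>2" .
      moreover have "0 < 1 + (real_of_int (m \<omega>))\<^sup>2" by (simp add: add_pos_nonneg)
      ultimately show ?thesis using d by (simp add: divide_simps mult.commute)
    qed
    have "(\<Sum>\<omega>\<in>F. 1 / (norm (z - \<omega>))\<^sup>2) \<le> (\<Sum>\<omega>\<in>F. k * (1 / (1 + (real_of_int (m \<omega>))\<^sup>2)))"
      by (intro sum_mono summand)
    also have "\<dots> = k * (\<Sum>n\<in>m ` F. 1 / (1 + (real_of_int n)\<^sup>2))"
      using inj by (simp add: sum_distrib_left sum.reindex)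
    also have "\<dots> \<le> k * K0" using K0(2)[of "m ` F"] fin k by (intro mult_left_mono) auto
    finally show ?thesis .
  qed
  then show ?thesis using that[of "k * K0"] k K0(1) by simp
qed

text \<open>Convolving \<open>1/|\<omega>|\<^sup>2\<close> with \<open>1/|s - \<omega>|\<^sup>2\<close> does not lose the quadratic decay: of \<open>\<omega>\<close> and
  \<open>s - \<omega>\<close> at least one has modulus at least \<open>|s|/2\<close>.\<close>

lemma inverse_square_product_le:
  fixes s \<omega> :: complex
  assumes "s \<noteq> 0" "\<omega> \<noteq> 0" "s \<noteq> \<omega>"
  shows "1 / ((norm \<omega>)\<^sup>2 * (norm (s - \<omega>))\<^sup>2) \<le> 2 / (norm s)\<^sup>2 * (1 / (norm \<omega>)\<^sup>2 + 1 / (norm (s - \<omega>))\<^sup>2)"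
proof -
  let ?a = "norm \<omega>" and ?b = "norm (s - \<omega>)"
  have ab: "0 < ?a" "0 < ?b" using assms by auto
  have "norm s \<le> ?a + ?b" using norm_triangle_ineq[of \<omega> "s - \<omega>"] by simp
  then have "(norm s)\<^sup>2 \<le> (?a + ?b)\<^sup>2" by (intro power_mono) auto
  also have "\<dots> \<le> 2 * (?a\<^sup>2 + ?b\<^sup>2)"
    using zero_le_power2[of "?a - ?b"] by (simp add: power2_eq_square algebra_simps)
  finally have "(norm s)\<^sup>2 / ((norm s)\<^sup>2 * (?a\<^sup>2 * ?b\<^sup>2)) \<le> 2 * (?a\<^sup>2 + ?b\<^sup>2) / ((norm s)\<^sup>2 * (?a\<^sup>2 * ?b\<^sup>2))"
    by (intro divide_right_mono) auto
  then show ?thesis using assms ab by (simp add: divide_simps)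
qed

section \<open>Periodic orbits and finite words\<close>

definition words :: "nat \<Rightarrow> (nat \<Rightarrow> real) \<Rightarrow> real \<Rightarrow> nat list set" where
  "words N w y = {u. u \<noteq> [] \<and> set u \<subseteq> {1..N} \<and> sum_list (map w u) \<le> y}"

lemma funpow_left_shift: "(left_shift ^^ k) a i = a (i + k)"
  by (induction k arbitrary: i) (simp_all add: left_shift_def)

lemma left_shift_periodic_iff: "(left_shift ^^ n) a = a \<longleftrightarrow> (\<forall>i. a (i + n) = a i)"
  by (simp add: fun_eq_iff funpow_left_shift)

lemma periodic_mod:
  assumes "(left_shift ^^ n) a = a"
  shows "a (i mod n) = a i"
proof -
  have "a (i + k * n) = a i" for i k
  proof (induction k)
    case (Suc k)
    then show ?case using assms unfolding left_shift_periodic_iff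
      by (metis add.assoc add.commute mult_Suc)
  qed simp
  from this[of "i mod n" "i div n"] show ?thesis by simp
qed

lemma funpow_left_shift_mod:
  assumes "(left_shift ^^ n) a = a"
  shows "(left_shift ^^ (k mod n)) a = (left_shift ^^ k) a"
proof
  fix i
  have "a ((i + k mod n) mod n) = a ((i + k) mod n)" by (simp add: mod_add_right_eq)
  then show "(left_shift ^^ (k mod n)) a i = (left_shift ^^ k) a i"
    by (simp add: funpow_left_shift periodic_mod[OF assms])
qed

definition orbit :: "(nat \<Rightarrow> nat) \<Rightarrow> (nat \<Rightarrow> nat) set" where
  "orbit a = range (\<lambda>k. (left_shift ^^ k) a)"

lemma orbit_minimal_period:
  assumes per: "(left_shift ^^ n) a = a" and n: "n \<ge> 1"
  shows "bij_betw (\<lambda>k. (left_shift ^^ k) a) {..<card (orbit a)} (orbit a)"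
    and "(left_shift ^^ card (orbit a)) a = a"
    and "card (orbit a) dvd n" and "card (orbit a) \<ge> 1"
proof -
  define m where "m = (LEAST m. m \<ge> 1 \<and> (left_shift ^^ m) a = a)"
  have m: "m \<ge> 1" "(left_shift ^^ m) a = a"
    using LeastI[of "\<lambda>m. m \<ge> 1 \<and> (left_shift ^^ m) a = a" n] per n by (auto simp: m_def)
  have min: "m \<le> k" if "k \<ge> 1" "(left_shift ^^ k) a = a" for k
    unfolding m_def by (rule Least_le) (use that in auto)
  have img: "orbit a = (\<lambda>k. (left_shift ^^ k) a) ` {..<m}"
  proof -
    have "(left_shift ^^ k) a \<in> (\<lambda>k. (left_shift ^^ k) a) ` {..<m}" for k
      using funpow_left_shift_mod[OF m(2), of k] m(1) by (intro image_eqI[of _ _ "k mod m"]) auto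
    then show ?thesis unfolding orbit_def by auto
  qed
  have lt: False if "i < j" "j < m" "(left_shift ^^ i) a = (left_shift ^^ j) a" for i j
  proof -
    have "a (x + (j - i)) = a x" for x
    proof -
      have "a (x + (j - i)) = a (x + (j - i) + m)" using m(2) unfolding left_shift_periodic_iff by simp
      also have "x + (j - i) + m = (x + (m - i)) + j" using that by simp
      also have "a \<dots> = a ((x + (m - i)) + i)"
        using fun_cong[OF that(3), of "x + (m - i)"] by (simp add: funpow_left_shift)
      also have "(x + (m - i)) + i = x + m" using that by simp
      also have "a \<dots> = a x" using m(2) unfolding left_shift_periodic_iff by simp
      finally show ?thesis .
    qed
    then have "(left_shift ^^ (j - i)) a = a" by (simp add: left_shift_periodic_iff)
    with min[of "j - i"] that show False by (simp add: Suc_le_eq)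
  qed
  have inj: "inj_on (\<lambda>k. (left_shift ^^ k) a) {..<m}"
    by (rule linorder_inj_onI) (use lt in auto)
  have card: "card (orbit a) = m" unfolding img by (simp add: card_image[OF inj])
  show "bij_betw (\<lambda>k. (left_shift ^^ k) a) {..<card (orbit a)} (orbit a)"
    unfolding bij_betw_def card using inj img by simp
  show "(left_shift ^^ card (orbit a)) a = a" "card (orbit a) \<ge> 1" using m card by auto
  have "(left_shift ^^ (n mod m)) a = a" using funpow_left_shift_mod[OF m(2), of n] per by simp
  then have "n mod m = 0" using min[of "n mod m"] mod_less_divisor[of m n] m(1) by fastforce
  then show "card (orbit a) dvd n" unfolding card by auto
qed

lemma orbit_of_member:
  assumes per: "(left_shift ^^ n) a = a" and n: "n \<ge> 1" and b: "b \<in> orbit a"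
  shows "(left_shift ^^ n) b = b" "orbit b = orbit a"
proof -
  obtain i where b_eq: "b = (left_shift ^^ i) a" using b by (auto simp: orbit_def)
  show "(left_shift ^^ n) b = b"
    using per unfolding b_eq left_shift_periodic_iff funpow_left_shift
    by (metis add.assoc add.commute)
  have "i \<le> n * i" using n by simp
  have "(left_shift ^^ (n * i - i)) b = (left_shift ^^ (n * i)) a"
    unfolding b_eq fun_eq_iff funpow_left_shift
    by (simp only: add.assoc le_add_diff_inverse2[OF \<open>i \<le> n * i\<close>] simp_thms)
  also have "\<dots> = a" using funpow_left_shift_mod[OF per, of "n * i"] by simp
  finally have a_eq: "a = (left_shift ^^ (n * i - i)) b" by simp
  have sub: "orbit ((left_shift ^^ k) c) \<subseteq> orbit c" for k c
  proof
    fix d assume "d \<in> orbit ((left_shift ^^ k) c)"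
    then obtain j where "d = (left_shift ^^ (j + k)) c" by (auto simp: orbit_def funpow_add)
    then show "d \<in> orbit c" by (auto simp: orbit_def)
  qed
  show "orbit b = orbit a"
  proof
    show "orbit b \<subseteq> orbit a" unfolding b_eq by (rule sub)
    show "orbit a \<subseteq> orbit b" by (subst a_eq) (rule sub)
  qed
qed

lemma periodic_orbits_eq:
  "periodic_orbits N = {orbit a | a. a \<in> word_space N \<and> (\<exists>n\<ge>1. (left_shift ^^ n) a = a)}"
  by (simp add: periodic_orbits_def orbit_def)

lemma periodic_orbit_nonempty: "\<pp> \<in> periodic_orbits N \<Longrightarrow> \<exists>b. b \<in> \<pp>"
  unfolding periodic_orbits_eq orbit_def by blast

lemma periodic_orbitD:
  assumes "\<pp> \<in> periodic_orbits N" "b \<in> \<pp>"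
  shows "orbit b = \<pp>" "b \<in> word_space N" "(left_shift ^^ card \<pp>) b = b"
    "bij_betw (\<lambda>k. (left_shift ^^ k) b) {..<card \<pp>} \<pp>" "card \<pp> \<ge> 1"
proof -
  obtain a n where a: "\<pp> = orbit a" "a \<in> word_space N" "n \<ge> 1" "(left_shift ^^ n) a = a"
    using assms(1) unfolding periodic_orbits_eq by auto
  note b = orbit_of_member[OF a(4,3) assms(2)[unfolded a(1)]]
  show ob: "orbit b = \<pp>" using b a by simp
  obtain i where "b = (left_shift ^^ i) a" using assms(2) a(1) by (auto simp: orbit_def)
  then show "b \<in> word_space N" using a(2) by (simp add: word_space_def funpow_left_shift)
  show "(left_shift ^^ card \<pp>) b = b" "card \<pp> \<ge> 1"
    "bij_betw (\<lambda>k. (left_shift ^^ k) b) {..<card \<pp>} \<pp>"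
    using orbit_minimal_period[OF b(1) a(3)] ob by auto
qed

lemma sum_over_periods:
  assumes "\<pp> \<in> periodic_orbits N" "b \<in> \<pp>"
  shows "(\<Sum>i<k * card \<pp>. w (b i)) = real k * total_weight w \<pp>"
proof -
  let ?m = "card \<pp>"
  note p = periodic_orbitD[OF assms]
  have one: "(\<Sum>i<?m. w (b i)) = total_weight w \<pp>"
  proof -
    have "total_weight w \<pp> = (\<Sum>i<?m. word_weight w ((left_shift ^^ i) b))"
      unfolding total_weight_def by (rule sum.reindex_bij_betw[OF p(4), symmetric])
    then show ?thesis by (simp add: word_weight_def funpow_left_shift)
  qed
  show ?thesis
  proof (induction k)
    case (Suc k)
    have "(\<Sum>i<Suc k * ?m. w (b i)) = (\<Sum>i<k * ?m. w (b i)) + (\<Sum>i<?m. w (b (i + k * ?m)))"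
    proof -
      have "sum f {..<p + q} = sum f {..<p} + (\<Sum>i<q. f (i + p))" for f :: "nat \<Rightarrow> real" and p q :: nat
        by (induction q) (simp_all add: add.commute add.left_commute)
      from this[of "\<lambda>i. w (b i)" "k * ?m" ?m] show ?thesis by (simp add: add.commute)
    qed
    moreover have "b (i + k * ?m) = b i" for i
      using periodic_mod[OF p(3), of "i + k * ?m"] periodic_mod[OF p(3), of i] by simp
    ultimately show ?case using Suc one by (simp add: algebra_simps)
  qed simp
qed

definition periodic_extension :: "nat list \<Rightarrow> nat \<Rightarrow> nat" where
  "periodic_extension u i = u ! (i mod length u)"

context
  fixes N :: nat and w :: "nat \<Rightarrow> real"
  assumes flow: "self_similar_flow N w"
begin

lemma sum_list_weight_ge:
  assumes "set u \<subseteq> {1..N}"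
  shows "real (length u) * w 1 \<le> sum_list (map w u)"
  using assms
proof (induction u)
  case (Cons j u)
  have "w 1 \<le> w j"
    using flow Cons.prems by (intro mono_onD[of "{1..N}" w]) (auto simp: self_similar_flow_def)
  with Cons show ?case by (simp add: algebra_simps)
qed simp

lemma finite_words: "finite (words N w y)"
proof (rule finite_subset)
  have w1: "0 < w 1" using flow by (simp add: self_similar_flow_def)
  show "words N w y \<subseteq> {u. set u \<subseteq> {1..N} \<and> length u \<le> nat \<lceil>y / w 1\<rceil>}"
  proof safe
    fix u assume u: "u \<in> words N w y"
    then have "real (length u) * w 1 \<le> y"
      using sum_list_weight_ge[of u] by (simp add: words_def)
    then have "real (length u) \<le> y / w 1" using w1 by (simp add: field_simps)
    then show "length u \<le> nat \<lceil>y / w 1\<rceil>" by linarith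
  qed (auto simp: words_def)
qed (intro finite_lists_length_le, simp)

text \<open>A pair \<open>(\<pp>, k)\<close> together with a starting point \<open>b \<in> \<pp>\<close> is the same as a nonempty finite
  word: read off \<open>k * card \<pp>\<close> letters of \<open>b\<close>. Thus the weight of an orbit, which is a sum over its
  points, spreads over its cyclic rotations, each contributing the weight of its first letter.\<close>

lemma psi_eq_sum_words: "psi N w x = (\<Sum>u\<in>words N w (ln x). w (hd u))"
proof -
  define y where "y = ln x"
  define I where "I = {(\<pp>, k :: nat). \<pp> \<in> periodic_orbits N \<and> k \<ge> 1 \<and> real k * total_weight w \<pp> \<le> y}"
  define P where "P = Sigma I fst"
  define read where "read = (\<lambda>((\<pp> :: (nat \<Rightarrow> nat) set, k :: nat), b :: nat \<Rightarrow> nat). map b [0..<k * card \<pp>])"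
  define loop where "loop u = ((orbit (periodic_extension u), length u div card (orbit (periodic_extension u))),
      periodic_extension u)" for u
  have sum_list_read: "sum_list (map w (map b [0..<n])) = (\<Sum>i<n. w (b i))" for b n
    by (simp add: interv_sum_list_conv_sum_set_nat comp_def atLeast0LessThan)
  have read_in: "read q \<in> words N w y" and loop_read: "loop (read q) = q"
    and weight: "w (hd (read q)) = word_weight w (snd q)" if "q \<in> P" for q
  proof -
    obtain \<pp> k b where q: "q = ((\<pp>, k), b)" by (metis surj_pair)
    have qI: "\<pp> \<in> periodic_orbits N" "k \<ge> 1" "real k * total_weight w \<pp> \<le> y" "b \<in> \<pp>"
      using that by (auto simp: P_def I_def q)
    note p = periodic_orbitD[OF qI(1,4)]
    let ?n = "k * card \<pp>"
    have n: "?n \<ge> 1" using qI(2) p(5) by (metis mult_le_mono nat_mult_1)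
    have "(left_shift ^^ ?n) b = b"
      using funpow_left_shift_mod[OF p(3), of ?n] by simp
    then have ext: "periodic_extension (read q) = b"
      using n periodic_mod[of ?n b] by (auto simp: periodic_extension_def read_def q fun_eq_iff)
    show "read q \<in> words N w y"
      unfolding words_def mem_Collect_eq
    proof (intro conjI)
      show "read q \<noteq> []" using n by (simp add: read_def q)
      show "set (read q) \<subseteq> {1..N}" using p(2) by (auto simp: read_def q word_space_def)
      show "sum_list (map w (read q)) \<le> y"
        using sum_over_periods[OF qI(1,4), of w k] qI(3) by (simp add: read_def q sum_list_read del: map_map)
    qed
    have "length (read q) div card \<pp> = k" using p(5) by (simp add: read_def q)
    then show "loop (read q) = q" unfolding loop_def ext p(1) by (simp add: q)
    show "w (hd (read q)) = word_weight w (snd q)"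
      using n by (simp add: read_def q word_weight_def upt_conv_Cons)
  qed
  have loop_in: "loop u \<in> P" and read_loop: "read (loop u) = u" if u: "u \<in> words N w y" for u
  proof -
    let ?b = "periodic_extension u" and ?n = "length u"
    have n: "?n \<ge> 1" using u by (auto simp: words_def Suc_le_eq)
    have b: "?b \<in> word_space N"
    proof -
      have "u ! (i mod ?n) \<in> {1..N}" for i
      proof -
        have "u ! (i mod ?n) \<in> set u" by (intro nth_mem mod_less_divisor) (use n in linarith)
        then show ?thesis using u unfolding words_def by blast
      qed
      then show ?thesis unfolding word_space_def periodic_extension_def by blast
    qed
    have per: "(left_shift ^^ ?n) ?b = ?b"
      by (simp add: left_shift_periodic_iff periodic_extension_def)
    note m = orbit_minimal_period[OF per n]
    have orb: "orbit ?b \<in> periodic_orbits N" using b per n unfolding periodic_orbits_eq by blast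
    have mem: "?b \<in> orbit ?b" unfolding orbit_def by (rule range_eqI[of _ _ 0]) simp
    have k: "length u div card (orbit ?b) * card (orbit ?b) = ?n" using m(3) by simp
    have "map ?b [0..<?n] = u" by (rule nth_equalityI) (auto simp: periodic_extension_def)
    then show rl: "read (loop u) = u" by (simp add: loop_def read_def k)
    have "sum_list (map w u) = real (length u div card (orbit ?b)) * total_weight w (orbit ?b)"
      using sum_over_periods[OF orb mem, of w "length u div card (orbit ?b)"]
      by (metis k sum_list_read \<open>map ?b [0..<?n] = u\<close>)
    moreover have "length u div card (orbit ?b) \<ge> 1"
      using k n by (metis One_nat_def Suc_le_eq gr0I mult_0)
    ultimately show "loop u \<in> P"
      using orb mem u by (auto simp: loop_def P_def I_def words_def)
  qed
  have I_eq: "I = (\<lambda>u. fst (loop u)) ` words N w y"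
  proof (intro equalityI subsetI)
    fix q assume q: "q \<in> I"
    then obtain b where "b \<in> fst q"
      using periodic_orbit_nonempty[of "fst q" N] by (auto simp: I_def)
    with q have "(q, b) \<in> P" by (simp add: P_def)
    from loop_read[OF this] read_in[OF this]
    show "q \<in> (\<lambda>u. fst (loop u)) ` words N w y" by (intro image_eqI[of _ _ "read (q, b)"]) simp_all
  next
    fix q assume "q \<in> (\<lambda>u. fst (loop u)) ` words N w y"
    then obtain u where "q = fst (loop u)" "loop u \<in> P" using loop_in by blast
    then show "q \<in> I" unfolding P_def by (metis SigmaD1 prod.collapse)
  qed
  then have "finite I" using finite_words by simp
  have fin: "finite (fst q)" if "q \<in> I" for q
  proof -
    obtain \<pp> k where q: "q = (\<pp>, k)" by fastforce
    have p: "\<pp> \<in> periodic_orbits N" using that by (simp add: I_def q)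
    then obtain b where b: "b \<in> \<pp>" using periodic_orbit_nonempty by blast
    show ?thesis using periodic_orbitD(5)[OF p b] by (simp add: q card_ge_0_finite)
  qed
  have "psi N w x = (\<Sum>q\<in>I. \<Sum>b\<in>fst q. word_weight w b)"
    unfolding psi_def I_def y_def total_weight_def by (simp add: case_prod_unfold)
  also have "\<dots> = (\<Sum>q\<in>P. word_weight w (snd q))"
    unfolding P_def using \<open>finite I\<close> fin by (simp add: sum.Sigma case_prod_unfold)
  also have "\<dots> = (\<Sum>u\<in>words N w y. w (hd u))"
    by (rule sum.reindex_bij_witness[of _ loop read]) (use read_in loop_read loop_in read_loop weight in auto)
  finally show ?thesis unfolding y_def .
qed

text \<open>Splitting off the last letter keeps the first one, hence the weight.\<close>

lemma sum_words_renewal: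
  fixes k :: "real \<Rightarrow> real"
  shows "(\<Sum>u\<in>words N w y. w (hd u) * k (y - sum_list (map w u))) =
    (\<Sum>j=1..N. (if w j \<le> y then w j * k (y - w j) else 0) +
       (\<Sum>u\<in>words N w (y - w j). w (hd u) * k (y - w j - sum_list (map w u))))"
proof -
  define W0 where "W0 z = {v. set v \<subseteq> {1..N} \<and> sum_list (map w v) \<le> z}" for z
  have W0_eq: "W0 z = (if 0 \<le> z then {[]} else {}) \<union> words N w z" for z
    by (auto simp: W0_def words_def)
  have fin: "finite (W0 z)" for z using finite_words by (simp add: W0_eq)
  have snoc: "v @ [j] \<in> words N w y \<longleftrightarrow> j \<in> {1..N} \<and> v \<in> W0 (y - w j)" for v j
    by (auto simp: words_def W0_def)
  have "(\<Sum>u\<in>words N w y. w (hd u) * k (y - sum_list (map w u))) =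
      (\<Sum>(j, v)\<in>Sigma {1..N} (\<lambda>j. W0 (y - w j)). w (hd (v @ [j])) * k (y - w j - sum_list (map w v)))"
  proof (rule sum.reindex_bij_witness[of _ "\<lambda>(j, v). v @ [j]" "\<lambda>u. (last u, butlast u)"])
    fix u assume u: "u \<in> words N w y"
    then obtain v j where vj: "u = v @ [j]" by (cases u rule: rev_cases) (auto simp: words_def)
    then show "(\<lambda>(j, v). v @ [j]) (last u, butlast u) = u"
      "(last u, butlast u) \<in> Sigma {1..N} (\<lambda>j. W0 (y - w j))"
      "(\<lambda>(j, v). w (hd (v @ [j])) * k (y - w j - sum_list (map w v))) (last u, butlast u)
         = w (hd u) * k (y - sum_list (map w u))"
      using u snoc[of v j] by (auto simp: algebra_simps)
  next
    fix q assume q: "q \<in> Sigma {1..N} (\<lambda>j. W0 (y - w j))"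
    then obtain j v where jv: "q = (j, v)" by fastforce
    then show "(\<lambda>u. (last u, butlast u)) ((\<lambda>(j, v). v @ [j]) q) = q"
      "(\<lambda>(j, v). v @ [j]) q \<in> words N w y"
      using q snoc[of v j] by auto
  qed
  also have "\<dots> = (\<Sum>j=1..N. \<Sum>v\<in>W0 (y - w j). w (hd (v @ [j])) * k (y - w j - sum_list (map w v)))"
    using fin by (subst sum.Sigma) auto
  also have "\<dots> = (\<Sum>j=1..N. (if w j \<le> y then w j * k (y - w j) else 0) +
       (\<Sum>u\<in>words N w (y - w j). w (hd u) * k (y - w j - sum_list (map w u))))"
  proof (intro sum.cong refl)
    fix j
    have "(\<Sum>v\<in>W0 (y - w j). w (hd (v @ [j])) * k (y - w j - sum_list (map w v))) =
        (\<Sum>v\<in>(if 0 \<le> y - w j then {[]} else {}). w (hd (v @ [j])) * k (y - w j - sum_list (map w v))) +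
        (\<Sum>v\<in>words N w (y - w j). w (hd (v @ [j])) * k (y - w j - sum_list (map w v)))"
      unfolding W0_eq using finite_words by (intro sum.union_disjoint) (auto simp: words_def)
    also have "(\<Sum>v\<in>words N w (y - w j). w (hd (v @ [j])) * k (y - w j - sum_list (map w v))) =
        (\<Sum>v\<in>words N w (y - w j). w (hd v) * k (y - w j - sum_list (map w v)))"
      by (intro sum.cong) (auto simp: words_def hd_append)
    finally show "(\<Sum>v\<in>W0 (y - w j). w (hd (v @ [j])) * k (y - w j - sum_list (map w v))) =
        (if w j \<le> y then w j * k (y - w j) else 0) +
       (\<Sum>u\<in>words N w (y - w j). w (hd u) * k (y - w j - sum_list (map w u)))"
      by simp
  qed
  finally show ?thesis .
qed

end

section \<open>Inversion of the logarithmic derivative\<close>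

text \<open>Up to the substitution \<open>x = e\<^sup>y\<close> and the factor \<open>e\<^sup>y\<close>, this is the primitive of
  \<open>psi N w\<close>.\<close>

definition smoothed_count :: "nat \<Rightarrow> (nat \<Rightarrow> real) \<Rightarrow> real \<Rightarrow> real" where
  "smoothed_count N w y = (\<Sum>u\<in>words N w y. w (hd u) * (1 - exp (- (y - sum_list (map w u)))))"

context self_similar
begin

text \<open>The product of \<open>denom'/denom\<close>, which is the logarithmic derivative \<open>- \<zeta>'/\<zeta>\<close>, with the Perron kernel
  at \<open>0\<close>: its Laplace inversion is \<open>smoothed_count\<close>.\<close>

definition log_integrand :: "real \<Rightarrow> complex \<Rightarrow> complex" where
  "log_integrand y s = exp (s * of_real y) * denom' s / (denom s * (s * (s + 1)))"

lemma denom_nonzero_right: "D < Re s \<Longrightarrow> denom s \<noteq> 0"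
  using denom_zero_Re_le[of s] by auto

text \<open>The identity is \<open>denom'/denom = denom' + (1 - denom) * denom'/denom\<close>, in which \<open>1 - denom\<close> is the sum of
  the shifts \<open>e\<^bsup>-w\<^sub>j s\<^esup>\<close>; it mirrors the renewal equation for words.\<close>

lemma log_integrand_renewal:
  assumes "denom s \<noteq> 0"
  shows "log_integrand y s =
    (\<Sum>j=1..N. of_real (w j) * perron_kernel 0 (y - w j) s + log_integrand (y - w j) s)"
proof -
  let ?E = "\<lambda>j. exp (- (of_real (w j) * s))"
  have shift: "exp (s * of_real (y - w j)) = exp (s * of_real y) * ?E j" for j
    by (simp add: exp_add[symmetric] algebra_simps)
  let ?c = "exp (s * of_real y) / (s * (s + 1))"
  have "(\<Sum>j=1..N. of_real (w j) * perron_kernel 0 (y - w j) s + log_integrand (y - w j) s)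
      = (\<Sum>j=1..N. ?c * (of_real (w j) * ?E j) + ?c * (denom' s / denom s) * ?E j)"
    unfolding perron_kernel_def log_integrand_def shift by (simp add: mult_ac)
  also have "\<dots> = ?c * denom' s + ?c * (denom' s / denom s) * (1 - denom s)"
  proof -
    have "(\<Sum>j=1..N. of_real (w j) * ?E j) = denom' s" "(\<Sum>j=1..N. ?E j) = 1 - denom s"
      by (simp_all add: denom'_def denom_def)
    then show ?thesis by (simp only: sum.distrib sum_distrib_left[symmetric])
  qed
  also have "\<dots> = ?c * (denom' s / denom s)"
  proof -
    have "a * p + a * (p / q) * (1 - q) = a * (p / q)" if "q \<noteq> 0" for a p q :: complex
      using that by (simp add: field_simps)
    from this[OF assms] show ?thesis .
  qed
  also have "\<dots> = log_integrand y s" by (simp add: log_integrand_def mult_ac)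
  finally show ?thesis by simp
qed

lemma log_integrand_continuous:
  assumes "D < c"
  shows "continuous_on X (\<lambda>t. log_integrand y (Complex c t))"
    and "continuous_on X (\<lambda>t. perron_kernel 0 y (Complex c t))"
proof -
  have ne: "Complex c t \<noteq> 0 \<and> Complex c t + 1 \<noteq> 0 \<and> denom (Complex c t) \<noteq> 0" for t
    using assms D_pos denom_nonzero_right[of "Complex c t"] by (auto simp: complex_eq_iff)
  have cont: "continuous_on X (\<lambda>t. Complex c t)" by (auto simp: Complex_eq intro!: continuous_intros)
  note c = continuous_on_compose2[OF holomorphic_on_imp_continuous_on[OF denom_holomorphic[of UNIV]] cont]
    continuous_on_compose2[OF holomorphic_on_imp_continuous_on[OF denom'_holomorphic[of UNIV]] cont]
  show "continuous_on X (\<lambda>t. log_integrand y (Complex c t))"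
    unfolding log_integrand_def using ne by (intro continuous_intros cont c) auto
  show "continuous_on X (\<lambda>t. perron_kernel 0 y (Complex c t))"
    unfolding perron_kernel_def using ne by (intro continuous_intros cont) auto
qed

lemma log_integrand_integral_nonpos:
  assumes c: "D < c" and y: "y \<le> 0"
  shows "((\<lambda>T. vertical_integral (log_integrand y) c T) \<longlongrightarrow> 0) at_top"
proof -
  define d where "d = 1 - (\<Sum>j=1..N. exp (- (w j * c)))"
  define M where "M = (\<Sum>j=1..N. w j * exp (- (w j * c)))"
  have c0: "0 < c" using c D_pos by simp
  have d: "0 < d" using exp_sum_strict_antimono[OF c] D_eq by (simp add: d_def)
  have dn: "d \<le> norm (denom s)" if "c \<le> Re s" for s
    using denom_right_bound[of s] exp_sum_antimono[OF that] by (simp add: d_def)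
  show ?thesis
  proof (rule vertical_integral_tendsto_0[OF c0])
    have "s \<noteq> 0 \<and> s + 1 \<noteq> 0" if "c \<le> Re s" for s
      using that c0 by (auto simp: complex_eq_iff)
    moreover have "denom s \<noteq> 0" if "c \<le> Re s" for s
      using dn[OF that] d by auto
    ultimately show "log_integrand y holomorphic_on {s. c \<le> Re s}"
      unfolding log_integrand_def
      by (intro holomorphic_intros denom_holomorphic denom'_holomorphic) auto
    fix s assume s: "c \<le> Re s"
    have 1: "norm s \<le> norm (s + 1)"
      using s c0 unfolding cmod_def by (auto intro!: real_sqrt_le_mono power_mono)
    have 2: "norm (exp (s * of_real y)) \<le> 1" using s c0 y by (auto simp: mult_nonneg_nonpos)
    have 3: "0 < norm s" using s c0 by auto
    have 4: "norm (denom' s) \<le> M" using denom'_bound[OF s] by (simp add: M_def)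
    have "norm (log_integrand y s) \<le> (1 * M) / (d * (norm s * norm s))"
      unfolding log_integrand_def norm_divide norm_mult
      using 1 2 3 4 d dn[OF s] by (intro frac_le mult_mono mult_nonneg_nonneg order_trans[OF norm_ge_zero 4] mult_pos_pos) auto
    then show "norm (log_integrand y s) \<le> (M / d) / (norm s)\<^sup>2"
      by (simp add: power2_eq_square)
  qed
qed

lemma words_empty:
  assumes "y < w 1" shows "words N w y = {}"
proof -
  have "False" if u: "u \<in> words N w y" for u
  proof -
    have "real (length u) * w 1 \<le> y"
      using sum_list_weight_ge[OF flow, of u] u by (simp add: words_def)
    moreover have "1 * w 1 \<le> real (length u) * w 1"
      using u w_pos[of 1] N_ge_2 by (intro mult_right_mono) (auto simp: words_def Suc_le_eq)
    ultimately show False using assms by simp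
  qed
  then show ?thesis by auto
qed

text \<open>Both sides satisfy the same renewal equation, which determines them from their values on
  the negative half-line, where they vanish.\<close>

lemma log_integrand_inversion:
  assumes c: "D < c"
  shows "((\<lambda>T. vertical_integral (log_integrand y) c T)
            \<longlongrightarrow> complex_of_real (2 * pi * smoothed_count N w y)) at_top"
proof -
  have c0: "0 < c" using c D_pos by simp
  have w1: "0 < w 1" using w_pos[of 1] N_ge_2 by simp
  define k where "k z = (if 0 \<le> z then 1 - exp (- z) else 0)" for z :: real
  have kernel: "((\<lambda>T. vertical_integral (perron_kernel 0 z) c T)
            \<longlongrightarrow> complex_of_real (2 * pi * k z)) at_top" for z
    using perron_kernel_tendsto_nonneg[of 0 c z] perron_kernel_tendsto_neg[of c z] c0
    by (cases "0 \<le> z") (auto simp: k_def exp_of_real[symmetric])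
  have "((\<lambda>T. vertical_integral (log_integrand y) c T)
            \<longlongrightarrow> complex_of_real (2 * pi * smoothed_count N w y)) at_top" if "y < real n * w 1" for n
    using that
  proof (induction n arbitrary: y)
    case 0
    then show ?case
      using log_integrand_integral_nonpos[OF c, of y] words_empty[of y] w1
      by (simp add: smoothed_count_def)
  next
    case (Suc n)
    let ?J = "\<lambda>T j. of_real (w j) * vertical_integral (perron_kernel 0 (y - w j)) c T
          + vertical_integral (log_integrand (y - w j)) c T"
    have "vertical_integral (log_integrand y) c T = (\<Sum>j=1..N. ?J T j)" for T
    proof -
      have "vertical_integral (log_integrand y) c T = integral {-T..T} (\<lambda>t.
          \<Sum>j=1..N. of_real (w j) * perron_kernel 0 (y - w j) (Complex c t)
              + log_integrand (y - w j) (Complex c t))"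
        using c denom_nonzero_right by (intro integral_cong log_integrand_renewal) auto
      also have "\<dots> = (\<Sum>j=1..N. ?J T j)"
      proof -
        have int: "(\<lambda>t. of_real (w j) * perron_kernel 0 (y - w j) (Complex c t)) integrable_on {-T..T}"
          "(\<lambda>t. log_integrand (y - w j) (Complex c t)) integrable_on {-T..T}" for j
          by (intro integrable_continuous_interval continuous_intros log_integrand_continuous[OF c])+
        show ?thesis
          by (subst integral_sum) (simp_all add: integrable_add int integral_add)
      qed
      finally show ?thesis .
    qed
    moreover have "((\<lambda>T. \<Sum>j=1..N. ?J T j) \<longlongrightarrow>
        (\<Sum>j=1..N. complex_of_real (w j) * complex_of_real (2 * pi * k (y - w j))
           + complex_of_real (2 * pi * smoothed_count N w (y - w j)))) at_top"
    proof (intro tendsto_sum tendsto_add tendsto_mult tendsto_const kernel Suc.IH)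
      fix j assume j: "j \<in> {1..N}"
      show "y - w j < real n * w 1" using Suc.prems w_bounds(1)[OF j] by (simp add: algebra_simps)
    qed
    moreover have "(\<Sum>j=1..N. complex_of_real (w j) * complex_of_real (2 * pi * k (y - w j))
           + complex_of_real (2 * pi * smoothed_count N w (y - w j))) = complex_of_real (2 * pi * smoothed_count N w y)"
    proof -
      have "smoothed_count N w y = (\<Sum>j=1..N. w j * k (y - w j) + smoothed_count N w (y - w j))"
      proof -
        have "smoothed_count N w y = (\<Sum>j=1..N. (if w j \<le> y then w j * (1 - exp (- (y - w j))) else 0)
            + smoothed_count N w (y - w j))"
          unfolding smoothed_count_def by (rule sum_words_renewal[OF flow])
        also have "\<dots> = (\<Sum>j=1..N. w j * k (y - w j) + smoothed_count N w (y - w j))"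
          by (intro sum.cong) (auto simp: k_def)
        finally show ?thesis .
      qed
      then show ?thesis by (simp add: sum_distrib_left distrib_left mult_ac)
    qed
    ultimately show ?case by simp
  qed
  moreover obtain n :: nat where "y < real n * w 1" using reals_Archimedean3[OF w1] by blast
  ultimately show ?thesis by blast
qed

end

section \<open>Sums over the zeros\<close>

text \<open>Riemann's theorem on removable singularities, for finitely many points at once; the bound
  persists at the added points by continuity.\<close>

lemma holomorphic_extension_bounded:
  fixes f :: "complex \<Rightarrow> complex"
  assumes "finite K" "open S" "f holomorphic_on S - K" "continuous_on S M"
    and "\<And>s. s \<in> S - K \<Longrightarrow> norm (f s) \<le> M s"
  shows "\<exists>g. g holomorphic_on S \<and> (\<forall>s\<in>S - K. g s = f s) \<and> (\<forall>s\<in>S. norm (g s) \<le> M s)"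
  using assms
proof (induction K arbitrary: f rule: finite_induct)
  case empty
  then show ?case by auto
next
  case (insert k K)
  show ?case
  proof (cases "k \<in> S")
    case False
    then have "S - insert k K = S - K" by auto
    with insert show ?thesis by metis
  next
    case True
    define S' where "S' = S - K"
    have S': "open S'" "k \<in> S'" "S' - {k} = S - insert k K"
      using insert.hyps insert.prems(1) True open_Diff[OF _ finite_imp_closed] by (auto simp: S'_def)
    have bd: "norm (f s) \<le> M s" if "s \<in> S'" "s \<noteq> k" for s
      using insert.prems(4)[of s] that by (simp add: S'_def)
    have isM: "isCont M k"
      using insert.prems(1,3) True by (simp add: continuous_on_eq_continuous_at)
    have near: "eventually (\<lambda>s. s \<in> S' - {k}) (at k)"
      by (rule eventually_at_in_open[OF S'(1,2)])
    have "eventually (\<lambda>s. M s < M k + 1) (at k)"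
      using isM unfolding isCont_def by (intro order_tendstoD) auto
    with near have f_bd: "eventually (\<lambda>s. norm (f s) \<le> M k + 1) (at k)"
    proof eventually_elim
      case (elim s)
      then have "s \<in> S - insert k K" using S'(3) by blast
      from insert.prems(4)[OF this] elim show ?case by simp
    qed
    have ext: "f holomorphic_on S' - {k}" "k \<in> interior S'"
      using insert.prems(2) S' by (simp_all add: interior_open)
    have "\<exists>g. g holomorphic_on S' \<and> (\<forall>s\<in>S' - {k}. g s = f s)"
      unfolding holomorphic_on_extend_bounded[OF ext] using f_bd by (rule exI)
    then obtain g where g: "g holomorphic_on S'" "\<And>s. s \<in> S' - {k} \<Longrightarrow> g s = f s" by blast
    have "norm (g s) \<le> M s" if s: "s \<in> S'" for s
    proof (cases "s = k")
      case False
      then show ?thesis using g(2)[of s] bd[of s] s by simp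
    next
      case True
      have "isCont g k"
        using holomorphic_on_imp_continuous_on[OF g(1)] S' by (simp add: continuous_on_eq_continuous_at)
      then have lim: "((\<lambda>s. norm (g s)) \<longlongrightarrow> norm (g k)) (at k)" unfolding isCont_def by (rule tendsto_norm)
      have "norm (g k) \<le> M k"
      proof (rule tendsto_le[OF _ _ lim])
        show "(M \<longlongrightarrow> M k) (at k)" using isM by (simp add: isCont_def)
        show "eventually (\<lambda>s. norm (g s) \<le> M s) (at k)"
          using near
        proof eventually_elim
          case (elim s)
          then show ?case using g(2)[of s] bd[of s] by simp
        qed
      qed simp
      with True show ?thesis by simp
    qed
    then have "\<exists>h. h holomorphic_on S \<and> (\<forall>s\<in>S - K. h s = g s) \<and> (\<forall>s\<in>S. norm (h s) \<le> M s)"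
      using g(1) unfolding S'_def by (intro insert.IH insert.prems) auto
    then obtain h where h: "h holomorphic_on S" "\<And>s. s \<in> S - K \<Longrightarrow> h s = g s"
      "\<And>s. s \<in> S \<Longrightarrow> norm (h s) \<le> M s"
      by blast
    have "h s = f s" if "s \<in> S - insert k K" for s
      using h(2)[of s] g(2)[of s] that by (simp add: S'_def)
    with h show ?thesis by blast
  qed
qed

text \<open>The error depends on the integrand through its decay rate \<open>M\<close> only. This makes it uniform when
  the integrand is a sum over an increasing number of poles.\<close>

lemma symmetric_integral_tail_bound:
  fixes p :: "real \<Rightarrow> complex"
  assumes T: "0 < T" and cont: "continuous_on UNIV p"
    and bound: "\<And>t. T \<le> \<bar>t\<bar> \<Longrightarrow> norm (p t) \<le> M / t\<^sup>2"
    and lim: "((\<lambda>T. integral {-T..T} p) \<longlongrightarrow> L) at_top"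
  shows "norm (L - integral {-T..T} p) \<le> 2 * M / T"
proof (rule tendsto_upperbound)
  show "((\<lambda>R. norm (integral {-R..R} p - integral {-T..T} p)) \<longlongrightarrow> norm (L - integral {-T..T} p)) at_top"
    by (intro tendsto_intros lim)
  have M: "0 \<le> M" using order_trans[OF norm_ge_zero bound[of T]] T by (simp add: zero_le_divide_iff)
  have int: "p integrable_on {a..b}" for a b
    by (intro integrable_continuous_interval continuous_on_subset[OF cont]) auto
  show "eventually (\<lambda>R. norm (integral {-R..R} p - integral {-T..T} p) \<le> 2 * M / T) at_top"
    using eventually_ge_at_top[of T]
  proof eventually_elim
    case (elim R)
    have prim: "((\<lambda>t. M / t\<^sup>2) has_integral (- M / b - (- M / a))) {a..b}"
      if "a \<le> b" "0 < a \<or> b < 0" for a b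
    proof (rule fundamental_theorem_of_calculus[OF that(1)])
      fix t assume "t \<in> {a..b}"
      then have "t \<noteq> 0" using that by auto
      then show "((\<lambda>t. - M / t) has_vector_derivative M / t\<^sup>2) (at t within {a..b})"
        unfolding has_real_derivative_iff_has_vector_derivative[symmetric]
        by (auto intro!: derivative_eq_intros simp: power2_eq_square)
    qed
    have side: "norm (integral {a..b} p) \<le> M / T"
      if "a \<le> b" "T \<le> a \<and> b = R \<or> a = -R \<and> b \<le> - T" "a = T \<or> b = -T" for a b
    proof -
      have "norm (integral {a..b} p) \<le> integral {a..b} (\<lambda>t. M / t\<^sup>2)"
        using prim[OF that(1)] that T
        by (intro integral_norm_bound_integral int bound) (auto simp: has_integral_iff)
      also have "\<dots> = - M / b - (- M / a)"
        using prim[OF that(1)] that T by (intro integral_unique) auto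
      also have "\<dots> \<le> M / T" using that T elim M by (auto simp: divide_simps)
      finally show ?thesis .
    qed
    have "integral {-R..R} p = integral {-R..-T} p + integral {-T..T} p + integral {T..R} p"
      using elim T by (simp add: Henstock_Kurzweil_Integration.integral_combine int)
    then have "norm (integral {-R..R} p - integral {-T..T} p) \<le> M / T + M / T"
      using side[of "-R" "-T"] side[of T R] elim by (auto intro!: norm_triangle_le)
    then show ?case by simp
  qed
qed simp

context zero_control
begin

definition near_zeros :: "complex set" where
  "near_zeros = {\<omega>. denom \<omega> = 0 \<and> D - 6 * e \<le> Re \<omega>}"

abbreviation dominant_zeros :: "complex set" where
  "dominant_zeros \<equiv> {\<omega> \<in> near_zeros. D - 2 * e < Re \<omega>}"

text \<open>Within \<open>24 * e\<close> of a zero there is no second one, and the real parts differ by at most \<open>6 * e\<close>.\<close>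

lemma near_zeros_separated:
  assumes "\<omega> \<in> near_zeros" "\<omega>' \<in> near_zeros" "\<omega> \<noteq> \<omega>'"
  shows "18 * e \<le> \<bar>Im \<omega> - Im \<omega>'\<bar>"
proof (rule ccontr)
  assume "\<not> ?thesis"
  moreover have "\<bar>Re \<omega> - Re \<omega>'\<bar> \<le> 6 * e"
    using assms denom_zero_Re_le[of \<omega>] denom_zero_Re_le[of \<omega>'] by (auto simp: near_zeros_def)
  ultimately have "norm (\<omega> - \<omega>') \<le> 24 * e" using cmod_le[of "\<omega> - \<omega>'"] by simp
  then have "A * norm (\<omega> - \<omega>') \<le> norm (denom \<omega>)"
    using zero_lower[of \<omega>' \<omega>] assms e_small by (auto simp: near_zeros_def)
  then show False using assms pos by (auto simp: near_zeros_def mult_le_0_iff)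
qed

lemma near_zero_bounds:
  assumes "\<omega> \<in> near_zeros"
  shows "D - 6 * e \<le> Re \<omega>" "Re \<omega> \<le> D" "D - 6 * e \<le> norm \<omega>" "\<omega> \<noteq> 0" "norm \<omega> \<le> norm (\<omega> + 1)"
proof -
  show 1: "D - 6 * e \<le> Re \<omega>" "Re \<omega> \<le> D"
    using assms denom_zero_Re_le[of \<omega>] by (auto simp: near_zeros_def)
  then show "D - 6 * e \<le> norm \<omega>" "\<omega> \<noteq> 0" using complex_Re_le_cmod[of \<omega>] e_small by auto
  show "norm \<omega> \<le> norm (\<omega> + 1)"
    using 1 e_small unfolding cmod_def by (auto intro!: real_sqrt_le_mono power_mono)
qed

text \<open>The zeros are simple, so \<open>denom'/denom\<close> has residue \<open>1\<close> there, and \<open>coeff \<omega> * exp (\<omega> * y)\<close> is the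
  residue of \<open>log_integrand y\<close> at \<open>\<omega>\<close>.\<close>

definition coeff :: "complex \<Rightarrow> complex" where "coeff \<omega> = 1 / (\<omega> * (\<omega> + 1))"

abbreviation dim_term :: "real \<Rightarrow> complex \<Rightarrow> complex" where
  "dim_term y \<omega> \<equiv> coeff \<omega> * exp (\<omega> * of_real y)"

abbreviation pole_term :: "complex \<Rightarrow> complex \<Rightarrow> complex" where
  "pole_term s \<omega> \<equiv> coeff \<omega> * perron_kernel \<omega> 0 s"

lemma norm_coeff_le: "\<omega> \<in> near_zeros \<Longrightarrow> norm (coeff \<omega>) \<le> 1 / (norm \<omega>)\<^sup>2"
  using near_zero_bounds[of \<omega>] unfolding coeff_def norm_divide norm_mult power2_eq_square
  by (intro frac_le mult_mono) auto

lemma near_zeros_sum_bound: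
  "\<exists>K>0. (\<forall>F. finite F \<longrightarrow> F \<subseteq> near_zeros \<longrightarrow> (\<Sum>\<omega>\<in>F. 1 / (norm \<omega>)\<^sup>2) \<le> K) \<and>
    (\<forall>F s. finite F \<longrightarrow> F \<subseteq> near_zeros \<longrightarrow> (\<forall>\<omega>\<in>F. e \<le> norm (s - \<omega>)) \<longrightarrow> s \<noteq> 0 \<longrightarrow>
      (\<Sum>\<omega>\<in>F. 1 / ((norm \<omega>)\<^sup>2 * (norm (s - \<omega>))\<^sup>2)) \<le> K / (norm s)\<^sup>2)"
proof -
  define \<rho> where "\<rho> = min e (D - 6 * e)"
  have rho: "0 < \<rho>" using pos e_small by (simp add: \<rho>_def)
  obtain K where K: "K > 0"
    "\<And>F z. finite F \<Longrightarrow>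
       (\<And>\<omega> \<omega>'. \<omega> \<in> F \<Longrightarrow> \<omega>' \<in> F \<Longrightarrow> \<omega> \<noteq> \<omega>' \<Longrightarrow> 18 * e \<le> \<bar>Im \<omega> - Im \<omega>'\<bar>) \<Longrightarrow>
       (\<And>\<omega>. \<omega> \<in> F \<Longrightarrow> \<rho> \<le> norm (z - \<omega>)) \<Longrightarrow>
       (\<Sum>\<omega>\<in>F. 1 / (norm (z - \<omega>))\<^sup>2) \<le> K"
    using separated_inverse_square_sum[of "18 * e" \<rho>] rho pos by (metis mult_pos_pos zero_less_numeral)
  have 1: "(\<Sum>\<omega>\<in>F. 1 / (norm \<omega>)\<^sup>2) \<le> K" if F: "finite F" "F \<subseteq> near_zeros" for F
  proof -
    have "(\<Sum>\<omega>\<in>F. 1 / (norm (0 - \<omega>))\<^sup>2) \<le> K"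
    proof (rule K(2)[OF F(1)])
      show "18 * e \<le> \<bar>Im \<omega> - Im \<omega>'\<bar>" if "\<omega> \<in> F" "\<omega>' \<in> F" "\<omega> \<noteq> \<omega>'" for \<omega> \<omega>'
        using near_zeros_separated that F by blast
      show "\<rho> \<le> norm (0 - \<omega>)" if "\<omega> \<in> F" for \<omega>
        using near_zero_bounds(3)[of \<omega>] that F by (auto simp: \<rho>_def)
    qed
    then show ?thesis by simp
  qed
  have 2: "(\<Sum>\<omega>\<in>F. 1 / ((norm \<omega>)\<^sup>2 * (norm (s - \<omega>))\<^sup>2)) \<le> 4 * K / (norm s)\<^sup>2"
    if F: "finite F" "F \<subseteq> near_zeros" and far: "\<And>\<omega>. \<omega> \<in> F \<Longrightarrow> e \<le> norm (s - \<omega>)" and "s \<noteq> 0" for F s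
  proof -
    have s: "(\<Sum>\<omega>\<in>F. 1 / (norm (s - \<omega>))\<^sup>2) \<le> K"
    proof (rule K(2)[OF F(1)])
      show "18 * e \<le> \<bar>Im \<omega> - Im \<omega>'\<bar>" if "\<omega> \<in> F" "\<omega>' \<in> F" "\<omega> \<noteq> \<omega>'" for \<omega> \<omega>'
        using near_zeros_separated that F by blast
      show "\<rho> \<le> norm (s - \<omega>)" if "\<omega> \<in> F" for \<omega>
        using far[OF that] by (auto simp: \<rho>_def)
    qed
    have "(\<Sum>\<omega>\<in>F. 1 / ((norm \<omega>)\<^sup>2 * (norm (s - \<omega>))\<^sup>2)) \<le>
        (\<Sum>\<omega>\<in>F. 2 / (norm s)\<^sup>2 * (1 / (norm \<omega>)\<^sup>2 + 1 / (norm (s - \<omega>))\<^sup>2))"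
    proof (intro sum_mono inverse_square_product_le \<open>s \<noteq> 0\<close>)
      fix \<omega> assume w: "\<omega> \<in> F"
      then show "\<omega> \<noteq> 0" "s \<noteq> \<omega>" using near_zero_bounds(4)[of \<omega>] F far[OF w] pos by auto
    qed
    also have "\<dots> = 2 / (norm s)\<^sup>2 * ((\<Sum>\<omega>\<in>F. 1 / (norm \<omega>)\<^sup>2) + (\<Sum>\<omega>\<in>F. 1 / (norm (s - \<omega>))\<^sup>2))"
      by (simp only: sum_distrib_left[symmetric] sum.distrib)
    also have "\<dots> \<le> 2 / (norm s)\<^sup>2 * (K + K)"
      using 1[OF F] s by (intro mult_left_mono add_mono) auto
    finally show ?thesis by simp
  qed
  have "\<forall>F. finite F \<longrightarrow> F \<subseteq> near_zeros \<longrightarrow> (\<Sum>\<omega>\<in>F. 1 / (norm \<omega>)\<^sup>2) \<le> 4 * K"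
    using 1 K(1) by force
  with 2 K(1) show ?thesis by (intro exI[of _ "4 * K"] conjI) simp_all
qed

lemma inverse_square_summable: "(\<lambda>\<omega>. 1 / (norm \<omega>)\<^sup>2) summable_on near_zeros"
proof -
  obtain K where K: "\<forall>F. finite F \<longrightarrow> F \<subseteq> near_zeros \<longrightarrow> (\<Sum>\<omega>\<in>F. 1 / (norm \<omega>)\<^sup>2) \<le> K"
    using near_zeros_sum_bound by (elim exE conjE)
  show ?thesis
    by (rule nonneg_bdd_above_summable_on) (auto intro!: bdd_aboveI[of _ K] K[rule_format])
qed

lemma coeff_exp_summable:
  assumes "W \<subseteq> near_zeros" "0 \<le> y"
  shows "(\<lambda>\<omega>. norm (dim_term y \<omega>)) summable_on W"
    and "(\<lambda>\<omega>. norm (coeff \<omega> * exp ((\<omega> - 1) * of_real y))) summable_on W"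
proof -
  have ub: "norm (coeff \<omega> * exp ((\<omega> - a) * of_real y)) \<le> exp (D * y) * (1 / (norm \<omega>)\<^sup>2)"
    if "\<omega> \<in> W" "a \<in> {0, 1}" for \<omega> a
  proof -
    have "norm (exp ((\<omega> - a) * of_real y)) \<le> exp (D * y)"
      using near_zero_bounds(2)[of \<omega>] assms that by (auto intro!: mult_right_mono)
    moreover have "norm (coeff \<omega>) \<le> 1 / (norm \<omega>)\<^sup>2"
      using norm_coeff_le assms that by blast
    ultimately show ?thesis
      unfolding norm_mult by (subst mult.commute) (intro mult_mono; simp)
  qed
  have sm: "(\<lambda>\<omega>. exp (D * y) * (1 / (norm \<omega>)\<^sup>2)) summable_on W"
    by (intro summable_on_cmult_right summable_on_subset_banach[OF inverse_square_summable] assms)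
  show "(\<lambda>\<omega>. norm (dim_term y \<omega>)) summable_on W"
    by (rule summable_on_comparison_test[OF sm]) (use ub[where a = 0] in auto)
  show "(\<lambda>\<omega>. norm (coeff \<omega> * exp ((\<omega> - 1) * of_real y))) summable_on W"
    by (rule summable_on_comparison_test[OF sm]) (use ub[where a = 1] in auto)
qed

lemma finite_near_zeros_Im: "finite {\<omega> \<in> near_zeros. \<bar>Im \<omega>\<bar> \<le> R}"
proof -
  obtain K where K: "\<forall>F. finite F \<longrightarrow> F \<subseteq> near_zeros \<longrightarrow> (\<Sum>\<omega>\<in>F. 1 / (norm \<omega>)\<^sup>2) \<le> K"
    using near_zeros_sum_bound by (elim exE conjE)
  define Q where "Q = (D + \<bar>R\<bar>)\<^sup>2"
  have Q: "0 < Q" using D_pos by (auto simp: Q_def)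
  have "card F \<le> nat \<lceil>K * Q\<rceil>" if F: "F \<subseteq> {\<omega> \<in> near_zeros. \<bar>Im \<omega>\<bar> \<le> R}" "finite F" for F
  proof -
    have "1 / Q \<le> 1 / (norm \<omega>)\<^sup>2" if w: "\<omega> \<in> F" for \<omega>
    proof -
      have "norm \<omega> \<le> D + \<bar>R\<bar>"
        using cmod_le[of \<omega>] near_zero_bounds(1,2)[of \<omega>] w F e_small by fastforce
      then show ?thesis unfolding Q_def
        using near_zero_bounds(4)[of \<omega>] w F by (intro divide_left_mono power_mono mult_pos_pos) (auto simp: D_pos add_pos_nonneg)
    qed
    then have "real (card F) * (1 / Q) \<le> (\<Sum>\<omega>\<in>F. 1 / (norm \<omega>)\<^sup>2)"
      by (rule sum_bounded_below)
    also have "\<dots> \<le> K" using K F by auto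
    finally have "real (card F) \<le> K * Q" using Q by (simp add: field_simps)
    then show ?thesis by linarith
  qed
  then show ?thesis by (rule finite_if_finite_subsets_card_bdd[THEN conjunct1, rotated]) auto
qed

end

section \<open>Compensating the poles\<close>

context zero_control
begin

lemma strip_bounds:
  assumes "D - 5 * e \<le> Re s"
  shows "D - 1 \<le> Re s" "s \<noteq> 0" "norm s \<le> norm (s + 1)"
    "\<omega> \<in> near_zeros \<Longrightarrow> norm (s - \<omega>) \<le> norm (s - \<omega> + 1)"
proof -
  have *: "norm u \<le> norm (u + 1)" if "- 1 / 2 \<le> Re u" for u :: complex
    unfolding cmod_def using that by (intro real_sqrt_le_mono) (simp add: power2_eq_square algebra_simps)
  show "D - 1 \<le> Re s" "s \<noteq> 0" using assms e_small pos by auto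
  have "- 1 / 2 \<le> Re s" using assms e_small pos by linarith
  then show "norm s \<le> norm (s + 1)" by (rule *)
  assume "\<omega> \<in> near_zeros"
  then have "- 1 / 2 \<le> Re (s - \<omega>)"
    using near_zero_bounds(2)[of \<omega>] assms e_small pos unfolding minus_complex.sel by linarith
  then show "norm (s - \<omega>) \<le> norm (s - \<omega> + 1)" by (rule *)
qed

lemma kernel_sum_bound:
  "\<exists>K>0. \<forall>F s. finite F \<longrightarrow> F \<subseteq> near_zeros \<longrightarrow> D - 5 * e \<le> Re s \<longrightarrow> (\<forall>\<omega>\<in>F. e \<le> norm (s - \<omega>)) \<longrightarrow>
      norm (sum (pole_term s) F) \<le> K / (norm s)\<^sup>2"
proof -
  obtain K where K: "K > 0"
    "\<forall>F. finite F \<longrightarrow> F \<subseteq> near_zeros \<longrightarrow> (\<Sum>\<omega>\<in>F. 1 / (norm \<omega>)\<^sup>2) \<le> K"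
    "\<forall>F s. finite F \<longrightarrow> F \<subseteq> near_zeros \<longrightarrow> (\<forall>\<omega>\<in>F. e \<le> norm (s - \<omega>)) \<longrightarrow> s \<noteq> 0 \<longrightarrow>
      (\<Sum>\<omega>\<in>F. 1 / ((norm \<omega>)\<^sup>2 * (norm (s - \<omega>))\<^sup>2)) \<le> K / (norm s)\<^sup>2"
    using near_zeros_sum_bound by (elim exE conjE)
  have "norm (sum (pole_term s) F) \<le> K / (norm s)\<^sup>2"
    if F: "finite F" "F \<subseteq> near_zeros" "D - 5 * e \<le> Re s" "\<And>\<omega>. \<omega> \<in> F \<Longrightarrow> e \<le> norm (s - \<omega>)" for F s
  proof -
    have "norm (pole_term s \<omega>) \<le> 1 / ((norm \<omega>)\<^sup>2 * (norm (s - \<omega>))\<^sup>2)" if w: "\<omega> \<in> F" for \<omega>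
    proof -
      have near: "\<omega> \<in> near_zeros" using w F by blast
      have "0 < norm (s - \<omega>)" using F(4)[OF w] pos by linarith
      then have "norm (perron_kernel \<omega> 0 s) \<le> 1 / (norm (s - \<omega>))\<^sup>2"
        using strip_bounds(4)[OF F(3) near]
        unfolding perron_kernel_def norm_divide norm_mult power2_eq_square
        by (intro frac_le mult_left_mono) auto
      then show ?thesis
        using norm_coeff_le[OF near] mult_mono[of "norm (coeff \<omega>)" _ "norm (perron_kernel \<omega> 0 s)"]
        by (fastforce simp: norm_mult)
    qed
    then have "norm (sum (pole_term s) F) \<le>
        (\<Sum>\<omega>\<in>F. 1 / ((norm \<omega>)\<^sup>2 * (norm (s - \<omega>))\<^sup>2))"
      by (rule sum_norm_le)
    also have "\<dots> \<le> K / (norm s)\<^sup>2" using K(3) F strip_bounds(2)[OF F(3)] by blast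
    finally show ?thesis .
  qed
  then show ?thesis using K(1) by (intro exI[of _ K]) simp
qed

text \<open>Near a zero \<open>\<omega>\<close> the pole of the logarithmic derivative cancels against the one of the
  compensating kernel. With \<open>d = s - \<omega>\<close> the difference is exactly \<open>(p + q) / (s * (s + 1))\<close>, where \<open>p\<close>
  measures how far \<open>denom\<close> is from being linear, while \<open>q\<close> comes from freezing the factor
  \<open>1 / (s * (s + 1))\<close> at \<open>\<omega>\<close> and from the second factor of the kernel.\<close>

lemma pole_cancellation:
  "\<exists>C>0. \<forall>s \<omega>. D - 5 * e \<le> Re s \<longrightarrow> \<omega> \<in> near_zeros \<longrightarrow> s \<noteq> \<omega> \<longrightarrow> norm (s - \<omega>) \<le> e \<longrightarrow>
      norm (log_integrand 0 s - pole_term s \<omega>) \<le> C / (norm s)\<^sup>2"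
proof -
  define m where "m = D - 6 * e"
  have m: "0 < m" using e_small by (simp add: m_def)
  define C where "C = B / A + 2 * (1 + 1 / m + 2 / m\<^sup>2)"
  have "C > 0" unfolding C_def using pos m by (intro add_pos_pos mult_pos_pos divide_pos_pos) auto
  have "\<forall>s \<omega>. D - 5 * e \<le> Re s \<longrightarrow> \<omega> \<in> near_zeros \<longrightarrow> s \<noteq> \<omega> \<longrightarrow> norm (s - \<omega>) \<le> e \<longrightarrow>
      norm (log_integrand 0 s - pole_term s \<omega>) \<le> C / (norm s)\<^sup>2"
  proof (intro allI impI)
    fix s \<omega> assume s: "D - 5 * e \<le> Re s" and w: "\<omega> \<in> near_zeros" and ne: "s \<noteq> \<omega>" and close: "norm (s - \<omega>) \<le> e"
    define d where "d = s - \<omega>"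
    have d: "d \<noteq> 0" "s = \<omega> + d" using ne by (auto simp: d_def)
    have z: "denom \<omega> = 0" "D - 6 * e \<le> Re \<omega>" using w by (auto simp: near_zeros_def)
    note sb = strip_bounds[OF s] and wb = near_zero_bounds[OF w]
    have low: "A * norm d \<le> norm (denom s)"
      unfolding d_def by (rule zero_lower[OF z sb(1)]) (use close pos in simp)
    then have dn: "denom s \<noteq> 0" using d(1) pos by (auto simp: mult_le_0_iff)
    define p where "p = denom' s / denom s - 1 / d"
    define q where "q = (\<omega>\<^sup>2 - \<omega> - 1 - d) / (\<omega> * (\<omega> + 1) * (d + 1))"
    have nz: "\<omega> \<noteq> 0" "\<omega> + 1 \<noteq> 0" "s \<noteq> 0" "s + 1 \<noteq> 0" "d + 1 \<noteq> 0"
      using wb(4,5) sb(2,3) sb(4)[OF w] d(1) by (auto simp: d_def)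
    have "log_integrand 0 s - pole_term s \<omega> = (p + q) / (s * (s + 1))"
    proof -
      have "1 / (\<omega> * (\<omega> + 1)) * (1 / (d * (d + 1))) = (1 / d - q) / (s * (s + 1))"
      proof -
        have num: "\<omega> * (\<omega> + 1) * (d + 1) - d * (\<omega>\<^sup>2 - \<omega> - 1 - d) = s * (s + 1)"
          unfolding d(2) by (simp add: power2_eq_square algebra_simps)
        have "1 / d - q = (\<omega> * (\<omega> + 1) * (d + 1) - d * (\<omega>\<^sup>2 - \<omega> - 1 - d)) / (d * (\<omega> * (\<omega> + 1) * (d + 1)))"
          unfolding q_def using nz d(1) by (subst diff_frac_eq) (auto simp: mult_ac)
        then have "1 / d - q = s * (s + 1) / (d * (\<omega> * (\<omega> + 1) * (d + 1)))" unfolding num .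
        then show ?thesis using nz by (simp add: mult_ac)
      qed
      then show ?thesis
        by (simp add: log_integrand_def coeff_def perron_kernel_def p_def diff_divide_distrib add_divide_distrib
            d_def[symmetric] mult_ac)
    qed
    moreover have "norm p \<le> B / A"
    proof -
      have "p = (denom' s * d - denom s) / (denom s * d)"
        unfolding p_def using dn d(1) by (simp add: divide_simps)
      then have "norm p = norm (denom' s * d - denom s) / (norm (denom s) * norm d)"
        by (simp add: norm_divide norm_mult)
      also have "\<dots> \<le> (B * (norm d)\<^sup>2) / ((A * norm d) * norm d)"
        using zero_linear[OF z sb(1)] low pos d(1)
        by (intro frac_le mult_right_mono) (auto simp: d_def)
      also have "\<dots> = B / A" using d(1) pos by (simp add: power2_eq_square)
      finally show ?thesis .
    qed
    moreover have "norm q \<le> 2 * (1 + 1 / m + 2 / m\<^sup>2)"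
    proof -
      have wm: "m \<le> norm \<omega>" using wb(3) by (simp add: m_def)
      have "norm (\<omega>\<^sup>2 - \<omega> - 1 - d) \<le> norm (\<omega>\<^sup>2) + norm \<omega> + norm (1::complex) + norm d"
        by (intro order_trans[OF norm_triangle_ineq4] add_right_mono order_refl)
      also have "\<dots> \<le> (norm \<omega>)\<^sup>2 + norm \<omega> + 2" using close e_small by (simp add: d_def norm_power)
      finally have num: "norm (\<omega>\<^sup>2 - \<omega> - 1 - d) \<le> (norm \<omega>)\<^sup>2 + norm \<omega> + 2" .
      have "1 / 2 \<le> norm (d + 1)"
      proof -
        have "norm d \<le> e" using close by (simp add: d_def)
        then show ?thesis
          using norm_triangle_ineq2[of 1 "- d"] e_small by (simp add: add.commute)
      qed
      then have den: "(norm \<omega>)\<^sup>2 / 2 \<le> norm (\<omega> * (\<omega> + 1) * (d + 1))"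
        using mult_mono[OF mult_left_mono[OF wb(5), of "norm \<omega>"], of "1/2" "norm (d + 1)"]
        by (simp add: norm_mult power2_eq_square)
      have "norm q \<le> ((norm \<omega>)\<^sup>2 + norm \<omega> + 2) / ((norm \<omega>)\<^sup>2 / 2)"
        unfolding q_def norm_divide using num den nz(1) by (intro frac_le) auto
      also have "\<dots> = 2 * (1 + 1 / norm \<omega> + 2 / (norm \<omega>)\<^sup>2)"
        using nz(1) by (simp add: add_divide_distrib power2_eq_square)
      also have "\<dots> \<le> 2 * (1 + 1 / m + 2 / m\<^sup>2)"
        using wm m by (intro mult_left_mono add_mono divide_left_mono power_mono mult_pos_pos zero_less_power) auto
      finally show ?thesis .
    qed
    ultimately have "norm (log_integrand 0 s - pole_term s \<omega>) \<le> C / (norm s * norm (s + 1))"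
      unfolding C_def by (simp add: norm_divide norm_mult divide_right_mono norm_triangle_mono)
    also have "\<dots> \<le> C / (norm s)\<^sup>2"
      unfolding power2_eq_square using sb nz \<open>C > 0\<close> by (intro divide_left_mono mult_left_mono) auto
    finally show "norm (log_integrand 0 s - pole_term s \<omega>) \<le> C / (norm s)\<^sup>2" .
  qed
  with \<open>C > 0\<close> show ?thesis by (intro exI[of _ C]) simp
qed

text \<open>At most one zero lies within \<open>e\<close> of \<open>s\<close>. If there is one, its pole is cancelled and the other
  terms are small by separation; otherwise \<open>denom\<close> is bounded from below at \<open>s\<close>. The set \<open>F\<close> must
  contain all zeros at about the height of \<open>s\<close>, but it may contain others, and the bound does not
  depend on it.\<close>

lemma remainder_bound:
  "\<exists>C>0. \<forall>F s. finite F \<longrightarrow> F \<subseteq> near_zeros \<longrightarrow> {\<omega> \<in> near_zeros. \<bar>Im \<omega>\<bar> \<le> \<bar>Im s\<bar> + e} \<subseteq> F \<longrightarrow>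
      D - 5 * e \<le> Re s \<longrightarrow> s \<notin> F \<longrightarrow>
      norm (log_integrand 0 s - (sum (pole_term s) F)) \<le> C / (norm s)\<^sup>2"
proof -
  obtain K where K: "K > 0"
    "\<forall>F s. finite F \<longrightarrow> F \<subseteq> near_zeros \<longrightarrow> D - 5 * e \<le> Re s \<longrightarrow> (\<forall>\<omega>\<in>F. e \<le> norm (s - \<omega>)) \<longrightarrow>
      norm (sum (pole_term s) F) \<le> K / (norm s)\<^sup>2"
    using kernel_sum_bound by (elim exE conjE)
  obtain C0 where C0: "C0 > 0"
    "\<forall>s \<omega>. D - 5 * e \<le> Re s \<longrightarrow> \<omega> \<in> near_zeros \<longrightarrow> s \<noteq> \<omega> \<longrightarrow> norm (s - \<omega>) \<le> e \<longrightarrow>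
      norm (log_integrand 0 s - pole_term s \<omega>) \<le> C0 / (norm s)\<^sup>2"
    using pole_cancellation by (elim exE conjE)
  define C where "C = C0 + B / (A * e) + K"
  have "norm (log_integrand 0 s - (sum (pole_term s) F)) \<le> C / (norm s)\<^sup>2"
    if F: "finite F" "F \<subseteq> near_zeros" "{\<omega> \<in> near_zeros. \<bar>Im \<omega>\<bar> \<le> \<bar>Im s\<bar> + e} \<subseteq> F"
      and s: "D - 5 * e \<le> Re s" "s \<notin> F" for F s
  proof (cases "\<exists>\<omega>0\<in>near_zeros. norm (s - \<omega>0) \<le> e")
    case True
    then obtain \<omega>0 where w0: "\<omega>0 \<in> near_zeros" "norm (s - \<omega>0) \<le> e" by blast
    have "\<bar>Im \<omega>0\<bar> \<le> \<bar>Im s\<bar> + e" using abs_Im_le_cmod[of "s - \<omega>0"] w0(2) by simp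
    then have inF: "\<omega>0 \<in> F" using F(3) w0(1) by blast
    have far: "e \<le> norm (s - \<omega>)" if "\<omega> \<in> F - {\<omega>0}" for \<omega>
    proof -
      have "18 * e \<le> \<bar>Im \<omega> - Im \<omega>0\<bar>" using near_zeros_separated[of \<omega> \<omega>0] that w0 F by auto
      then show ?thesis
        using abs_Im_le_cmod[of "s - \<omega>0"] abs_Im_le_cmod[of "s - \<omega>"] w0(2) by simp
    qed
    have "(sum (pole_term s) F) = coeff \<omega>0 * perron_kernel \<omega>0 0 s
        + (\<Sum>\<omega>\<in>F - {\<omega>0}. pole_term s \<omega>)"
      using F(1) inF by (rule sum.remove)
    then have "norm (log_integrand 0 s - (sum (pole_term s) F)) \<le>
        norm (log_integrand 0 s - coeff \<omega>0 * perron_kernel \<omega>0 0 s)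
        + norm (\<Sum>\<omega>\<in>F - {\<omega>0}. pole_term s \<omega>)"
      by (simp add: diff_diff_eq[symmetric] norm_triangle_ineq4)
    also have "\<dots> \<le> C0 / (norm s)\<^sup>2 + K / (norm s)\<^sup>2"
      using F s w0 far inF by (intro add_mono C0(2)[rule_format] K(2)[rule_format]) auto
    also have "\<dots> \<le> C / (norm s)\<^sup>2"
      unfolding C_def add_divide_distrib[symmetric] using pos by (intro divide_right_mono) auto
    finally show ?thesis .
  next
    case False
    note sb = strip_bounds[OF s(1)]
    have "A * e \<le> norm (denom s)"
    proof (rule zero_free_lower[OF s(1) pos(1) order_refl])
      fix z assume z: "norm (s - z) \<le> e"
      have "D - 6 * e \<le> Re z" using abs_Re_le_cmod[of "s - z"] z s(1) by simp
      then show "denom z \<noteq> 0" using False z by (auto simp: near_zeros_def)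
    qed
    then have "norm (log_integrand 0 s) \<le> B / ((A * e) * (norm s * norm s))"
      unfolding log_integrand_def norm_divide norm_mult
      using denom'_le[OF sb(1)] sb pos by (intro frac_le mult_mono mult_pos_pos) auto
    then have "norm (log_integrand 0 s) \<le> (B / (A * e)) / (norm s)\<^sup>2" by (simp add: power2_eq_square)
    moreover have "norm (sum (pole_term s) F) \<le> K / (norm s)\<^sup>2"
      using F s False by (intro K(2)[rule_format]) (auto simp: not_le less_imp_le subset_iff)
    ultimately have "norm (log_integrand 0 s - (sum (pole_term s) F))
        \<le> (B / (A * e)) / (norm s)\<^sup>2 + K / (norm s)\<^sup>2"
      by (intro order_trans[OF norm_triangle_ineq4] add_mono)
    also have "\<dots> \<le> C / (norm s)\<^sup>2"
      unfolding C_def add_divide_distrib[symmetric] using C0(1) by (intro divide_right_mono) auto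
    finally show ?thesis .
  qed
  moreover have "C > 0" unfolding C_def using C0(1) K(1) pos by (intro add_pos_pos divide_pos_pos mult_pos_pos) auto
  ultimately show ?thesis by (intro exI[of _ C]) simp
qed

end

section \<open>The explicit formula\<close>

context zero_control
begin

text \<open>Poles slightly above the height \<open>T\<close> still influence the segment up to height \<open>T\<close>, hence the
  margin \<open>1\<close>.\<close>

definition low_zeros :: "real \<Rightarrow> complex set" where
  "low_zeros T = {\<omega> \<in> near_zeros. \<bar>Im \<omega>\<bar> \<le> T + 1}"

lemma low_zeros: "finite (low_zeros T)" "low_zeros T \<subseteq> near_zeros"
  using finite_near_zeros_Im by (auto simp: low_zeros_def)

definition compensator :: "real \<Rightarrow> real \<Rightarrow> complex \<Rightarrow> complex" where
  "compensator T y s = (\<Sum>\<omega>\<in>low_zeros T. coeff \<omega> * perron_kernel \<omega> y s)"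

lemma regular_remainder:
  "\<exists>C>0. \<forall>T>0. \<exists>G. G holomorphic_on {s. D - 5 * e < Re s \<and> \<bar>Im s\<bar> < T + 1 / 2} \<and>
     (\<forall>s. D < Re s \<longrightarrow> \<bar>Im s\<bar> < T + 1 / 2 \<longrightarrow> G s = log_integrand 0 s - compensator T 0 s) \<and>
     (\<forall>s. D - 5 * e < Re s \<longrightarrow> \<bar>Im s\<bar> < T + 1 / 2 \<longrightarrow> norm (G s) \<le> C / (norm s)\<^sup>2)"
proof -
  obtain C where C: "C > 0" "\<forall>F s. finite F \<longrightarrow> F \<subseteq> near_zeros \<longrightarrow>
      {\<omega> \<in> near_zeros. \<bar>Im \<omega>\<bar> \<le> \<bar>Im s\<bar> + e} \<subseteq> F \<longrightarrow> D - 5 * e \<le> Re s \<longrightarrow> s \<notin> F \<longrightarrow>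
      norm (log_integrand 0 s - (sum (pole_term s) F)) \<le> C / (norm s)\<^sup>2"
    using remainder_bound by (elim exE conjE)
  have "\<exists>G. G holomorphic_on {s. D - 5 * e < Re s \<and> \<bar>Im s\<bar> < T + 1 / 2} \<and>
     (\<forall>s. D < Re s \<longrightarrow> \<bar>Im s\<bar> < T + 1 / 2 \<longrightarrow> G s = log_integrand 0 s - compensator T 0 s) \<and>
     (\<forall>s. D - 5 * e < Re s \<longrightarrow> \<bar>Im s\<bar> < T + 1 / 2 \<longrightarrow> norm (G s) \<le> C / (norm s)\<^sup>2)" if T: "T > 0" for T
  proof -
    define S where "S = {s. D - 5 * e < Re s \<and> \<bar>Im s\<bar> < T + 1 / 2}"
    have "\<exists>G. G holomorphic_on S \<and> (\<forall>s\<in>S - low_zeros T. G s = log_integrand 0 s - compensator T 0 s) \<and>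
       (\<forall>s\<in>S. norm (G s) \<le> C / (norm s)\<^sup>2)"
    proof (rule holomorphic_extension_bounded[OF low_zeros(1)])
      have "S = {s. D - 5 * e < Re s} \<inter> {s. Im s < T + 1 / 2} \<inter> {s. - (T + 1 / 2) < Im s}"
        by (auto simp: S_def)
      then show "open S"
        by (simp add: open_Int open_halfspace_Re_gt open_halfspace_Im_lt open_halfspace_Im_gt)
      have denom_nz: "denom s \<noteq> 0" if "s \<in> S - low_zeros T" for s
        using that pos by (auto simp: S_def low_zeros_def near_zeros_def)
      have nz: "s \<noteq> 0 \<and> s + 1 \<noteq> 0" if "s \<in> S" for s
      proof -
        have "D - 5 * e \<le> Re s" using that by (simp add: S_def)
        from strip_bounds(2,3)[OF this] show ?thesis by auto
      qed
      have knz: "s - \<omega> \<noteq> 0 \<and> s - \<omega> + 1 \<noteq> 0" if "s \<in> S - low_zeros T" "\<omega> \<in> low_zeros T" for s \<omega>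
      proof -
        have "D - 5 * e \<le> Re s" "\<omega> \<in> near_zeros" "s \<noteq> \<omega>"
          using that low_zeros by (auto simp: S_def)
        then show ?thesis using strip_bounds(4)[of s \<omega>] by auto
      qed
      show "(\<lambda>s. log_integrand 0 s - compensator T 0 s) holomorphic_on S - low_zeros T"
        unfolding log_integrand_def compensator_def perron_kernel_def
        using denom_nz nz knz
        by (intro holomorphic_intros denom_holomorphic denom'_holomorphic) auto
      show "continuous_on S (\<lambda>s. C / (norm s)\<^sup>2)"
        using nz by (intro continuous_intros) auto
      fix s assume s: "s \<in> S - low_zeros T"
      have "{\<omega> \<in> near_zeros. \<bar>Im \<omega>\<bar> \<le> \<bar>Im s\<bar> + e} \<subseteq> low_zeros T"
        using s e_small by (auto simp: S_def low_zeros_def)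
      then show "norm (log_integrand 0 s - compensator T 0 s) \<le> C / (norm s)\<^sup>2"
        unfolding compensator_def using s by (intro C(2)[rule_format] low_zeros) (auto simp: S_def)
    qed
    then obtain G where G: "G holomorphic_on S" "\<And>s. s \<in> S - low_zeros T \<Longrightarrow> G s = log_integrand 0 s - compensator T 0 s"
       "\<And>s. s \<in> S \<Longrightarrow> norm (G s) \<le> C / (norm s)\<^sup>2" by blast
    show ?thesis
    proof (intro exI[of _ G] conjI allI impI)
      fix s assume s: "D < Re s" "\<bar>Im s\<bar> < T + 1 / 2"
      have "s \<notin> low_zeros T" using s denom_nonzero_right[of s] by (auto simp: low_zeros_def near_zeros_def)
      then show "G s = log_integrand 0 s - compensator T 0 s"
        using s pos by (intro G(2)) (auto simp: S_def)
    qed (use G in \<open>auto simp: S_def\<close>)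
  qed
  then show ?thesis using C(1) by (intro exI[of _ C]) simp
qed

lemma log_integrand_factor: "log_integrand y s = exp (s * of_real y) * log_integrand 0 s"
  by (simp add: log_integrand_def)

lemma compensator_factor: "compensator T y s = exp (s * of_real y) * compensator T 0 s"
  by (simp add: compensator_def perron_kernel_def sum_distrib_left mult_ac)

text \<open>The Laplace inversion of the compensating kernel at \<open>\<omega>\<close>: the wanted residue together with a
  by-product that is smaller by a factor \<open>e\<^sup>y\<close>.\<close>

definition residue_term :: "real \<Rightarrow> complex \<Rightarrow> complex" where
  "residue_term y \<omega> = coeff \<omega> * (exp (\<omega> * of_real y) - exp ((\<omega> - 1) * of_real y))"

lemma compensator_integral:
  "\<exists>K>0. \<forall>T y. 0 < T \<longrightarrow> 0 \<le> y \<longrightarrow>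
    continuous_on UNIV (\<lambda>t. compensator T y (Complex (D + 1) t)) \<and>
    norm (complex_of_real (2 * pi) * (\<Sum>\<omega>\<in>low_zeros T. residue_term y \<omega>)
      - vertical_integral (compensator T y) (D + 1) T) \<le> 2 * (exp ((D + 1) * y) * K) / T"
proof -
  obtain K where K: "K > 0" "\<forall>F s. finite F \<longrightarrow> F \<subseteq> near_zeros \<longrightarrow> D - 5 * e \<le> Re s \<longrightarrow>
      (\<forall>\<omega>\<in>F. e \<le> norm (s - \<omega>)) \<longrightarrow>
      norm (sum (pole_term s) F) \<le> K / (norm s)\<^sup>2"
    using kernel_sum_bound by (elim exE conjE)
  have "continuous_on UNIV (\<lambda>t. compensator T y (Complex (D + 1) t)) \<and>
    norm (complex_of_real (2 * pi) * (\<Sum>\<omega>\<in>low_zeros T. residue_term y \<omega>)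
      - vertical_integral (compensator T y) (D + 1) T) \<le> 2 * (exp ((D + 1) * y) * K) / T"
    if T: "0 < T" and y: "0 \<le> y" for T y
  proof
    let ?s = "\<lambda>t. Complex (D + 1) t"
    have near: "\<omega> \<in> near_zeros" if "\<omega> \<in> low_zeros T" for \<omega> using that low_zeros by blast
    have far: "1 \<le> norm (?s t - \<omega>)" if "\<omega> \<in> low_zeros T" for \<omega> t
      using abs_Re_le_cmod[of "?s t - \<omega>"] near_zero_bounds(2)[OF near[OF that]] by simp
    have nz: "?s t - \<omega> \<noteq> 0 \<and> ?s t - \<omega> + 1 \<noteq> 0" if "\<omega> \<in> low_zeros T" for \<omega> t
      using near_zero_bounds(2)[OF near[OF that]] by (auto simp: complex_eq_iff)
    have cont1: "continuous_on X (\<lambda>t. perron_kernel \<omega> y (?s t))" if "\<omega> \<in> low_zeros T" for \<omega> X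
      unfolding perron_kernel_def using nz[OF that]
      by (auto simp: Complex_eq intro!: continuous_intros)
    show cont: "continuous_on UNIV (\<lambda>t. compensator T y (?s t))"
      unfolding compensator_def by (intro continuous_intros cont1)
    show "norm (complex_of_real (2 * pi) * (\<Sum>\<omega>\<in>low_zeros T. residue_term y \<omega>)
        - integral {-T..T} (\<lambda>t. compensator T y (?s t))) \<le> 2 * (exp ((D + 1) * y) * K) / T"
    proof (rule symmetric_integral_tail_bound[OF T cont])
      fix t assume t: "T \<le> \<bar>t\<bar>"
      have "norm (compensator T 0 (?s t)) \<le> K / (norm (?s t))\<^sup>2"
        unfolding compensator_def
      proof (intro K(2)[rule_format] low_zeros)
        show "e \<le> norm (?s t - \<omega>)" if "\<omega> \<in> low_zeros T" for \<omega>
          using far[OF that, of t] e_small by simp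
      qed (use pos in simp)
      also have "\<dots> \<le> K / t\<^sup>2"
        using K(1) t T by (intro divide_left_mono) (auto simp: cmod_power2 intro!: mult_pos_pos add_nonneg_pos)
      finally have "norm (compensator T 0 (?s t)) \<le> K / t\<^sup>2" .
      then have "exp ((D + 1) * y) * norm (compensator T 0 (?s t)) \<le> exp ((D + 1) * y) * (K / t\<^sup>2)"
        by (intro mult_left_mono) auto
      then show "norm (compensator T y (?s t)) \<le> exp ((D + 1) * y) * K / t\<^sup>2"
        by (subst compensator_factor) (simp add: norm_mult)
    next
      have "integral {-R..R} (\<lambda>t. compensator T y (?s t)) =
          (\<Sum>\<omega>\<in>low_zeros T. coeff \<omega> * integral {-R..R} (\<lambda>t. perron_kernel \<omega> y (?s t)))" for R
        unfolding compensator_def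
        by (subst integral_sum) (auto intro!: low_zeros integrable_continuous_interval continuous_intros cont1)
      moreover have "((\<lambda>R. \<Sum>\<omega>\<in>low_zeros T. coeff \<omega> * integral {-R..R} (\<lambda>t. perron_kernel \<omega> y (?s t)))
          \<longlongrightarrow> (\<Sum>\<omega>\<in>low_zeros T. coeff \<omega> * (complex_of_real (2 * pi) * (exp (\<omega> * y) - exp ((\<omega> - 1) * y))))) at_top"
      proof (intro tendsto_sum tendsto_mult tendsto_const)
        fix \<omega> assume "\<omega> \<in> low_zeros T"
        then have "Re \<omega> < D + 1" using near_zero_bounds(2)[OF near] by fastforce
        from perron_kernel_tendsto_nonneg[OF this y]
        show "((\<lambda>R. integral {-R..R} (\<lambda>t. perron_kernel \<omega> y (?s t))) \<longlongrightarrow>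
          complex_of_real (2 * pi) * (exp (\<omega> * y) - exp ((\<omega> - 1) * y))) at_top" by simp
      qed
      ultimately show "((\<lambda>R. integral {-R..R} (\<lambda>t. compensator T y (?s t))) \<longlongrightarrow>
          complex_of_real (2 * pi) * (\<Sum>\<omega>\<in>low_zeros T. residue_term y \<omega>)) at_top"
        by (simp add: residue_term_def sum_distrib_left mult_ac)
    qed
  qed
  then show ?thesis using K(1) by (intro exI[of _ K]) simp
qed

lemma integral_inverse_square_bound:
  fixes a T :: real
  assumes "0 < a" "0 < T"
  shows "(\<lambda>t. 1 / (a\<^sup>2 + t\<^sup>2)) integrable_on {-T..T}" "integral {-T..T} (\<lambda>t. 1 / (a\<^sup>2 + t\<^sup>2)) \<le> pi / a"
proof -
  have h: "((\<lambda>t. 1 / (a\<^sup>2 + t\<^sup>2)) has_integral (arctan (T / a) / a - arctan (-T / a) / a)) {-T..T}"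
  proof (rule fundamental_theorem_of_calculus)
    fix t assume "t \<in> {-T..T}"
    have "1 + (t / a)\<^sup>2 = (a\<^sup>2 + t\<^sup>2) / a\<^sup>2" using assms by (simp add: power_divide add_divide_distrib)
    then have "inverse (1 + (t / a)\<^sup>2) * (1 / a) / a = 1 / (a\<^sup>2 + t\<^sup>2)"
      using assms by (simp add: power2_eq_square)
    moreover have "((\<lambda>t. arctan (t / a) / a) has_real_derivative (inverse (1 + (t / a)\<^sup>2) * (1 / a) / a)) (at t within {-T..T})"
      by (rule DERIV_cdivide[OF DERIV_chain2[OF DERIV_arctan DERIV_cdivide[OF DERIV_ident]]])
    ultimately show "((\<lambda>t. arctan (t / a) / a) has_vector_derivative 1 / (a\<^sup>2 + t\<^sup>2)) (at t within {-T..T})"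
      by (simp add: has_real_derivative_iff_has_vector_derivative)
  qed (use assms in simp)
  show "(\<lambda>t. 1 / (a\<^sup>2 + t\<^sup>2)) integrable_on {-T..T}" using h by blast
  have "arctan (T / a) - arctan (-T / a) \<le> pi / 2 + pi / 2"
    using arctan_ubound[of "T / a"] arctan_lbound[of "-T / a"] by linarith
  then have "(arctan (T / a) - arctan (-T / a)) / a \<le> pi / a"
    using assms by (intro divide_right_mono) auto
  then show "integral {-T..T} (\<lambda>t. 1 / (a\<^sup>2 + t\<^sup>2)) \<le> pi / a"
    using integral_unique[OF h] by (simp add: diff_divide_distrib)
qed

text \<open>After subtraction of the compensator the integrand is holomorphic across the zeros and decays
  quadratically, so the line of integration moves from \<open>D + 1\<close> to \<open>D - 4 * e\<close> irrespective of the zeros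
  on or near the latter line. The compensator itself is integrated on the original line.\<close>

lemma truncated_explicit_formula:
  "\<exists>C>0. \<forall>y\<ge>0. \<exists>E. \<forall>T\<ge>1. norm (vertical_integral (log_integrand y) (D + 1) T
      - complex_of_real (2 * pi) * (\<Sum>\<omega>\<in>low_zeros T. residue_term y \<omega>)) \<le> C * exp ((D - 4 * e) * y) + E / T"
proof -
  obtain C where C: "C > 0" "\<forall>T>0. \<exists>G. G holomorphic_on {s. D - 5 * e < Re s \<and> \<bar>Im s\<bar> < T + 1 / 2} \<and>
     (\<forall>s. D < Re s \<longrightarrow> \<bar>Im s\<bar> < T + 1 / 2 \<longrightarrow> G s = log_integrand 0 s - compensator T 0 s) \<and>
     (\<forall>s. D - 5 * e < Re s \<longrightarrow> \<bar>Im s\<bar> < T + 1 / 2 \<longrightarrow> norm (G s) \<le> C / (norm s)\<^sup>2)"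
    using regular_remainder by (elim exE conjE)
  obtain K where K: "K > 0" "\<forall>T y. 0 < T \<longrightarrow> 0 \<le> y \<longrightarrow>
    continuous_on UNIV (\<lambda>t. compensator T y (Complex (D + 1) t)) \<and>
    norm (complex_of_real (2 * pi) * (\<Sum>\<omega>\<in>low_zeros T. residue_term y \<omega>)
      - vertical_integral (compensator T y) (D + 1) T) \<le> 2 * (exp ((D + 1) * y) * K) / T"
    using compensator_integral by (elim exE conjE)
  define c where "c = D + 1"
  define c1 where "c1 = D - 4 * e"
  have c1: "0 < c1" "D - 5 * e < c1" "c1 < c" using pos e_small by (auto simp: c_def c1_def)
  have "norm (vertical_integral (log_integrand y) c T
      - complex_of_real (2 * pi) * (\<Sum>\<omega>\<in>low_zeros T. residue_term y \<omega>))
      \<le> (C * pi / c1) * exp (c1 * y) + (2 * (c - c1) * (exp (c * y) * C) + 2 * (exp (c * y) * K)) / T"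
    if y: "0 \<le> y" and T1: "1 \<le> T" for y T
  proof -
    have T: "0 < T" using T1 by simp
    obtain G where G: "G holomorphic_on {s. D - 5 * e < Re s \<and> \<bar>Im s\<bar> < T + 1 / 2}"
     "\<And>s. D < Re s \<Longrightarrow> \<bar>Im s\<bar> < T + 1 / 2 \<Longrightarrow> G s = log_integrand 0 s - compensator T 0 s"
     "\<And>s. D - 5 * e < Re s \<Longrightarrow> \<bar>Im s\<bar> < T + 1 / 2 \<Longrightarrow> norm (G s) \<le> C / (norm s)\<^sup>2"
      using C(2)[rule_format, OF T] by blast
    define H where "H s = exp (s * of_real y) * G s" for s
    have H_hol: "H holomorphic_on cbox (Complex c1 (-T)) (Complex c T)"
      unfolding H_def using c1
      by (intro holomorphic_intros holomorphic_on_subset[OF G(1)]) (auto simp: in_cbox_complex_iff)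
    have H_bound: "norm (H s) \<le> exp (Re s * y) * (C / (norm s)\<^sup>2)" if "c1 \<le> Re s" "\<bar>Im s\<bar> \<le> T" for s
      unfolding H_def norm_mult using G(3)[of s] that c1 by (intro mult_mono) auto
    have H_cont: "continuous_on {-T..T} (\<lambda>t. H (Complex r t))" if "c1 \<le> r" "r \<le> c" for r
      by (rule continuous_on_compose2[OF holomorphic_on_imp_continuous_on[OF H_hol]])
         (use that in \<open>auto simp: Complex_eq in_cbox_complex_iff intro!: continuous_intros\<close>)
    have eq: "log_integrand y (Complex c t) = H (Complex c t) + compensator T y (Complex c t)"
      if "t \<in> {-T..T}" for t
    proof -
      have "G (Complex c t) = log_integrand 0 (Complex c t) - compensator T 0 (Complex c t)"
        using that by (intro G(2)) (auto simp: c_def)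
      then show ?thesis
        by (simp add: H_def log_integrand_factor[of y] compensator_factor[of T y] right_diff_distrib)
    qed
    have "vertical_integral (log_integrand y) c T =
        integral {-T..T} (\<lambda>t. H (Complex c t) + compensator T y (Complex c t))"
      using eq by (rule integral_cong)
    also have "\<dots> = vertical_integral H c T + vertical_integral (compensator T y) c T"
      using K(2)[rule_format, OF T y] c1(3)
      by (intro integral_add integrable_continuous_interval H_cont)
         (auto simp: c_def intro: continuous_on_subset)
    finally have split: "vertical_integral (log_integrand y) c T =
        vertical_integral H c T + vertical_integral (compensator T y) c T" .
    have shift: "norm (vertical_integral H c T - vertical_integral H c1 T)
        \<le> 2 * (c - c1) * (exp (c * y) * C / T\<^sup>2)"
    proof (rule vertical_shift_estimate[OF c1(3) T H_hol])
      fix s assume s: "\<bar>Im s\<bar> = T" "c1 \<le> Re s" "Re s \<le> c"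
      have "T\<^sup>2 \<le> (norm s)\<^sup>2" using abs_Im_le_cmod[of s] s T by (intro power_mono) auto
      then have "C / (norm s)\<^sup>2 \<le> C / T\<^sup>2"
        using T C(1) by (intro divide_left_mono mult_pos_pos) (auto intro: less_le_trans[of _ "T\<^sup>2"])
      moreover have "exp (Re s * y) \<le> exp (c * y)" using s y by (auto intro: mult_right_mono)
      ultimately have "exp (Re s * y) * (C / (norm s)\<^sup>2) \<le> exp (c * y) * (C / T\<^sup>2)"
        using C(1) by (intro mult_mono) auto
      then show "norm (H s) \<le> exp (c * y) * C / T\<^sup>2" using H_bound[of s] s by simp
    qed
    also have "\<dots> \<le> 2 * (c - c1) * (exp (c * y) * C / T)"
      using T1 T c1 C(1) by (intro mult_left_mono divide_left_mono mult_pos_pos) (auto simp: power2_eq_square)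
    finally have shift: "norm (vertical_integral H c T - vertical_integral H c1 T)
        \<le> 2 * (c - c1) * (exp (c * y) * C / T)" .
    have left: "norm (vertical_integral H c1 T) \<le> (C * pi / c1) * exp (c1 * y)"
    proof -
      have "norm (vertical_integral H c1 T) \<le>
          integral {-T..T} (\<lambda>t. exp (c1 * y) * C * (1 / (c1\<^sup>2 + t\<^sup>2)))"
      proof (rule integral_norm_bound_integral)
        show "(\<lambda>t. H (Complex c1 t)) integrable_on {-T..T}"
          using c1(3) by (intro integrable_continuous_interval H_cont) auto
        show "(\<lambda>t. exp (c1 * y) * C * (1 / (c1\<^sup>2 + t\<^sup>2))) integrable_on {-T..T}"
          by (intro integrable_on_mult_right integral_inverse_square_bound c1 T)
        show "norm (H (Complex c1 t)) \<le> exp (c1 * y) * C * (1 / (c1\<^sup>2 + t\<^sup>2))" if "t \<in> {-T..T}" for t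
        proof -
          have "\<bar>t\<bar> \<le> T" using that by auto
          then show ?thesis using H_bound[of "Complex c1 t"] by (simp add: cmod_power2)
        qed
      qed
      also have "\<dots> = exp (c1 * y) * C * integral {-T..T} (\<lambda>t. 1 / (c1\<^sup>2 + t\<^sup>2))"
        by (rule integral_mult_right)
      also have "\<dots> \<le> exp (c1 * y) * C * (pi / c1)"
        using integral_inverse_square_bound(2)[OF c1(1) T] C(1) by (intro mult_left_mono) auto
      finally show ?thesis by (simp add: mult_ac)
    qed
    let ?I = "\<lambda>r. vertical_integral H r T"
    let ?J = "vertical_integral (compensator T y) c T"
    let ?S = "complex_of_real (2 * pi) * (\<Sum>\<omega>\<in>low_zeros T. residue_term y \<omega>)"
    have tail: "norm (?S - ?J) \<le> 2 * (exp (c * y) * K) / T"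
      using K(2)[rule_format, OF T y] by (simp add: c_def)
    have tri: "norm (u + j - k) \<le> norm v + norm (u - v) + norm (k - j)" for u j k v :: complex
      using norm_triangle_ineq4[of "v + (u - v)" "k - j"] norm_triangle_ineq[of v "u - v"]
      by (simp add: diff_diff_eq2)
    have "norm (?I c + ?J - ?S) \<le> norm (?I c1) + norm (?I c - ?I c1) + norm (?S - ?J)"
      by (rule tri)
    also have "\<dots> \<le> (C * pi / c1) * exp (c1 * y) + 2 * (c - c1) * (exp (c * y) * C / T) + 2 * (exp (c * y) * K) / T"
      by (intro add_mono left shift tail)
    finally show ?thesis unfolding split by (simp add: add_divide_distrib)
  qed
  moreover have "0 < C * pi / c1" using C(1) c1 by simp
  ultimately show ?thesis unfolding c_def c1_def by (intro exI[of _ "C * pi / (D - 4 * e)"]) auto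
qed

lemma coeff_exp_abs_bound:
  assumes "W \<subseteq> near_zeros" "0 \<le> y" "\<And>\<omega>. \<omega> \<in> W \<Longrightarrow> Re \<omega> \<le> \<beta>"
  shows "norm (\<Sum>\<^sub>\<infinity>\<omega>\<in>W. dim_term y \<omega>) \<le> exp (\<beta> * y) * (\<Sum>\<^sub>\<infinity>\<omega>\<in>W. 1 / (norm \<omega>)\<^sup>2)"
    and "norm (\<Sum>\<^sub>\<infinity>\<omega>\<in>W. coeff \<omega> * exp ((\<omega> - 1) * of_real y)) \<le> exp ((\<beta> - 1) * y) * (\<Sum>\<^sub>\<infinity>\<omega>\<in>W. 1 / (norm \<omega>)\<^sup>2)"
proof -
  have sm: "(\<lambda>\<omega>. 1 / (norm \<omega>)\<^sup>2) summable_on W"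
    by (rule summable_on_subset_banach[OF inverse_square_summable assms(1)])
  have gen: "norm (\<Sum>\<^sub>\<infinity>\<omega>\<in>W. coeff \<omega> * f \<omega>) \<le> Q * (\<Sum>\<^sub>\<infinity>\<omega>\<in>W. 1 / (norm \<omega>)\<^sup>2)"
    if f: "\<And>\<omega>. \<omega> \<in> W \<Longrightarrow> norm (f \<omega>) \<le> Q" and Q: "0 \<le> Q" for f Q
  proof -
    have ub: "norm (coeff \<omega> * f \<omega>) \<le> Q * (1 / (norm \<omega>)\<^sup>2)" if "\<omega> \<in> W" for \<omega>
      using norm_coeff_le[of \<omega>] f[OF that] that assms(1) Q unfolding norm_mult
      by (subst mult.commute) (intro mult_mono, auto)
    have abs: "(\<lambda>\<omega>. norm (coeff \<omega> * f \<omega>)) summable_on W"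
      by (rule summable_on_comparison_test[OF summable_on_cmult_right[OF sm, of Q]]) (use ub in auto)
    have "norm (\<Sum>\<^sub>\<infinity>\<omega>\<in>W. coeff \<omega> * f \<omega>) \<le> (\<Sum>\<^sub>\<infinity>\<omega>\<in>W. norm (coeff \<omega> * f \<omega>))"
      by (rule norm_infsum_bound[OF abs])
    also have "\<dots> \<le> (\<Sum>\<^sub>\<infinity>\<omega>\<in>W. Q * (1 / (norm \<omega>)\<^sup>2))"
      by (rule infsum_mono[OF abs summable_on_cmult_right[OF sm] ub])
    also have "\<dots> = Q * (\<Sum>\<^sub>\<infinity>\<omega>\<in>W. 1 / (norm \<omega>)\<^sup>2)"
      by (rule infsum_cmult_right) (use sm in simp)
    finally show ?thesis .
  qed
  show "norm (\<Sum>\<^sub>\<infinity>\<omega>\<in>W. dim_term y \<omega>) \<le> exp (\<beta> * y) * (\<Sum>\<^sub>\<infinity>\<omega>\<in>W. 1 / (norm \<omega>)\<^sup>2)"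
    using assms by (intro gen) (auto intro!: mult_right_mono)
  show "norm (\<Sum>\<^sub>\<infinity>\<omega>\<in>W. coeff \<omega> * exp ((\<omega> - 1) * of_real y)) \<le> exp ((\<beta> - 1) * y) * (\<Sum>\<^sub>\<infinity>\<omega>\<in>W. 1 / (norm \<omega>)\<^sup>2)"
    using assms by (intro gen) (auto intro!: mult_right_mono)
qed

lemma inverse_square_infsum_mono:
  assumes "W \<subseteq> near_zeros"
  shows "(\<Sum>\<^sub>\<infinity>\<omega>\<in>W. 1 / (norm \<omega>)\<^sup>2) \<le> (\<Sum>\<^sub>\<infinity>\<omega>\<in>near_zeros. 1 / (norm \<omega>)\<^sup>2)"
  by (intro infsum_mono_neutral summable_on_subset_banach[OF inverse_square_summable] assms) (use assms in auto)

lemma filterlim_low_zeros: "filterlim low_zeros (finite_subsets_at_top near_zeros) at_top"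
  unfolding filterlim_finite_subsets_at_top
proof (intro allI impI)
  fix X assume X: "finite X \<and> X \<subseteq> near_zeros"
  define R where "R = (\<Sum>\<omega>\<in>X. \<bar>Im \<omega>\<bar>)"
  have "\<bar>Im \<omega>\<bar> \<le> R" if "\<omega> \<in> X" for \<omega>
    unfolding R_def using X that by (intro member_le_sum) auto
  then have "X \<subseteq> low_zeros T" if "R \<le> T" for T
    using X that by (fastforce simp: low_zeros_def)
  then show "eventually (\<lambda>T. finite (low_zeros T) \<and> X \<subseteq> low_zeros T \<and> low_zeros T \<subseteq> near_zeros) at_top"
    by (intro eventually_mono[OF eventually_ge_at_top[of R]] conjI low_zeros)
qed

text \<open>The set \<open>W\<close> is arbitrary to the left of \<open>D - 2 * e\<close>: by absolute convergence the zeros there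
  contribute \<open>O(e\<^bsup>(D - 2 e) y\<^esup>)\<close> in total. Therefore one formula serves every screen between
  \<open>D - 6 * e\<close> and \<open>D - 2 * e\<close>.\<close>

lemma explicit_formula:
  "\<exists>C>0. \<forall>W y. W \<subseteq> near_zeros \<longrightarrow> dominant_zeros \<subseteq> W \<longrightarrow> 0 \<le> y \<longrightarrow>
    norm (of_real (smoothed_count N w y) - (\<Sum>\<^sub>\<infinity>\<omega>\<in>W. dim_term y \<omega>))
      \<le> C * exp ((D - 2 * e) * y)"
proof -
  obtain C where C: "C > 0" "\<forall>y\<ge>0. \<exists>E. \<forall>T\<ge>1. norm (vertical_integral (log_integrand y) (D + 1) T
      - complex_of_real (2 * pi) * (\<Sum>\<omega>\<in>low_zeros T. residue_term y \<omega>)) \<le> C * exp ((D - 4 * e) * y) + E / T"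
    using truncated_explicit_formula by (elim exE conjE)
  define K where "K = (\<Sum>\<^sub>\<infinity>\<omega>\<in>near_zeros. 1 / (norm \<omega>)\<^sup>2)"
  have K: "0 \<le> K" unfolding K_def by (intro infsum_nonneg) simp
  have "norm (of_real (smoothed_count N w y) - (\<Sum>\<^sub>\<infinity>\<omega>\<in>W. dim_term y \<omega>))
      \<le> (C / (2 * pi) + 2 * K) * exp ((D - 2 * e) * y)"
    if W: "W \<subseteq> near_zeros" "dominant_zeros \<subseteq> W" and y: "0 \<le> y" for W y
  proof -
    let ?U = "complex_of_real (smoothed_count N w y)"
    let ?f = "\<lambda>\<omega>. dim_term y \<omega>" and ?g = "\<lambda>\<omega>. coeff \<omega> * exp ((\<omega> - 1) * of_real y)"
    obtain E where E: "\<And>T. T \<ge> 1 \<Longrightarrow> norm (vertical_integral (log_integrand y) (D + 1) T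
      - complex_of_real (2 * pi) * (\<Sum>\<omega>\<in>low_zeros T. residue_term y \<omega>)) \<le> C * exp ((D - 4 * e) * y) + E / T"
      using C(2)[rule_format, OF y] by blast
    have f_sum: "?f summable_on V" and g_sum: "?g summable_on V" if "V \<subseteq> near_zeros" for V
      using coeff_exp_summable[OF that y] by (auto intro: abs_summable_summable)
    have "(residue_term y has_sum (infsum ?f near_zeros - infsum ?g near_zeros)) near_zeros"
      using has_sum_add[OF has_sum_infsum[OF f_sum[OF order_refl]]
          has_sum_uminusI[OF has_sum_infsum[OF g_sum[OF order_refl]]]]
      by (simp add: residue_term_def[abs_def] right_diff_distrib)
    then have "((\<lambda>T. \<Sum>\<omega>\<in>low_zeros T. residue_term y \<omega>) \<longlongrightarrow> infsum ?f near_zeros - infsum ?g near_zeros) at_top"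
      unfolding has_sum_def by (rule filterlim_compose[OF _ filterlim_low_zeros])
    then have lim: "((\<lambda>T. norm (vertical_integral (log_integrand y) (D + 1) T
        - complex_of_real (2 * pi) * (\<Sum>\<omega>\<in>low_zeros T. residue_term y \<omega>))) \<longlongrightarrow>
        norm (complex_of_real (2 * pi * smoothed_count N w y)
          - complex_of_real (2 * pi) * (infsum ?f near_zeros - infsum ?g near_zeros))) at_top"
      by (intro tendsto_intros log_integrand_inversion) simp
    have lim2: "((\<lambda>T. C * exp ((D - 4 * e) * y) + E / T) \<longlongrightarrow> C * exp ((D - 4 * e) * y)) at_top"
    proof -
      have "((\<lambda>T. E / T) \<longlongrightarrow> 0) at_top" by real_asymp
      from tendsto_add[OF tendsto_const this] show ?thesis by simp
    qed
    have "norm (complex_of_real (2 * pi * smoothed_count N w y)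
          - complex_of_real (2 * pi) * (infsum ?f near_zeros - infsum ?g near_zeros)) \<le> C * exp ((D - 4 * e) * y)"
      using E by (intro tendsto_le[OF _ lim2 lim] eventually_mono[OF eventually_ge_at_top[of 1]]) simp_all
    also have "complex_of_real (2 * pi * smoothed_count N w y)
          - complex_of_real (2 * pi) * (infsum ?f near_zeros - infsum ?g near_zeros)
        = complex_of_real (2 * pi) * (?U - (infsum ?f near_zeros - infsum ?g near_zeros))"
      by (simp add: algebra_simps)
    finally have "2 * pi * norm (?U - (infsum ?f near_zeros - infsum ?g near_zeros)) \<le> C * exp ((D - 4 * e) * y)"
      by (simp add: norm_mult)
    then have main: "norm (?U - (infsum ?f near_zeros - infsum ?g near_zeros)) \<le> C / (2 * pi) * exp ((D - 4 * e) * y)"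
      by (simp add: field_simps)
    also have "\<dots> \<le> C / (2 * pi) * exp ((D - 2 * e) * y)"
      using C(1) pos y by (intro mult_left_mono) (auto intro: mult_right_mono)
    finally have main: "norm (?U - (infsum ?f near_zeros - infsum ?g near_zeros)) \<le> C / (2 * pi) * exp ((D - 2 * e) * y)" .
    have far: "norm (infsum ?f (near_zeros - W)) \<le> exp ((D - 2 * e) * y) * K"
      unfolding K_def using W y
      by (intro order_trans[OF coeff_exp_abs_bound(1) mult_left_mono[OF inverse_square_infsum_mono]]) auto
    have "norm (infsum ?g near_zeros) \<le> exp ((D - 1) * y) * K"
      unfolding K_def using near_zero_bounds(2) y by (intro coeff_exp_abs_bound(2)) auto
    also have "\<dots> \<le> exp ((D - 2 * e) * y) * K"
      using K y e_small pos by (intro mult_right_mono) (auto intro: mult_right_mono)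
    finally have g_bound: "norm (infsum ?g near_zeros) \<le> exp ((D - 2 * e) * y) * K" .
    have "infsum ?f (W \<union> (near_zeros - W)) = infsum ?f W + infsum ?f (near_zeros - W)"
      using W by (intro infsum_Un_disjoint f_sum) auto
    moreover have "W \<union> (near_zeros - W) = near_zeros" using W by auto
    ultimately have split: "infsum ?f near_zeros = infsum ?f W + infsum ?f (near_zeros - W)" by simp
    have tri: "norm (u - p) \<le> norm (u - (p + q - r)) + norm q + norm r" for u p q r :: complex
      using norm_triangle_ineq4[of "u - (p + q - r) + q" r] norm_triangle_ineq[of "u - (p + q - r)" q]
      by (simp add: algebra_simps)
    have "norm (?U - infsum ?f W) \<le> norm (?U - (infsum ?f near_zeros - infsum ?g near_zeros))
        + norm (infsum ?f (near_zeros - W)) + norm (infsum ?g near_zeros)"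
      unfolding split by (rule tri)
    also have "\<dots> \<le> C / (2 * pi) * exp ((D - 2 * e) * y) + exp ((D - 2 * e) * y) * K + exp ((D - 2 * e) * y) * K"
      by (intro add_mono main far g_bound)
    finally show ?thesis by (simp add: algebra_simps)
  qed
  moreover have "0 < C / (2 * pi) + 2 * K" using C(1) K by (intro add_pos_nonneg) auto
  ultimately show ?thesis by (intro exI[of _ "C / (2 * pi) + 2 * K"]) simp
qed

end

section \<open>Complex dimensions and the screen\<close>

context self_similar
begin

lemma zeta_eq: "zeta N w = (\<lambda>s. inverse (denom s))"
  by (simp add: zeta_def denom_def fun_eq_iff)

lemma neg_logderiv_zeta_eq:
  assumes "denom s \<noteq> 0"
  shows "neg_logderiv_zeta N w s = denom' s / denom s"
proof -
  have "deriv (zeta N w) s = - (inverse (denom s) * denom' s * inverse (denom s))"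
    unfolding zeta_eq using assms
    by (intro DERIV_imp_deriv DERIV_inverse' denom_has_deriv)
  then show ?thesis using assms unfolding neg_logderiv_zeta_def zeta_eq by (simp add: field_simps)
qed

lemma eventually_neg_logderiv_zeta_eq:
  assumes "eventually (\<lambda>s. denom s \<noteq> 0) (at z)"
  shows "eventually (\<lambda>s. neg_logderiv_zeta N w s = denom' s / denom s) (at z)"
  using assms by eventually_elim (rule neg_logderiv_zeta_eq)

lemma denom_isCont: "isCont denom z"
  using denom_has_deriv[of z UNIV] by (rule DERIV_isCont)

lemma denom'_isCont: "isCont denom' z"
  unfolding denom'_def by (intro continuous_intros)

lemma complex_dimension_imp_zero:
  assumes "z \<in> complex_dimensions N w" shows "denom z = 0"
proof (rule ccontr)
  assume nz: "denom z \<noteq> 0"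
  have "((\<lambda>s. denom' s / denom s) \<longlongrightarrow> denom' z / denom z) (at z)"
    using denom_isCont[of z] denom'_isCont[of z] nz unfolding isCont_def by (intro tendsto_divide)
  moreover have "eventually (\<lambda>s. denom s \<noteq> 0) (at z)"
    using denom_isCont[of z] nz unfolding isCont_def by (rule tendsto_imp_eventually_ne)
  then have "eventually (\<lambda>s. denom' s / denom s = neg_logderiv_zeta N w s) (at z)"
    by (rule eventually_mono[OF eventually_neg_logderiv_zeta_eq]) simp
  ultimately have "(neg_logderiv_zeta N w \<longlongrightarrow> denom' z / denom z) (at z)"
    by (rule Lim_transform_eventually)
  moreover have "filterlim (neg_logderiv_zeta N w) at_infinity (at z)"
    using assms by (simp add: complex_dimensions_def is_pole_def)
  ultimately show False by (rule not_tendsto_and_filterlim_at_infinity[OF at_neq_bot])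
qed

end

context zero_control
begin

lemma near_zeros_eventually_nonzero:
  assumes "\<omega> \<in> near_zeros"
  shows "eventually (\<lambda>s. denom s \<noteq> 0) (at \<omega>)"
proof -
  have "denom s \<noteq> 0" if "s \<noteq> \<omega>" "dist s \<omega> < e" for s
  proof -
    have "\<bar>Re (s - \<omega>)\<bar> < e" using abs_Re_le_cmod[of "s - \<omega>"] that(2) by (simp add: dist_norm)
    then have "A * norm (s - \<omega>) \<le> norm (denom s)"
      using assms that e_small by (intro zero_lower) (auto simp: near_zeros_def dist_norm)
    moreover have "0 < A * norm (s - \<omega>)" using that(1) pos by simp
    ultimately show ?thesis by auto
  qed
  then show ?thesis
    unfolding eventually_at using pos by (intro exI[of _ e]) auto
qed

lemma near_zeros_pole_residue:
  assumes w: "\<omega> \<in> near_zeros"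
  shows "\<omega> \<in> complex_dimensions N w" "residue (neg_logderiv_zeta N w) \<omega> = 1"
proof -
  note nz = near_zeros_eventually_nonzero[OF w]
  note ev = eventually_neg_logderiv_zeta_eq[OF nz]
  have z: "denom \<omega> = 0" "denom' \<omega> \<noteq> 0" using w zero_simple by (auto simp: near_zeros_def)
  have "filterlim denom (at 0) (at \<omega>)"
    unfolding filterlim_at using denom_isCont[of \<omega>] z(1) nz by (simp add: isCont_def)
  then have "is_pole (\<lambda>s. denom' s / denom s) \<omega>"
    using denom'_isCont z(2) by (intro is_pole_divide)
  then show "\<omega> \<in> complex_dimensions N w"
    unfolding complex_dimensions_def using is_pole_cong[OF ev refl] by simp
  have "residue (\<lambda>s. denom' s / denom s) \<omega> = denom' \<omega> / denom' \<omega>"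
    by (rule residue_simple_pole_deriv[where s = UNIV])
       (use z denom'_holomorphic denom_holomorphic denom_has_deriv in auto)
  then show "residue (neg_logderiv_zeta N w) \<omega> = 1"
    using residue_cong[OF ev refl] z(2) by simp
qed

text \<open>The screen runs along \<open>Re s = D - 4 * e\<close> and makes a tent-shaped detour to the right around
  each zero close to this line. The imaginary parts of the zeros are so far apart that the tents
  hit no other zero.\<close>

lemma screen_exists:
  "\<exists>S. (\<forall>t. D - 4 * e \<le> S t \<and> S t \<le> D - 2 * e) \<and> 1-lipschitz_on UNIV S \<and>
      (\<forall>t z. norm (Complex (S t) t - z) \<le> e / 4 \<longrightarrow> denom z \<noteq> 0)"
proof -
  define c where "c = D - 4 * e"
  define Z where "Z = {\<omega> \<in> near_zeros. \<bar>Re \<omega> - c\<bar> \<le> e}"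
  \<comment> \<open>By convention the distance to the empty set is \<open>0\<close>, which would raise the tent everywhere.\<close>
  define tent where "tent t = (if Z = {} then 0 else max 0 (2 * e - infdist t (Im ` Z)))" for t
  define S where "S t = c + tent t" for t
  have tent_range: "0 \<le> tent t \<and> tent t \<le> 2 * e" for t
    using pos infdist_nonneg[of t "Im ` Z"] by (simp add: tent_def)
  have "1-lipschitz_on UNIV S"
  proof (rule lipschitz_onI)
    fix x y :: real
    show "dist (S x) (S y) \<le> 1 * dist x y"
      using infdist_triangle_abs[of x "Im ` Z" y]
      by (cases "Z = {}") (auto simp: S_def tent_def dist_real_def)
  qed simp
  moreover have False if close: "norm (Complex (S t) t - z) \<le> e / 4" and z: "denom z = 0" for t z
  proof -
    have Re: "\<bar>S t - Re z\<bar> \<le> e / 4" and Im: "\<bar>t - Im z\<bar> \<le> e / 4"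
      using abs_Re_le_cmod[of "Complex (S t) t - z"] abs_Im_le_cmod[of "Complex (S t) t - z"] close by auto
    have "D - 6 * e \<le> Re z"
      using Re pos(1) tent_range[of t] unfolding S_def c_def by linarith
    then have near: "z \<in> near_zeros" using z by (simp add: near_zeros_def)
    show False
    proof (cases "z \<in> Z")
      case True
      have "infdist t (Im ` Z) \<le> dist t (Im z)" using True by (intro infdist_le) auto
      moreover have "2 * e - infdist t (Im ` Z) \<le> tent t" using True by (auto simp: tent_def)
      ultimately have "2 * e - e / 4 \<le> tent t" using Im unfolding dist_real_def by linarith
      moreover have "\<bar>Re z - c\<bar> \<le> e" using True by (simp add: Z_def)
      ultimately show False using Re pos(1) unfolding S_def by linarith
    next
      case False
      then have far: "e < \<bar>Re z - c\<bar>" using near by (simp add: Z_def)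
      have "tent t \<noteq> 0"
      proof
        assume "tent t = 0"
        then show False using far Re pos(1) unfolding S_def by linarith
      qed
      then have ne: "Z \<noteq> {}" and "infdist t (Im ` Z) < 2 * e" by (auto simp: tent_def split: if_splits)
      then obtain \<omega> where w: "\<omega> \<in> Z" "dist t (Im \<omega>) < 2 * e"
        using cInf_lessD[of "(\<lambda>a. dist t a) ` Im ` Z" "2 * e"] by (auto simp: infdist_notempty)
      have "18 * e \<le> \<bar>Im z - Im \<omega>\<bar>"
        using near_zeros_separated[OF near, of \<omega>] w(1) False by (auto simp: Z_def)
      then show False using w(2) Im pos(1) unfolding dist_real_def by linarith
    qed
  qed
  ultimately show ?thesis
    using tent_range by (intro exI[of _ S]) (auto simp: S_def c_def algebra_simps)
qed

lemma neg_logderiv_zeta_bounded_on_screen: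
  assumes "D - 4 * e \<le> S t" and "\<And>z. norm (Complex (S t) t - z) \<le> e / 4 \<Longrightarrow> denom z \<noteq> 0"
  shows "norm (neg_logderiv_zeta N w (Complex (S t) t)) \<le> B / (A * (e / 4))"
proof -
  let ?s = "Complex (S t) t"
  have s: "D - 5 * e \<le> Re ?s" using assms(1) pos by simp
  have "A * (e / 4) \<le> norm (denom ?s)"
    using assms(2) pos by (intro zero_free_lower[OF s]) auto
  moreover have nz: "denom ?s \<noteq> 0" using assms(2)[of ?s] pos by simp
  ultimately show ?thesis
    unfolding neg_logderiv_zeta_eq[OF nz] norm_divide
    using denom'_le[OF strip_bounds(1)[OF s]] pos by (intro frac_le) auto
qed

end

section \<open>Pointwise asymptotics\<close>

lemma powr_difference_quotient:
  fixes r :: real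
  shows "((\<lambda>\<mu>. (\<mu> powr r - 1) / (\<mu> - 1)) \<longlongrightarrow> r) (at 1)"
proof -
  have "((\<lambda>\<mu>. \<mu> powr r) has_real_derivative r * 1 powr (r - 1)) (at 1)"
    by (rule has_real_derivative_powr) simp
  then show ?thesis by (simp add: has_field_derivative_iff)
qed

text \<open>The asymptotics of a primitive may be differentiated if the derivative is monotone: the mean
  of the derivative over \<open>[x, \<mu> x]\<close> with \<open>\<mu> > 1\<close> bounds \<open>f x\<close> from above, the mean over \<open>[\<mu> x, x]\<close> with
  \<open>\<mu> < 1\<close> bounds it from below, and both tend to the expected limit as \<open>\<mu>\<close> tends to \<open>1\<close>.\<close>

lemma monotone_density:
  fixes F f :: "real \<Rightarrow> real"
  assumes upper: "\<And>x x'. 0 < x \<Longrightarrow> x \<le> x' \<Longrightarrow> f x * (x' - x) \<le> F x' - F x"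
    and lower: "\<And>x x'. 0 < x \<Longrightarrow> x \<le> x' \<Longrightarrow> F x' - F x \<le> f x' * (x' - x)"
    and lim: "((\<lambda>x. F x / x powr r) \<longlongrightarrow> c) at_top"
  shows "((\<lambda>x. f x / x powr (r - 1)) \<longlongrightarrow> c * r) at_top"
proof -
  have scaled: "((\<lambda>x. (F (\<mu> * x) - F x) / ((\<mu> - 1) * x powr r)) \<longlongrightarrow> c * ((\<mu> powr r - 1) / (\<mu> - 1))) at_top"
    if mu: "0 < \<mu>" "\<mu> \<noteq> 1" for \<mu>
  proof -
    have "filterlim (\<lambda>x. \<mu> * x) at_top at_top"
      using mu by (intro filterlim_tendsto_pos_mult_at_top[OF tendsto_const _ filterlim_ident]) auto
    from filterlim_compose[OF lim this]
    have "((\<lambda>x. (\<mu> powr r * (F (\<mu> * x) / (\<mu> * x) powr r) - F x / x powr r) / (\<mu> - 1))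
        \<longlongrightarrow> (\<mu> powr r * c - c) / (\<mu> - 1)) at_top"
      using mu by (intro tendsto_intros lim) auto
    moreover have "eventually (\<lambda>x. (\<mu> powr r * (F (\<mu> * x) / (\<mu> * x) powr r) - F x / x powr r) / (\<mu> - 1)
        = (F (\<mu> * x) - F x) / ((\<mu> - 1) * x powr r)) at_top"
      using eventually_gt_at_top[of 0]
    proof eventually_elim
      case (elim x)
      then have "\<mu> powr r * (F (\<mu> * x) / (\<mu> * x) powr r) = F (\<mu> * x) / x powr r"
        using mu by (simp add: powr_mult)
      then show ?case by (simp add: diff_divide_distrib mult.commute)
    qed
    ultimately have "((\<lambda>x. (F (\<mu> * x) - F x) / ((\<mu> - 1) * x powr r)) \<longlongrightarrow> (\<mu> powr r * c - c) / (\<mu> - 1)) at_top"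
      by (rule Lim_transform_eventually)
    then show ?thesis by (simp add: algebra_simps)
  qed
  have q: "((\<lambda>\<mu>. c * ((\<mu> powr r - 1) / (\<mu> - 1))) \<longlongrightarrow> c * r) (at 1)"
    by (intro tendsto_mult tendsto_const powr_difference_quotient)
  have x_powr: "x powr r = x * x powr (r - 1)" if "0 < x" for x :: real
    using that by (simp add: powr_diff)
  show ?thesis
  proof (rule order_tendstoI)
    fix a assume "c * r < a"
    then have "eventually (\<lambda>\<mu>. c * ((\<mu> powr r - 1) / (\<mu> - 1)) < a) (at_right 1)"
      using order_tendstoD(2)[OF q] by (simp add: eventually_at_split)
    then have "eventually (\<lambda>\<mu>. c * ((\<mu> powr r - 1) / (\<mu> - 1)) < a \<and> 1 < \<mu>) (at_right 1)"
      using eventually_at_right_less by (rule eventually_conj)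
    then have "\<exists>\<mu>. c * ((\<mu> powr r - 1) / (\<mu> - 1)) < a \<and> 1 < \<mu>"
      by (rule eventually_happens'[OF trivial_limit_at_right_real])
    then obtain \<mu> where mu: "c * ((\<mu> powr r - 1) / (\<mu> - 1)) < a" "1 < \<mu>" by (elim exE conjE)
    have "eventually (\<lambda>x. (F (\<mu> * x) - F x) / ((\<mu> - 1) * x powr r) < a) at_top"
      using order_tendstoD(2)[OF scaled mu(1)] mu(2) by simp
    then show "eventually (\<lambda>x. f x / x powr (r - 1) < a) at_top"
      using eventually_gt_at_top[of 0]
    proof eventually_elim
      case (elim x)
      have "f x * (\<mu> * x - x) \<le> F (\<mu> * x) - F x" using elim mu by (intro upper) auto
      then have "f x * (\<mu> * x - x) / ((\<mu> - 1) * x powr r) \<le> (F (\<mu> * x) - F x) / ((\<mu> - 1) * x powr r)"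
        using mu by (intro divide_right_mono) auto
      also have "f x * (\<mu> * x - x) / ((\<mu> - 1) * x powr r) = f x / x powr (r - 1)"
      proof -
        have "f x * (\<mu> * x - x) / ((\<mu> - 1) * x powr r) = (f x * ((\<mu> - 1) * x)) / (x powr (r - 1) * ((\<mu> - 1) * x))"
          using elim(2) by (simp add: x_powr algebra_simps)
        then show ?thesis using mu elim(2) by simp
      qed
      finally show ?case using elim by simp
    qed
  next
    fix a assume "a < c * r"
    then have "eventually (\<lambda>\<mu>. a < c * ((\<mu> powr r - 1) / (\<mu> - 1))) (at_left 1)"
      using order_tendstoD(1)[OF q] by (simp add: eventually_at_split)
    moreover have "eventually (\<lambda>\<mu>::real. \<mu> \<in> {0<..<1}) (at_left 1)"
      by (rule eventually_at_left_real) simp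
    ultimately have "eventually (\<lambda>\<mu>. a < c * ((\<mu> powr r - 1) / (\<mu> - 1)) \<and> \<mu> \<in> {0<..<1}) (at_left 1)"
      by (rule eventually_conj)
    then have "\<exists>\<mu>. a < c * ((\<mu> powr r - 1) / (\<mu> - 1)) \<and> \<mu> \<in> {0<..<1}"
      by (rule eventually_happens'[OF trivial_limit_at_left_real])
    then obtain \<mu> where mu: "a < c * ((\<mu> powr r - 1) / (\<mu> - 1))" "0 < \<mu>" "\<mu> < 1"
      unfolding greaterThanLessThan_iff by (elim exE conjE)
    have "eventually (\<lambda>x. a < (F (\<mu> * x) - F x) / ((\<mu> - 1) * x powr r)) at_top"
      using order_tendstoD(1)[OF scaled mu(1)] mu by simp
    then show "eventually (\<lambda>x. a < f x / x powr (r - 1)) at_top"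
      using eventually_gt_at_top[of 0]
    proof eventually_elim
      case (elim x)
      have "F x - F (\<mu> * x) \<le> f x * (x - \<mu> * x)" using elim mu by (intro lower) auto
      then have "(F x - F (\<mu> * x)) / ((1 - \<mu>) * x powr r) \<le> f x * (x - \<mu> * x) / ((1 - \<mu>) * x powr r)"
        using mu by (intro divide_right_mono) auto
      also have "f x * (x - \<mu> * x) / ((1 - \<mu>) * x powr r) = f x / x powr (r - 1)"
      proof -
        have "f x * (x - \<mu> * x) / ((1 - \<mu>) * x powr r) = (f x * ((1 - \<mu>) * x)) / (x powr (r - 1) * ((1 - \<mu>) * x))"
          using elim(2) by (simp add: x_powr algebra_simps)
        then show ?thesis using mu elim(2) by simp
      qed
      also have "(F x - F (\<mu> * x)) / ((1 - \<mu>) * x powr r) = (F (\<mu> * x) - F x) / ((\<mu> - 1) * x powr r)"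
        using minus_divide_divide[of "F (\<mu> * x) - F x" "(\<mu> - 1) * x powr r"]
        by (simp only: minus_diff_eq mult_minus_left[symmetric])
      finally show ?case using elim by simp
    qed
  qed
qed

definition psi_primitive :: "nat \<Rightarrow> (nat \<Rightarrow> real) \<Rightarrow> real \<Rightarrow> real" where
  "psi_primitive N w x = (\<Sum>u\<in>words N w (ln x). w (hd u) * (x - exp (sum_list (map w u))))"

context self_similar
begin

lemma psi_primitive_eq:
  assumes "0 < x" shows "psi_primitive N w x = x * smoothed_count N w (ln x)"
proof -
  have "w (hd u) * (x - exp (sum_list (map w u))) = x * (w (hd u) * (1 - exp (- (ln x - sum_list (map w u)))))" for u
    using assms by (simp add: exp_diff algebra_simps)
  then show ?thesis unfolding psi_primitive_def smoothed_count_def sum_distrib_left by (intro sum.cong refl)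
qed

lemma words_mono: "y \<le> y' \<Longrightarrow> words N w y \<subseteq> words N w y'"
  by (auto simp: words_def)

lemma hd_weight_nonneg: "u \<in> words N w y \<Longrightarrow> 0 \<le> w (hd u)"
  using w_pos[of "hd u"] hd_in_set[of u] by (force simp: words_def)

lemma psi_primitive_diff:
  assumes "0 < x" "x \<le> x'"
  shows "psi N w x * (x' - x) \<le> psi_primitive N w x' - psi_primitive N w x"
    and "psi_primitive N w x' - psi_primitive N w x \<le> psi N w x' * (x' - x)"
proof -
  let ?A = "words N w (ln x)" and ?B = "words N w (ln x') - words N w (ln x)"
  let ?b = "\<lambda>u. exp (sum_list (map w u))"
  have sub: "?A \<subseteq> words N w (ln x')" using assms by (intro words_mono) simp
  have split: "sum f (words N w (ln x')) = sum f ?A + sum f ?B" for f :: "nat list \<Rightarrow> real"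
    using sum.subset_diff[OF sub finite_words[OF flow]] by (simp add: add.commute)
  have diff: "psi_primitive N w x' - psi_primitive N w x = psi N w x * (x' - x) + (\<Sum>u\<in>?B. w (hd u) * (x' - ?b u))"
  proof -
    have "psi_primitive N w x' - psi_primitive N w x =
        (\<Sum>u\<in>?A. w (hd u) * (x' - ?b u) - w (hd u) * (x - ?b u)) + (\<Sum>u\<in>?B. w (hd u) * (x' - ?b u))"
      unfolding psi_primitive_def split sum_subtractf by simp
    also have "(\<Sum>u\<in>?A. w (hd u) * (x' - ?b u) - w (hd u) * (x - ?b u)) = psi N w x * (x' - x)"
      unfolding psi_eq_sum_words[OF flow] sum_distrib_right by (intro sum.cong) (auto simp: algebra_simps)
    finally show ?thesis .
  qed
  have B: "0 \<le> w (hd u)" "x \<le> ?b u" "?b u \<le> x'" if "u \<in> ?B" for u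
  proof -
    show "0 \<le> w (hd u)" using that hd_weight_nonneg by blast
    have "ln x \<le> sum_list (map w u)" "sum_list (map w u) \<le> ln x'" using that by (auto simp: words_def)
    then show "x \<le> ?b u" "?b u \<le> x'"
      using assms exp_le_cancel_iff[of "ln x" "sum_list (map w u)"]
        exp_le_cancel_iff[of "sum_list (map w u)" "ln x'"] by auto
  qed
  have "0 \<le> (\<Sum>u\<in>?B. w (hd u) * (x' - ?b u))" using B by (intro sum_nonneg mult_nonneg_nonneg) auto
  then show "psi N w x * (x' - x) \<le> psi_primitive N w x' - psi_primitive N w x" unfolding diff by simp
  have "(\<Sum>u\<in>?B. w (hd u) * (x' - ?b u)) \<le> (\<Sum>u\<in>?B. w (hd u) * (x' - x))"
    using B by (intro sum_mono mult_left_mono) auto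
  then show "psi_primitive N w x' - psi_primitive N w x \<le> psi N w x' * (x' - x)"
    unfolding diff psi_eq_sum_words[OF flow] split by (simp add: sum_distrib_right distrib_right)
qed

text \<open>A zero \<open>D + \<i>t\<close> forces all phases \<open>w\<^sub>j t\<close> to be multiples of \<open>2\<pi>\<close>. If \<open>t\<close> were not zero, the group
  generated by the weights would lie in \<open>(2\<pi>/t)\<int>\<close> and would not be dense.\<close>

lemma nonlattice_zero:
  assumes nl: "nonlattice N w" and z: "denom s = 0" and Re: "Re s = D"
  shows "s = of_real D"
proof (rule ccontr)
  assume "s \<noteq> of_real D"
  then have t: "Im s \<noteq> 0" using Re by (auto simp: complex_eq_iff)
  define p where "p j = exp (- (w j * D))" for j
  have "(\<Sum>j=1..N. p j * cos (w j * Im s)) = 1"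
  proof -
    have "Re (denom s) = 1 - (\<Sum>j=1..N. p j * cos (w j * Im s))"
      by (simp add: denom_def Re_exp Re p_def)
    then show ?thesis using z by simp
  qed
  then have "(\<Sum>j=1..N. p j * (1 - cos (w j * Im s))) = 0"
    using D_eq by (simp add: right_diff_distrib sum_subtractf p_def)
  then have "\<forall>j\<in>{1..N}. p j * (1 - cos (w j * Im s)) = 0"
    by (subst (asm) sum_nonneg_eq_0_iff) (auto simp: p_def)
  then have "cos (w j * Im s) = 1" if "j \<in> {1..N}" for j
    using that by (auto simp: p_def)
  then have "\<exists>n::int. w j * Im s = of_int n * 2 * pi" if "j \<in> {1..N}" for j
    using that by (simp add: cos_one_2pi_int)
  then obtain n :: "nat \<Rightarrow> int" where n: "\<And>j. j \<in> {1..N} \<Longrightarrow> w j * Im s = of_int (n j) * 2 * pi"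
    by metis
  define h where "h = 2 * pi / \<bar>Im s\<bar>"
  have h: "0 < h" using t by (simp add: h_def)
  have mult: "\<exists>m::int. (\<Sum>j=1..N. of_int (c j) * w j) = of_int m * h" for c :: "nat \<Rightarrow> int"
  proof -
    have "(\<Sum>j=1..N. of_int (c j) * w j) = (\<Sum>j=1..N. of_int (c j) * (of_int (n j) * (2 * pi) / Im s))"
      using n t by (intro sum.cong refl) (simp add: field_simps)
    also have "\<dots> = of_int (\<Sum>j=1..N. c j * n j) * (2 * pi / Im s)"
      by (simp add: sum_distrib_right sum_distrib_left mult_ac sum_divide_distrib)
    also have "\<dots> = of_int (sgn_int * (\<Sum>j=1..N. c j * n j)) * h" if "sgn_int = (if 0 < Im s then 1 else -1)" for sgn_int :: int
      using that t by (auto simp: h_def)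
    finally show ?thesis by blast
  qed
  \<comment> \<open>The point \<open>h / 2\<close> is at distance at least \<open>h / 2\<close> from all multiples of \<open>h\<close>.\<close>
  have "h / 2 \<in> closure (range (\<lambda>c :: nat \<Rightarrow> int. \<Sum>j=1..N. of_int (c j) * w j))"
    using nl by (simp add: nonlattice_def)
  then obtain c :: "nat \<Rightarrow> int" where c: "dist (\<Sum>j=1..N. of_int (c j) * w j) (h / 2) < h / 4"
    using h unfolding closure_approachable by (force dest!: spec[of _ "h / 4"])
  obtain m :: int where "(\<Sum>j=1..N. of_int (c j) * w j) = of_int m * h" using mult by blast
  then have "\<bar>of_int m * h - h / 2\<bar> < h / 4" using c by (simp add: dist_real_def)
  then have "\<bar>of_int m - 1 / 2\<bar> * h < 1 / 4 * h"
  proof -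
    have "of_int m * h - h / 2 = (of_int m - 1 / 2) * h" by (simp add: algebra_simps)
    then show ?thesis using \<open>\<bar>of_int m * h - h / 2\<bar> < h / 4\<close> h by (simp add: abs_mult)
  qed
  then have "\<bar>real_of_int m - 1 / 2\<bar> < 1 / 4" using h by (simp only: mult_less_cancel_right_pos)
  moreover have "real_of_int m \<le> 0 \<or> 1 \<le> real_of_int m" by (cases "m \<le> 0") auto
  ultimately show False by linarith
qed

end

context zero_control
begin

lemma D_near_zero: "of_real D \<in> near_zeros"
proof -
  have "exp (- (complex_of_real (w j) * of_real D)) = of_real (exp (- (w j * D)))" for j
    by (simp add: exp_of_real[symmetric])
  then have "denom (of_real D) = of_real (1 - (\<Sum>j=1..N. exp (- (w j * D))))"
    unfolding denom_def by simp
  then have "denom (of_real D) = 0" unfolding D_eq by simp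
  then show ?thesis using pos by (simp add: near_zeros_def)
qed

text \<open>Each omitted zero contributes at most a multiple of \<open>e\<^sup>D\<^sup>y/|\<omega>|\<^sup>2\<close>, so a truncation
  costs the tail of a convergent series, uniformly in \<open>y\<close> after division by \<open>e\<^sup>D\<^sup>y\<close>.\<close>

lemma explicit_formula_partial:
  "\<exists>C>0. \<forall>W F y. W \<subseteq> near_zeros \<longrightarrow> dominant_zeros \<subseteq> W \<longrightarrow> finite F \<longrightarrow> F \<subseteq> W \<longrightarrow> 0 \<le> y \<longrightarrow>
    norm (of_real (smoothed_count N w y) - (sum (dim_term y) F))
      \<le> C * exp ((D - 2 * e) * y) + ((\<Sum>\<^sub>\<infinity>\<omega>\<in>W. 1 / (norm \<omega>)\<^sup>2) - (\<Sum>\<omega>\<in>F. 1 / (norm \<omega>)\<^sup>2)) * exp (D * y)"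
proof -
  obtain C where C: "C > 0" "\<forall>W y. W \<subseteq> near_zeros \<longrightarrow> dominant_zeros \<subseteq> W \<longrightarrow> 0 \<le> y \<longrightarrow>
    norm (of_real (smoothed_count N w y) - (\<Sum>\<^sub>\<infinity>\<omega>\<in>W. dim_term y \<omega>))
      \<le> C * exp ((D - 2 * e) * y)"
    using explicit_formula by (elim exE conjE)
  have "norm (of_real (smoothed_count N w y) - (sum (dim_term y) F))
      \<le> C * exp ((D - 2 * e) * y) + ((\<Sum>\<^sub>\<infinity>\<omega>\<in>W. 1 / (norm \<omega>)\<^sup>2) - (\<Sum>\<omega>\<in>F. 1 / (norm \<omega>)\<^sup>2)) * exp (D * y)"
    if W: "W \<subseteq> near_zeros" "dominant_zeros \<subseteq> W" and F: "finite F" "F \<subseteq> W" and y: "0 \<le> y" for W F y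
  proof -
    let ?f = "\<lambda>\<omega>. dim_term y \<omega>" and ?h = "\<lambda>\<omega>::complex. 1 / (norm \<omega>)\<^sup>2"
    have f: "?f summable_on V" and h: "?h summable_on V" if "V \<subseteq> near_zeros" for V
      using coeff_exp_summable(1)[OF that y] summable_on_subset_banach[OF inverse_square_summable that]
      by (auto intro: abs_summable_summable)
    have un: "F \<union> (W - F) = W" using F by auto
    have "infsum ?f W = sum ?f F + infsum ?f (W - F)"
      using infsum_Un_disjoint[of ?f F "W - F"] f[of F] f[of "W - F"] F W unfolding un by auto
    moreover have "infsum ?h W = sum ?h F + infsum ?h (W - F)"
      using infsum_Un_disjoint[of ?h F "W - F"] h[of F] h[of "W - F"] F W unfolding un by auto
    moreover have "norm (infsum ?f (W - F)) \<le> exp (D * y) * infsum ?h (W - F)"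
      using W y near_zero_bounds(2) by (intro coeff_exp_abs_bound(1)) auto
    moreover have "norm (of_real (smoothed_count N w y) - infsum ?f W) \<le> C * exp ((D - 2 * e) * y)"
      using C(2) W y by blast
    moreover have "norm (u - p) \<le> norm (u - (p + q)) + norm q" for u p q :: complex
      using norm_triangle_ineq[of "u - (p + q)" q] by simp
    ultimately show ?thesis by (smt (verit, ccfv_threshold) mult.commute add_diff_cancel_left')
  qed
  then show ?thesis using C(1) by (intro exI[of _ C]) simp
qed

text \<open>All but finitely many terms of the explicit formula contribute at most \<open>\<epsilon>/2\<close>, uniformly in \<open>y\<close>,
  after division by \<open>e\<^bsup>D y\<^esup>\<close>; each of the remaining ones tends to zero except for the one at \<open>D\<close>, because
  in the nonlattice case the other zeros have real part less than \<open>D\<close>.\<close>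

lemma smoothed_count_asymptotics:
  assumes nl: "nonlattice N w"
  shows "((\<lambda>y. smoothed_count N w y * exp (- (D * y))) \<longlongrightarrow> 1 / (D * (D + 1))) at_top"
proof (rule tendstoI)
  fix \<epsilon> :: real assume eps: "0 < \<epsilon>"
  let ?h = "\<lambda>\<omega>::complex. 1 / (norm \<omega>)\<^sup>2"
  obtain C where C: "\<forall>W F y. W \<subseteq> near_zeros \<longrightarrow> dominant_zeros \<subseteq> W \<longrightarrow> finite F \<longrightarrow> F \<subseteq> W \<longrightarrow> 0 \<le> y \<longrightarrow>
    norm (of_real (smoothed_count N w y) - (sum (dim_term y) F))
      \<le> C * exp ((D - 2 * e) * y) + (infsum ?h W - sum ?h F) * exp (D * y)"
    using explicit_formula_partial by (elim exE conjE)
  have "(sum ?h \<longlongrightarrow> infsum ?h near_zeros) (finite_subsets_at_top near_zeros)"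
    using has_sum_infsum[OF inverse_square_summable] unfolding has_sum_def .
  then have "eventually (\<lambda>F. infsum ?h near_zeros - \<epsilon> / 2 < sum ?h F) (finite_subsets_at_top near_zeros)"
    using eps by (intro order_tendstoD(1)) auto
  then obtain F0 where F0: "finite F0" "F0 \<subseteq> near_zeros"
    "\<And>F. finite F \<Longrightarrow> F0 \<subseteq> F \<Longrightarrow> F \<subseteq> near_zeros \<Longrightarrow> infsum ?h near_zeros - \<epsilon> / 2 < sum ?h F"
    unfolding eventually_finite_subsets_at_top by auto
  define F where "F = F0 - {of_real D}"
  define F1 where "F1 = insert (complex_of_real D) F"
  have F: "finite F" "F \<subseteq> near_zeros" "of_real D \<notin> F" using F0 by (auto simp: F_def)
  have F1: "finite F1" "F1 \<subseteq> near_zeros" "F0 \<subseteq> F1" using F D_near_zero by (auto simp: F1_def F_def)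
  have tail: "infsum ?h near_zeros - sum ?h F1 < \<epsilon> / 2" using F0(3)[OF F1(1,3,2)] by simp
  have coeff_D: "coeff (of_real D) = of_real (1 / (D * (D + 1)))" by (simp add: coeff_def)
  have Re_lt: "Re \<omega> < D" if "\<omega> \<in> F" for \<omega>
    using that F near_zero_bounds(2)[of \<omega>] nonlattice_zero[OF nl, of \<omega>]
    by (fastforce simp: near_zeros_def less_le)
  let ?R = "\<lambda>y. C * exp (- 2 * e * y) + (\<Sum>\<omega>\<in>F. norm (coeff \<omega>) * exp ((Re \<omega> - D) * y))"
  have est: "dist (smoothed_count N w y * exp (- (D * y))) (1 / (D * (D + 1))) \<le> ?R y + \<epsilon> / 2" if y: "0 \<le> y" for y
  proof -
    let ?U = "smoothed_count N w y" and ?S = "\<Sum>\<omega>\<in>F. dim_term y \<omega>"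
    have sumF1: "(sum (dim_term y) F1) = of_real (1 / (D * (D + 1)) * exp (D * y)) + ?S"
      unfolding F1_def using F by (simp add: coeff_D exp_of_real[symmetric])
    have "norm (of_real ?U - (sum (dim_term y) F1))
        \<le> C * exp ((D - 2 * e) * y) + (infsum ?h near_zeros - sum ?h F1) * exp (D * y)"
      using C[rule_format, OF order_refl _ F1(1,2) y] by simp
    also have "\<dots> \<le> C * exp ((D - 2 * e) * y) + \<epsilon> / 2 * exp (D * y)"
      using tail by (intro add_left_mono mult_right_mono) auto
    finally have 1: "norm (of_real ?U - (of_real (1 / (D * (D + 1)) * exp (D * y)) + ?S))
        \<le> C * exp ((D - 2 * e) * y) + \<epsilon> / 2 * exp (D * y)" unfolding sumF1 .
    have 2: "norm ?S \<le> (\<Sum>\<omega>\<in>F. norm (coeff \<omega>) * exp (Re \<omega> * y))"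
      by (rule sum_norm_le) (simp add: norm_mult)
    have tri: "norm (u - p) \<le> norm (u - (p + q)) + norm q" for u p q :: complex
      using norm_triangle_ineq[of "u - (p + q)" q] by simp
    have "\<bar>?U - 1 / (D * (D + 1)) * exp (D * y)\<bar> = norm (complex_of_real ?U - of_real (1 / (D * (D + 1)) * exp (D * y)))"
      by (simp only: of_real_diff[symmetric] norm_of_real)
    also have "\<dots> \<le> C * exp ((D - 2 * e) * y) + \<epsilon> / 2 * exp (D * y) + (\<Sum>\<omega>\<in>F. norm (coeff \<omega>) * exp (Re \<omega> * y))"
      by (rule order_trans[OF tri add_mono[OF 1 2]])
    finally have "\<bar>?U - 1 / (D * (D + 1)) * exp (D * y)\<bar> * exp (- (D * y)) \<le>
        (C * exp ((D - 2 * e) * y) + \<epsilon> / 2 * exp (D * y) + (\<Sum>\<omega>\<in>F. norm (coeff \<omega>) * exp (Re \<omega> * y))) * exp (- (D * y))"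
      by (rule mult_right_mono) simp
    also have "\<dots> = ?R y + \<epsilon> / 2"
    proof -
      have E1: "exp ((D - 2 * e) * y) * exp (- (D * y)) = exp (- 2 * e * y)"
        and E2: "exp (D * y) * exp (- (D * y)) = 1"
        and E3: "exp (b * y) * exp (- (D * y)) = exp ((b - D) * y)" for b
        by (simp_all add: exp_add[symmetric] algebra_simps)
      show ?thesis
        by (simp only: distrib_right sum_distrib_right mult.assoc E1[simplified mult.assoc] E2 E3 mult_1_right) simp
    qed
    also have "\<bar>?U - 1 / (D * (D + 1)) * exp (D * y)\<bar> * exp (- (D * y))
        = \<bar>(?U - 1 / (D * (D + 1)) * exp (D * y)) * exp (- (D * y))\<bar>" by (simp only: abs_mult abs_exp_cancel)
    also have "(?U - 1 / (D * (D + 1)) * exp (D * y)) * exp (- (D * y)) = ?U * exp (- (D * y)) - 1 / (D * (D + 1))"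
      by (simp add: left_diff_distrib mult.assoc exp_add[symmetric])
    finally show ?thesis by (simp add: dist_real_def)
  qed
  have exp0: "((\<lambda>y. exp (b * y)) \<longlongrightarrow> 0) at_top" if "b < 0" for b :: real
    using that by real_asymp
  have "(?R \<longlongrightarrow> C * 0 + (\<Sum>\<omega>\<in>F. norm (coeff \<omega>) * 0)) at_top"
    using Re_lt pos by (intro tendsto_add tendsto_mult tendsto_const tendsto_sum exp0) auto
  then have "eventually (\<lambda>y. ?R y < \<epsilon> / 2) at_top"
    using eps by (intro order_tendstoD(2)[where a = "\<epsilon> / 2"]) auto
  then show "eventually (\<lambda>y. dist (smoothed_count N w y * exp (- (D * y))) (1 / (D * (D + 1))) < \<epsilon>) at_top"
    using eventually_ge_at_top[of 0]
  proof eventually_elim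
    case (elim y)
    then show ?case using est[of y] by linarith
  qed
qed

end

lemma (in self_similar) psi_asymptotics:
  assumes nl: "nonlattice N w"
  shows "(\<lambda>x. psi N w x - x powr D / D) \<in> o[at_top](\<lambda>x. x powr D)"
proof -
  obtain e A B where "zero_control N w e A B" using ex_zero_control by blast
  then have "((\<lambda>y. smoothed_count N w y * exp (- (D * y))) \<longlongrightarrow> 1 / (D * (D + 1))) at_top"
    by (rule zero_control.smoothed_count_asymptotics) (rule nl)
  then have "((\<lambda>x. smoothed_count N w (ln x) * exp (- (D * ln x))) \<longlongrightarrow> 1 / (D * (D + 1))) at_top"
    by (rule filterlim_compose[OF _ ln_at_top])
  moreover have "eventually (\<lambda>x. smoothed_count N w (ln x) * exp (- (D * ln x))
      = psi_primitive N w x / x powr (D + 1)) at_top"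
    using eventually_gt_at_top[of 0]
  proof eventually_elim
    case (elim x)
    then have "x powr (D + 1) = x * exp (D * ln x)" by (simp add: powr_def distrib_right exp_add)
    then show ?case using elim by (simp add: psi_primitive_eq exp_minus field_simps)
  qed
  ultimately have "((\<lambda>x. psi_primitive N w x / x powr (D + 1)) \<longlongrightarrow> 1 / (D * (D + 1))) at_top"
    by (rule Lim_transform_eventually)
  then have "((\<lambda>x. psi N w x / x powr (D + 1 - 1)) \<longlongrightarrow> 1 / (D * (D + 1)) * (D + 1)) at_top"
    by (intro monotone_density[of "psi N w" "psi_primitive N w"] psi_primitive_diff)
  moreover have "1 / (D * (D + 1)) * (D + 1) = 1 / D"
  proof -
    have "D + 1 \<noteq> 0" using D_pos by simp
    then show ?thesis by simp
  qed
  ultimately have "((\<lambda>x. psi N w x / x powr D) \<longlongrightarrow> 1 / D) at_top" by simp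
  from tendsto_diff[OF this tendsto_const[of "1 / D"]]
  have lim: "((\<lambda>x. psi N w x / x powr D - 1 / D) \<longlongrightarrow> 0) at_top" by simp
  have "eventually (\<lambda>x. psi N w x / x powr D - 1 / D = (psi N w x - x powr D / D) / x powr D) at_top"
    using eventually_gt_at_top[of 0] by eventually_elim (simp add: diff_divide_distrib)
  from Lim_transform_eventually[OF lim this] show ?thesis
    by (rule smalloI_tendsto) (rule eventually_mono[OF eventually_gt_at_top[of 0]], simp)
qed

section \<open>Pairing with dilated test functions\<close>

locale test_data =
  fixes \<phi> d :: "real \<Rightarrow> complex" and \<alpha> \<beta> M :: real
  assumes alpha: "0 < \<alpha>" "\<alpha> < \<beta>"
    and deriv: "\<And>x. (\<phi> has_vector_derivative d x) (at x)"
    and d_cont: "continuous_on UNIV d"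
    and outside: "\<And>x. x \<notin> {\<alpha><..<\<beta>} \<Longrightarrow> \<phi> x = 0"
    and M: "\<And>x. x \<in> {\<alpha>..\<beta>} \<Longrightarrow> norm (d x) \<le> M"

lemma test_function_data:
  assumes "test_function \<phi>"
  shows "\<exists>d \<alpha> \<beta> M. test_data \<phi> d \<alpha> \<beta> M"
proof -
  obtain dd :: "nat \<Rightarrow> real \<Rightarrow> complex" where dd: "dd 0 = \<phi>" "\<And>n x. (dd n has_vector_derivative dd (Suc n) x) (at x)"
    and comp: "compact (closure {x. \<phi> x \<noteq> 0})" and sub: "closure {x. \<phi> x \<noteq> 0} \<subseteq> {0<..}"
    using assms unfolding test_function_def by blast
  \<comment> \<open>The point \<open>1\<close> makes the set nonempty also for the zero function.\<close>
  define K where "K = insert 1 (closure {x. \<phi> x \<noteq> 0})"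
  have K: "compact K" "K \<noteq> {}" "K \<subseteq> {0<..}" using comp sub by (auto simp: K_def compact_insert)
  obtain k1 where k1: "k1 \<in> K" "\<And>x. x \<in> K \<Longrightarrow> k1 \<le> x" using compact_attains_inf[OF K(1,2)] by blast
  obtain k2 where k2: "k2 \<in> K" "\<And>x. x \<in> K \<Longrightarrow> x \<le> k2" using compact_attains_sup[OF K(1,2)] by blast
  have k: "0 < k1" "k1 \<le> k2" using k1 k2(2) K(3) by auto
  have cont: "continuous_on UNIV (dd 1)"
    using dd(2)[of 1] by (auto intro!: continuous_at_imp_continuous_on has_vector_derivative_continuous)
  have "compact (dd 1 ` {k1 / 2..k2 + 1})"
    by (intro compact_continuous_image continuous_on_subset[OF cont]) auto
  then have "bounded (dd 1 ` {k1 / 2..k2 + 1})" by (rule compact_imp_bounded)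
  then obtain M where M: "\<And>x. x \<in> {k1 / 2..k2 + 1} \<Longrightarrow> norm (dd 1 x) \<le> M"
    unfolding bounded_iff by blast
  have "test_data \<phi> (dd 1) (k1 / 2) (k2 + 1) M"
  proof unfold_locales
    show "(\<phi> has_vector_derivative dd 1 x) (at x)" for x using dd(2)[of 0 x] dd(1) by simp
    show "\<phi> x = 0" if "x \<notin> {k1 / 2<..<k2 + 1}" for x
    proof (rule ccontr)
      assume "\<phi> x \<noteq> 0"
      then have "x \<in> K" using closure_subset[of "{x. \<phi> x \<noteq> 0}"] by (auto simp: K_def)
      then have "k1 \<le> x" "x \<le> k2" using k1(2) k2(2) by auto
      then show False using that k by auto
    qed
  qed (use k cont M in auto)
  then show ?thesis by blast
qed

context test_data
begin

lemma dilate_deriv: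
  assumes "0 < a"
  shows "(dilate a \<phi> has_vector_derivative d (x / a) / of_real (a\<^sup>2)) (at x)"
proof -
  have "((\<lambda>x. x / a) has_vector_derivative 1 / a) (at x)"
    unfolding has_real_derivative_iff_has_vector_derivative[symmetric]
    using assms by (auto intro!: derivative_eq_intros)
  from vector_diff_chain_at[OF this deriv]
  have "((\<lambda>x. \<phi> (x / a)) has_vector_derivative (1 / a) *\<^sub>R d (x / a)) (at x)" by (simp add: o_def)
  then have "((\<lambda>x. \<phi> (x / a) / of_real a) has_vector_derivative ((1 / a) *\<^sub>R d (x / a)) / of_real a) (at x)"
    by (rule has_vector_derivative_divide)
  then show ?thesis
    unfolding dilate_def by (simp add: scaleR_conv_of_real power2_eq_square)
qed

lemma dilate_zero:
  assumes "0 < a" "x \<notin> {a * \<alpha><..<a * \<beta>}" shows "dilate a \<phi> x = 0"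
proof -
  have "x / a \<notin> {\<alpha><..<\<beta>}" using assms by (auto simp: field_simps)
  then show ?thesis by (simp add: dilate_def outside)
qed

lemma dilate_cont: "0 < a \<Longrightarrow> continuous_on X (dilate a \<phi>)"
  by (intro continuous_at_imp_continuous_on ballI has_vector_derivative_continuous[OF dilate_deriv])

lemma d_dilate_cont: "0 < a \<Longrightarrow> continuous_on X (\<lambda>x. d (x / a) / of_real (a\<^sup>2))"
  by (intro continuous_intros continuous_on_compose2[OF d_cont]) auto

text \<open>The derivative is moved to the test function, which replaces a counting function by its
  continuous primitive. The exceptional set \<open>s\<close> accommodates the jumps.\<close>

lemma pairing_by_parts:
  fixes F G :: "real \<Rightarrow> complex"
  assumes a: "0 < a" and int: "set_integrable lborel {a * \<alpha>..a * \<beta>} (\<lambda>x. G x * dilate a \<phi> x)"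
    and cont: "continuous_on {a * \<alpha>..a * \<beta>} F" and s: "finite s"
    and F: "\<And>x. x \<in> {a * \<alpha><..<a * \<beta>} - s \<Longrightarrow> (F has_vector_derivative G x) (at x)"
  shows "pairing G (dilate a \<phi>) = - integral {a * \<alpha>..a * \<beta>} (\<lambda>x. F x * (d (x / a) / of_real (a\<^sup>2)))"
proof -
  let ?I = "{a * \<alpha>..a * \<beta>}"
  let ?g' = "\<lambda>x. d (x / a) / of_real (a\<^sup>2)"
  have pos: "0 < a * \<alpha>" "a * \<alpha> \<le> a * \<beta>" using a alpha by auto
  have zero: "dilate a \<phi> x = 0" if "x \<notin> {a * \<alpha><..<a * \<beta>}" for x using dilate_zero[OF a that] .
  have "pairing G (dilate a \<phi>) = (LINT x:?I|lborel. G x * dilate a \<phi> x)"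
    unfolding pairing_def set_lebesgue_integral_def
  proof (rule Bochner_Integration.integral_cong[OF refl])
    fix x :: real
    show "indicator {0<..} x *\<^sub>R (G x * dilate a \<phi> x) = indicator ?I x *\<^sub>R (G x * dilate a \<phi> x)"
      using zero[of x] pos by (cases "x \<in> ?I") (auto simp: indicator_def)
  qed
  also have "\<dots> = integral ?I (\<lambda>x. G x * dilate a \<phi> x)"
    by (rule set_borel_integral_eq_integral(2)[OF int])
  also have "\<dots> = - integral ?I (\<lambda>x. F x * ?g' x)"
  proof (rule integral_unique)
    have "(\<lambda>x. F x * ?g' x) integrable_on ?I"
      by (intro integrable_continuous_interval continuous_intros cont d_dilate_cont a)
    from integrable_integral[OF this] have "((\<lambda>x. F x * ?g' x) has_integral
        (F (a * \<beta>) * dilate a \<phi> (a * \<beta>) - F (a * \<alpha>) * dilate a \<phi> (a * \<alpha>) - (- integral ?I (\<lambda>x. F x * ?g' x)))) ?I"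
      using zero[of "a * \<alpha>"] zero[of "a * \<beta>"]
      by (simp only: greaterThanLessThan_iff less_irrefl simp_thms mult_zero_right diff_self diff_0 minus_minus)
    from integration_by_parts_interior_strong[OF bounded_bilinear_mult s pos(2) cont dilate_cont[OF a] F dilate_deriv[OF a] this]
    show "((\<lambda>x. G x * dilate a \<phi> x) has_integral - integral ?I (\<lambda>x. F x * ?g' x)) ?I" .
  qed
  finally show ?thesis .
qed

lemma by_parts_integral_bound:
  fixes H :: "real \<Rightarrow> complex"
  assumes a: "0 < a" and cont: "continuous_on {a * \<alpha>..a * \<beta>} H"
    and bound: "\<And>x. x \<in> {a * \<alpha>..a * \<beta>} \<Longrightarrow> norm (H x) \<le> Q"
  shows "norm (integral {a * \<alpha>..a * \<beta>} (\<lambda>x. H x * (d (x / a) / of_real (a\<^sup>2)))) \<le> (\<beta> - \<alpha>) * M * Q / a"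
proof -
  have ab: "a * \<alpha> \<le> a * \<beta>" using a alpha by auto
  have "norm (integral {a * \<alpha>..a * \<beta>} (\<lambda>x. H x * (d (x / a) / of_real (a\<^sup>2)))) \<le> Q * (M / a\<^sup>2) * (a * \<beta> - a * \<alpha>)"
  proof (rule integral_bound[OF ab])
    show "continuous_on {a * \<alpha>..a * \<beta>} (\<lambda>x. H x * (d (x / a) / of_real (a\<^sup>2)))"
      by (intro continuous_intros cont d_dilate_cont a)
    fix x assume x: "x \<in> {a * \<alpha>..a * \<beta>}"
    then have "norm (d (x / a)) \<le> M" using a by (intro M) (auto simp: field_simps)
    then have "norm (d (x / a) / of_real (a\<^sup>2)) \<le> M / a\<^sup>2"
      by (simp add: norm_divide norm_power divide_right_mono)
    then show "norm (H x * (d (x / a) / of_real (a\<^sup>2))) \<le> Q * (M / a\<^sup>2)"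
      unfolding norm_mult using bound[OF x] order_trans[OF norm_ge_zero bound[OF x]]
      by (intro mult_mono) auto
  qed
  also have "\<dots> = (\<beta> - \<alpha>) * M * Q / a" using a by (simp add: power2_eq_square field_simps)
  finally show ?thesis .
qed

end

context test_data
begin

lemma interval_pos: "0 < a \<Longrightarrow> x \<in> {a * \<alpha>..a * \<beta>} \<Longrightarrow> 0 < x"
  using less_le_trans[of 0 "a * \<alpha>" x] alpha by simp

lemma pairing_power:
  assumes a: "0 < a" and w: "\<omega> \<noteq> 0" "\<omega> + 1 \<noteq> 0"
  shows "pairing (\<lambda>x. of_real x powr \<omega> / \<omega>) (dilate a \<phi>) =
    - integral {a * \<alpha>..a * \<beta>} (\<lambda>x. (of_real x * (1 / (\<omega> * (\<omega> + 1)) * exp (\<omega> * of_real (ln x)))) * (d (x / a) / of_real (a\<^sup>2)))"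
proof (rule pairing_by_parts[OF a _ _ finite.emptyI])
  let ?I = "{a * \<alpha>..a * \<beta>}"
  have pw: "of_real x powr \<omega> = exp (\<omega> * of_real (ln x))" if "0 < x" for x :: real
    using that by (simp add: powr_def Ln_of_real)
  have cont_ln: "continuous_on ?I (\<lambda>x. complex_of_real (ln x))"
  proof (intro continuous_on_of_real continuous_on_ln continuous_on_id ballI)
    fix x assume "x \<in> ?I"
    from interval_pos[OF a this] show "x \<noteq> 0" by simp
  qed
  have "continuous_on ?I (\<lambda>x. exp (\<omega> * of_real (ln x)) / \<omega> * dilate a \<phi> x)"
    using w by (intro continuous_intros cont_ln dilate_cont a) auto
  then have "continuous_on ?I (\<lambda>x. of_real x powr \<omega> / \<omega> * dilate a \<phi> x)"
  proof (rule continuous_on_eq)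
    fix x assume "x \<in> ?I"
    from pw[OF interval_pos[OF a this]]
    show "exp (\<omega> * of_real (ln x)) / \<omega> * dilate a \<phi> x = of_real x powr \<omega> / \<omega> * dilate a \<phi> x" by simp
  qed
  then show "set_integrable lborel ?I (\<lambda>x. of_real x powr \<omega> / \<omega> * dilate a \<phi> x)"
    by (rule borel_integrable_atLeastAtMost')
  show "continuous_on ?I (\<lambda>x. of_real x * (1 / (\<omega> * (\<omega> + 1)) * exp (\<omega> * of_real (ln x))))"
    using w by (intro continuous_intros cont_ln) auto
  fix x assume "x \<in> {a * \<alpha><..<a * \<beta>} - {}"
  then have x: "0 < x" using interval_pos[OF a, of x] by auto
  have "((\<lambda>x. complex_of_real x * (1 / (\<omega> * (\<omega> + 1)) * exp (\<omega> * of_real (ln x)))) has_vector_derivative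
     (1 * (1 / (\<omega> * (\<omega> + 1)) * exp (\<omega> * of_real (ln x)))
        + of_real x * (1 / (\<omega> * (\<omega> + 1)) * (\<omega> * of_real (inverse x) * exp (\<omega> * of_real (ln x)))))) (at x)"
  proof -
    have ln: "((\<lambda>x. complex_of_real (ln x)) has_vector_derivative of_real (inverse x)) (at x)"
      using DERIV_ln[OF x] by (intro has_vector_derivative_of_real) (simp add: has_real_derivative_iff_has_vector_derivative)
    have ex: "((\<lambda>x. exp (\<omega> * of_real (ln x))) has_vector_derivative (\<omega> * of_real (inverse x) * exp (\<omega> * of_real (ln x)))) (at x)"
    proof -
      have "(exp has_field_derivative exp (\<omega> * of_real (ln x))) (at (\<omega> * complex_of_real (ln x)))" by (rule DERIV_exp)
      moreover have "((\<lambda>x. \<omega> * complex_of_real (ln x)) has_vector_derivative \<omega> * of_real (inverse x)) (at x)"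
        by (rule has_vector_derivative_mult_right[OF ln])
      ultimately show ?thesis
        using field_vector_diff_chain_at[of "\<lambda>x. \<omega> * complex_of_real (ln x)"] by (simp add: o_def)
    qed
    have idd: "(complex_of_real has_vector_derivative 1) (at x)"
      using has_vector_derivative_of_real[OF DERIV_ident] by simp
    have "((\<lambda>x. 1 / (\<omega> * (\<omega> + 1)) * exp (\<omega> * of_real (ln x))) has_vector_derivative
        1 / (\<omega> * (\<omega> + 1)) * (\<omega> * of_real (inverse x) * exp (\<omega> * of_real (ln x)))) (at x)"
      by (rule has_vector_derivative_mult_right[OF ex])
    from has_vector_derivative_mult[OF idd this] show ?thesis by (simp add: add.commute)
  qed
  moreover have "1 * (1 / (\<omega> * (\<omega> + 1)) * exp (\<omega> * of_real (ln x)))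
        + of_real x * (1 / (\<omega> * (\<omega> + 1)) * (\<omega> * of_real (inverse x) * exp (\<omega> * of_real (ln x))))
      = of_real x powr \<omega> / \<omega>"
  proof -
    define E where "E = exp (\<omega> * complex_of_real (ln x))"
    have "complex_of_real x * of_real (inverse x) = 1" using x by (simp add: of_real_mult[symmetric] del: of_real_mult of_real_inverse)
    then have "of_real x * (1 / (\<omega> * (\<omega> + 1)) * (\<omega> * of_real (inverse x) * E)) = 1 / (\<omega> * (\<omega> + 1)) * \<omega> * E"
      by (metis (no_types, lifting) mult.assoc mult.commute mult.right_neutral)
    then have "1 * (1 / (\<omega> * (\<omega> + 1)) * E) + of_real x * (1 / (\<omega> * (\<omega> + 1)) * (\<omega> * of_real (inverse x) * E))
        = (\<omega> + 1) * E / (\<omega> * (\<omega> + 1))"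
      by (simp add: add_divide_distrib distrib_right)
    also have "(\<omega> + 1) * E / (\<omega> * (\<omega> + 1)) = E / \<omega>" using w by simp
    finally show ?thesis unfolding pw[OF x] E_def .
  qed
  ultimately show "((\<lambda>x. complex_of_real x * (1 / (\<omega> * (\<omega> + 1)) * exp (\<omega> * of_real (ln x)))) has_vector_derivative
     of_real x powr \<omega> / \<omega>) (at x)" by simp
qed

lemma pairing_psi:
  assumes flow: "self_similar_flow N w" and a: "0 < a"
  shows "continuous_on {a * \<alpha>..a * \<beta>} (\<lambda>x. complex_of_real (psi_primitive N w x))"
    and "pairing (\<lambda>x. of_real (psi N w x)) (dilate a \<phi>) =
    - integral {a * \<alpha>..a * \<beta>} (\<lambda>x. of_real (psi_primitive N w x) * (d (x / a) / of_real (a\<^sup>2)))"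
proof -
  let ?I = "{a * \<alpha>..a * \<beta>}"
  define L where "L = words N w (ln (a * \<beta>))"
  define b where "b u = exp (sum_list (map w u))" for u
  define P where "P x = complex_of_real (\<Sum>u\<in>L. w (hd u) * max 0 (x - b u))" for x
  define Q where "Q x = complex_of_real (\<Sum>u\<in>L. w (hd u) * (if b u \<le> x then 1 else 0))" for x
  have fin: "finite L" unfolding L_def by (rule finite_words[OF flow])
  have words_eq: "words N w (ln x) = {u \<in> L. b u \<le> x}" if "x \<in> ?I" for x
  proof -
    have x: "0 < x" "x \<le> a * \<beta>" using interval_pos[OF a that] that by auto
    then have "ln x \<le> ln (a * \<beta>)" by simp
    moreover have "b u \<le> x \<longleftrightarrow> sum_list (map w u) \<le> ln x" for u
      using x exp_le_cancel_iff[of "sum_list (map w u)" "ln x"] by (simp add: b_def)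
    ultimately show ?thesis by (auto simp: words_def L_def)
  qed
  have P_eq: "of_real (psi_primitive N w x) = P x" if "x \<in> ?I" for x
    unfolding P_def psi_primitive_def words_eq[OF that]
    using fin by (intro arg_cong[of _ _ of_real] sum.mono_neutral_cong_left) (auto simp: b_def max_def)
  have Q_eq: "of_real (psi N w x) = Q x" if "x \<in> ?I" for x
    unfolding Q_def psi_eq_sum_words[OF flow] words_eq[OF that]
    using fin by (intro arg_cong[of _ _ of_real] sum.mono_neutral_cong_left) auto
  have P_cont: "continuous_on ?I P" unfolding P_def by (intro continuous_intros)
  then show cont: "continuous_on ?I (\<lambda>x. complex_of_real (psi_primitive N w x))"
    by (rule continuous_on_eq) (use P_eq in simp)
  have step: "((\<lambda>x. max 0 (x - c)) has_real_derivative (if c \<le> x then 1 else 0)) (at x)" if "x \<noteq> c" for x c :: real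
  proof (cases "c < x")
    case True
    have "((\<lambda>x. x - c) has_real_derivative 1) (at x)" by (auto intro!: derivative_eq_intros)
    then have "((\<lambda>x. max 0 (x - c)) has_real_derivative 1) (at x)"
      by (rule has_field_derivative_transform_within_open[of _ _ _ "{c<..}"]) (use True in auto)
    then show ?thesis using True by simp
  next
    case False
    have "((\<lambda>x. 0) has_real_derivative 0) (at x)" by simp
    then have "((\<lambda>x. max 0 (x - c)) has_real_derivative 0) (at x)"
      by (rule has_field_derivative_transform_within_open[of _ _ _ "{..<c}"]) (use False that in auto)
    then show ?thesis using False that by simp
  qed
  show "pairing (\<lambda>x. of_real (psi N w x)) (dilate a \<phi>) =
    - integral ?I (\<lambda>x. of_real (psi_primitive N w x) * (d (x / a) / of_real (a\<^sup>2)))"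
  proof (rule pairing_by_parts[OF a _ cont])
    show "finite (b ` L)" using fin by simp
    fix x assume x: "x \<in> {a * \<alpha><..<a * \<beta>} - b ` L"
    have "((\<lambda>x. \<Sum>u\<in>L. w (hd u) * max 0 (x - b u)) has_real_derivative
        (\<Sum>u\<in>L. w (hd u) * (if b u \<le> x then 1 else 0))) (at x)"
      using x by (intro DERIV_sum DERIV_cmult step) auto
    then have "(P has_vector_derivative Q x) (at x)"
      unfolding P_def Q_def by (intro has_vector_derivative_of_real)
        (simp add: has_real_derivative_iff_has_vector_derivative)
    then have "((\<lambda>x. complex_of_real (psi_primitive N w x)) has_vector_derivative Q x) (at x)"
      by (rule has_vector_derivative_transform_within_open[of _ _ _ "{a * \<alpha><..<a * \<beta>}"]) (use x P_eq in auto)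
    then show "((\<lambda>x. complex_of_real (psi_primitive N w x)) has_vector_derivative of_real (psi N w x)) (at x)"
      using Q_eq[of x] x by simp
  next
    have "set_integrable lborel ?I (dilate a \<phi>)"
      by (intro borel_integrable_atLeastAtMost' dilate_cont a)
    then have "integrable lborel (\<lambda>x. indicator {b u..} x *\<^sub>R (indicator ?I x *\<^sub>R dilate a \<phi> x))" for u
      unfolding set_integrable_def by - (rule integrable_mult_indicator, simp_all)
    then have "integrable lborel (\<lambda>x. \<Sum>u\<in>L. of_real (w (hd u)) * (indicator {b u..} x *\<^sub>R (indicator ?I x *\<^sub>R dilate a \<phi> x)))"
      by (intro Bochner_Integration.integrable_sum integrable_mult_right)
    moreover have "(\<lambda>x. \<Sum>u\<in>L. of_real (w (hd u)) * (indicator {b u..} x *\<^sub>R (indicator ?I x *\<^sub>R dilate a \<phi> x)))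
        = (\<lambda>x. indicator ?I x *\<^sub>R (of_real (psi N w x) * dilate a \<phi> x))"
    proof (rule ext)
      fix x :: real
      show "(\<Sum>u\<in>L. of_real (w (hd u)) * (indicator {b u..} x *\<^sub>R (indicator ?I x *\<^sub>R dilate a \<phi> x)))
        = indicator ?I x *\<^sub>R (of_real (psi N w x) * dilate a \<phi> x)"
      proof (cases "x \<in> ?I")
        case True
        have "(\<Sum>u\<in>L. of_real (w (hd u)) * (indicator {b u..} x *\<^sub>R (indicator ?I x *\<^sub>R dilate a \<phi> x)))
            = (\<Sum>u\<in>L. of_real (w (hd u) * (if b u \<le> x then 1 else 0)) * dilate a \<phi> x)"
          using True by (intro sum.cong refl) (auto simp: indicator_def)
        also have "\<dots> = Q x * dilate a \<phi> x" by (simp only: Q_def of_real_sum sum_distrib_right)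
        finally show ?thesis using True Q_eq[OF True] by simp
      qed simp
    qed
    ultimately show "set_integrable lborel ?I (\<lambda>x. of_real (psi N w x) * dilate a \<phi> x)"
      unfolding set_integrable_def by simp
  qed
qed

end

section \<open>The distributional formula\<close>

lemma (in test_data) power_primitive_cont:
  assumes a: "0 < a"
  shows "continuous_on {a * \<alpha>..a * \<beta>} (\<lambda>x. of_real x * (c * exp (\<omega> * of_real (ln x))) :: complex)"
proof (intro continuous_on_mult continuous_on_const continuous_on_exp continuous_on_of_real continuous_on_ln continuous_on_id ballI)
  fix x assume "x \<in> {a * \<alpha>..a * \<beta>}"
  from interval_pos[OF a this] show "x \<noteq> 0" by simp
qed

locale smoothed_zeros = zero_control + test_data
begin

definition power_pairing :: "real \<Rightarrow> complex \<Rightarrow> complex" where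
  "power_pairing a \<omega> = pairing (\<lambda>x. of_real x powr \<omega> / \<omega>) (dilate a \<phi>)"

lemma power_pairing_eq:
  assumes "0 < a" "\<omega> \<in> near_zeros"
  shows "power_pairing a \<omega> = - integral {a * \<alpha>..a * \<beta>}
    (\<lambda>x. (of_real x * (coeff \<omega> * exp (\<omega> * of_real (ln x)))) * (d (x / a) / of_real (a\<^sup>2)))"
proof -
  have "\<omega> \<noteq> 0" "\<omega> + 1 \<noteq> 0" using near_zero_bounds(4,5)[OF assms(2)] by auto
  then show ?thesis unfolding power_pairing_def coeff_def by (rule pairing_power[OF assms(1)])
qed

lemma power_pairing_bound:
  assumes a: "0 < a"
  shows "\<exists>K. \<forall>\<omega>\<in>near_zeros. norm (power_pairing a \<omega>) \<le> K * (1 / (norm \<omega>)\<^sup>2)"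
proof -
  define E where "E = exp (D * max 0 (ln (a * \<beta>)))"
  have "norm (power_pairing a \<omega>) \<le> ((\<beta> - \<alpha>) * M * (a * \<beta> * E) / a) * (1 / (norm \<omega>)\<^sup>2)" if w: "\<omega> \<in> near_zeros" for \<omega>
  proof -
    have "norm (power_pairing a \<omega>) \<le> (\<beta> - \<alpha>) * M * (a * \<beta> * (1 / (norm \<omega>)\<^sup>2 * E)) / a"
      unfolding power_pairing_eq[OF a w] norm_minus_cancel
    proof (rule by_parts_integral_bound[OF a power_primitive_cont[OF a]])
      fix x assume x: "x \<in> {a * \<alpha>..a * \<beta>}"
      have x0: "0 < x" "x \<le> a * \<beta>" using interval_pos[OF a x] x by auto
      have "Re \<omega> * ln x \<le> D * max 0 (ln (a * \<beta>))"
      proof (cases "ln x \<le> 0")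
        case True
        then have "Re \<omega> * ln x \<le> 0" using near_zero_bounds(1)[OF w] e_small by (intro mult_nonneg_nonpos) auto
        also have "0 \<le> D * max 0 (ln (a * \<beta>))" using D_pos by simp
        finally show ?thesis .
      next
        case False
        then show ?thesis using near_zero_bounds(1,2)[OF w] x0 e_small D_pos
          by (intro mult_mono) (auto simp: le_max_iff_disj)
      qed
      then have "norm (exp (\<omega> * of_real (ln x))) \<le> E" by (simp add: E_def)
      then have "norm (coeff \<omega> * exp (\<omega> * of_real (ln x))) \<le> 1 / (norm \<omega>)\<^sup>2 * E"
        unfolding norm_mult using norm_coeff_le[OF w] by (intro mult_mono) auto
      then show "norm (of_real x * (coeff \<omega> * exp (\<omega> * of_real (ln x)))) \<le> a * \<beta> * (1 / (norm \<omega>)\<^sup>2 * E)"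
        unfolding norm_mult[of "of_real x"] using x0 by (intro mult_mono) auto
    qed
    then show ?thesis using a by (simp add: mult_ac)
  qed
  then show ?thesis by blast
qed

lemma power_pairing_summable:
  assumes "0 < a" "W \<subseteq> near_zeros"
  shows "power_pairing a summable_on W"
proof -
  obtain K where K: "\<forall>\<omega>\<in>near_zeros. norm (power_pairing a \<omega>) \<le> K * (1 / (norm \<omega>)\<^sup>2)"
    using power_pairing_bound[OF assms(1)] by (elim exE)
  have "(\<lambda>\<omega>. K * (1 / (norm \<omega>)\<^sup>2)) summable_on W"
    by (intro summable_on_cmult_right summable_on_subset_banach[OF inverse_square_summable] assms(2))
  then have "(\<lambda>\<omega>. norm (power_pairing a \<omega>)) summable_on W"
    by (rule summable_on_comparison_test) (use K assms(2) in auto)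
  then show ?thesis by (rule abs_summable_summable)
qed

text \<open>The estimate is first made for a finite set \<open>F\<close> of zeros, where integration by parts turns the
  pointwise formula into a formula for pairings; then \<open>F\<close> exhausts \<open>W\<close>.\<close>

lemma smoothed_explicit_formula:
  "\<exists>K. \<forall>W a. W \<subseteq> near_zeros \<longrightarrow> dominant_zeros \<subseteq> W \<longrightarrow> 1 / \<alpha> \<le> a \<longrightarrow>
    norm (pairing (\<lambda>x. of_real (psi N w x)) (dilate a \<phi>) - (\<Sum>\<^sub>\<infinity>\<omega>\<in>W. power_pairing a \<omega>)) \<le> K * a powr (D - 2 * e)"
proof -
  let ?h = "\<lambda>\<omega>::complex. 1 / (norm \<omega>)\<^sup>2"
  obtain C where C: "C > 0" "\<forall>W F y. W \<subseteq> near_zeros \<longrightarrow> dominant_zeros \<subseteq> W \<longrightarrow> finite F \<longrightarrow> F \<subseteq> W \<longrightarrow> 0 \<le> y \<longrightarrow>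
    norm (of_real (smoothed_count N w y) - (sum (dim_term y) F))
      \<le> C * exp ((D - 2 * e) * y) + (infsum ?h W - sum ?h F) * exp (D * y)"
    using explicit_formula_partial by (elim exE conjE)
  define K where "K = (\<beta> - \<alpha>) * M * (\<beta> * (C * \<beta> powr (D - 2 * e)))"
  have "norm (pairing (\<lambda>x. of_real (psi N w x)) (dilate a \<phi>) - infsum (power_pairing a) W) \<le> K * a powr (D - 2 * e)"
    if W: "W \<subseteq> near_zeros" "dominant_zeros \<subseteq> W" and a1: "1 / \<alpha> \<le> a" for W a
  proof -
    have a: "0 < a" using a1 alpha by (meson less_le_trans zero_less_divide_1_iff)
    have a\<alpha>: "1 \<le> a * \<alpha>" using a1 alpha by (simp add: field_simps)
    let ?I = "{a * \<alpha>..a * \<beta>}" and ?g = "\<lambda>x. d (x / a) / of_real (a\<^sup>2)"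
    let ?P = "\<lambda>\<omega> x. of_real x * (coeff \<omega> * exp (\<omega> * of_real (ln x))) :: complex"
    let ?psi = "pairing (\<lambda>x. of_real (psi N w x)) (dilate a \<phi>)"
    have hW: "?h summable_on W" by (rule summable_on_subset_banach[OF inverse_square_summable W(1)])
    define R where "R F = (\<beta> - \<alpha>) * M * (a * \<beta> * (C * exp ((D - 2 * e) * ln (a * \<beta>)) + (infsum ?h W - sum ?h F) * exp (D * ln (a * \<beta>)))) / a" for F
    have est: "norm (?psi - sum (power_pairing a) F) \<le> R F" if F: "finite F" "F \<subseteq> W" for F
    proof -
      have Fnear: "\<omega> \<in> near_zeros" if "\<omega> \<in> F" for \<omega> using that F W by blast
      have Pc: "continuous_on ?I (?P \<omega>)" for \<omega> by (rule power_primitive_cont[OF a])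
      have int: "(\<lambda>x. ?P \<omega> x * ?g x) integrable_on ?I" for \<omega>
        by (intro integrable_continuous_interval continuous_on_mult Pc d_dilate_cont a)
      have intpsi: "(\<lambda>x. of_real (psi_primitive N w x) * ?g x) integrable_on ?I"
        by (intro integrable_continuous_interval continuous_on_mult pairing_psi(1)[OF flow a] d_dilate_cont a)
      have tail0: "0 \<le> infsum ?h W - sum ?h F"
        using finite_sum_le_infsum[OF hW F] by simp
      have "sum (power_pairing a) F = - integral ?I (\<lambda>x. \<Sum>\<omega>\<in>F. ?P \<omega> x * ?g x)"
        using F(1) int by (simp only: integral_sum power_pairing_eq[OF a Fnear] sum_negf cong: sum.cong)
      then have "?psi - sum (power_pairing a) F =
          - (integral ?I (\<lambda>x. of_real (psi_primitive N w x) * ?g x) - integral ?I (\<lambda>x. \<Sum>\<omega>\<in>F. ?P \<omega> x * ?g x))"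
        by (simp add: pairing_psi(2)[OF flow a])
      also have "integral ?I (\<lambda>x. of_real (psi_primitive N w x) * ?g x) - integral ?I (\<lambda>x. \<Sum>\<omega>\<in>F. ?P \<omega> x * ?g x)
          = integral ?I (\<lambda>x. of_real (psi_primitive N w x) * ?g x - (\<Sum>\<omega>\<in>F. ?P \<omega> x * ?g x))"
        using F(1) int intpsi by (intro integral_diff[symmetric] integrable_sum) auto
      also have "(\<lambda>x. of_real (psi_primitive N w x) * ?g x - (\<Sum>\<omega>\<in>F. ?P \<omega> x * ?g x))
          = (\<lambda>x. (of_real (psi_primitive N w x) - (\<Sum>\<omega>\<in>F. ?P \<omega> x)) * ?g x)"
        by (simp only: left_diff_distrib sum_distrib_right)
      finally have eq: "?psi - sum (power_pairing a) F =
          - integral ?I (\<lambda>x. (of_real (psi_primitive N w x) - (\<Sum>\<omega>\<in>F. ?P \<omega> x)) * ?g x)" .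
      show ?thesis
        unfolding eq norm_minus_cancel R_def
      proof (rule by_parts_integral_bound[OF a])
        show "continuous_on ?I (\<lambda>x. of_real (psi_primitive N w x) - (\<Sum>\<omega>\<in>F. ?P \<omega> x))"
          by (intro continuous_on_diff continuous_on_sum Pc pairing_psi(1)[OF flow a])
        fix x assume x: "x \<in> ?I"
        have x0: "0 < x" "x \<le> a * \<beta>" "1 \<le> x" using interval_pos[OF a x] x a\<alpha> by auto
        define y where "y = ln x"
        have y: "0 \<le> y" "y \<le> ln (a * \<beta>)" using x0 by (auto simp: y_def)
        have "of_real (psi_primitive N w x) - (\<Sum>\<omega>\<in>F. ?P \<omega> x) =
            of_real x * (of_real (smoothed_count N w y) - (sum (dim_term y) F))"
          by (simp add: psi_primitive_eq[OF x0(1)] right_diff_distrib sum_distrib_left y_def)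
        moreover have "norm (of_real (smoothed_count N w y) - (sum (dim_term y) F))
            \<le> C * exp ((D - 2 * e) * ln (a * \<beta>)) + (infsum ?h W - sum ?h F) * exp (D * ln (a * \<beta>))"
        proof -
          have "norm (of_real (smoothed_count N w y) - (sum (dim_term y) F))
            \<le> C * exp ((D - 2 * e) * y) + (infsum ?h W - sum ?h F) * exp (D * y)"
            using C(2)[rule_format, OF W F y(1)] .
          also have "\<dots> \<le> C * exp ((D - 2 * e) * ln (a * \<beta>)) + (infsum ?h W - sum ?h F) * exp (D * ln (a * \<beta>))"
            using C(1) tail0 y(2) e_small pos D_pos by (intro add_mono mult_left_mono) auto
          finally show ?thesis .
        qed
        ultimately show "norm (of_real (psi_primitive N w x) - (\<Sum>\<omega>\<in>F. ?P \<omega> x))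
            \<le> a * \<beta> * (C * exp ((D - 2 * e) * ln (a * \<beta>)) + (infsum ?h W - sum ?h F) * exp (D * ln (a * \<beta>)))"
          using x0 by (simp only: norm_mult norm_of_real) (intro mult_mono; simp)
      qed
    qed
    have sum_lim: "(sum (power_pairing a) \<longlongrightarrow> infsum (power_pairing a) W) (finite_subsets_at_top W)"
      using has_sum_infsum[OF power_pairing_summable[OF a W(1)]] unfolding has_sum_def .
    have h_lim: "(sum ?h \<longlongrightarrow> infsum ?h W) (finite_subsets_at_top W)"
      using has_sum_infsum[OF hW] unfolding has_sum_def .
    have R_lim: "(R \<longlongrightarrow> (\<beta> - \<alpha>) * M * (a * \<beta> * (C * exp ((D - 2 * e) * ln (a * \<beta>)) + (infsum ?h W - infsum ?h W) * exp (D * ln (a * \<beta>)))) / a)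
        (finite_subsets_at_top W)"
      unfolding R_def by (intro tendsto_intros h_lim) (use a in simp)
    have "norm (?psi - infsum (power_pairing a) W) \<le>
        (\<beta> - \<alpha>) * M * (a * \<beta> * (C * exp ((D - 2 * e) * ln (a * \<beta>)) + (infsum ?h W - infsum ?h W) * exp (D * ln (a * \<beta>)))) / a"
    proof (rule tendsto_le[OF finite_subsets_at_top_neq_bot R_lim])
      show "((\<lambda>F. norm (?psi - sum (power_pairing a) F)) \<longlongrightarrow> norm (?psi - infsum (power_pairing a) W)) (finite_subsets_at_top W)"
        by (intro tendsto_intros sum_lim)
      show "eventually (\<lambda>F. norm (?psi - sum (power_pairing a) F) \<le> R F) (finite_subsets_at_top W)"
        using est by (rule eventually_finite_subsets_at_top_weakI)
    qed
    also have "\<dots> = K * a powr (D - 2 * e)"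
    proof -
      have "exp ((D - 2 * e) * ln (a * \<beta>)) = (a * \<beta>) powr (D - 2 * e)" using a alpha by (simp add: powr_def)
      also have "\<dots> = a powr (D - 2 * e) * \<beta> powr (D - 2 * e)" by (rule powr_mult)
      finally show ?thesis using a by (simp add: K_def mult_ac)
    qed
    finally show ?thesis .
  qed
  then show ?thesis by blast
qed

end

context zero_control
begin

lemma distributional_formula:
  assumes W: "W \<subseteq> near_zeros" "dominant_zeros \<subseteq> W"
  shows "\<forall>\<phi>. test_function \<phi> \<longrightarrow> (\<lambda>\<omega>. pairing (\<lambda>x. of_real x powr \<omega> / \<omega>) \<phi>) summable_on (W - {of_real D})"
    and "distribution_bigo
             (\<lambda>\<phi>. pairing (\<lambda>x. of_real (psi N w x)) \<phi>
                - pairing (\<lambda>x. of_real (x powr D / D)) \<phi>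
                - (\<Sum>\<^sub>\<infinity>\<omega> \<in> W - {of_real D}. pairing (\<lambda>x. of_real x powr \<omega> / \<omega>) \<phi>))
             (D - e)"
proof -
  have D_in: "of_real D \<in> W" using W(2) D_near_zero pos by auto
  have D_term: "pairing (\<lambda>x. of_real (x powr D / D)) \<phi> = pairing (\<lambda>x. of_real x powr of_real D / of_real D) \<phi>" for \<phi>
    unfolding pairing_def by (intro set_lebesgue_integral_cong) (auto simp: powr_of_real)
  show "\<forall>\<phi>. test_function \<phi> \<longrightarrow> (\<lambda>\<omega>. pairing (\<lambda>x. of_real x powr \<omega> / \<omega>) \<phi>) summable_on (W - {of_real D})"
  proof (intro allI impI)
    fix \<phi> assume "test_function \<phi>"
    then obtain d \<alpha> \<beta> M where "test_data \<phi> d \<alpha> \<beta> M" using test_function_data by blast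
    then interpret smoothed_zeros N w e A B \<phi> d \<alpha> \<beta> M
      by (intro smoothed_zeros.intro zero_control_axioms)
    have "dilate 1 \<phi> = \<phi>" by (simp add: dilate_def)
    moreover have "power_pairing 1 summable_on (W - {of_real D})" using W(1) by (intro power_pairing_summable) auto
    ultimately show "(\<lambda>\<omega>. pairing (\<lambda>x. of_real x powr \<omega> / \<omega>) \<phi>) summable_on (W - {of_real D})"
      by (simp add: power_pairing_def[abs_def])
  qed
  show "distribution_bigo
             (\<lambda>\<phi>. pairing (\<lambda>x. of_real (psi N w x)) \<phi>
                - pairing (\<lambda>x. of_real (x powr D / D)) \<phi>
                - (\<Sum>\<^sub>\<infinity>\<omega> \<in> W - {of_real D}. pairing (\<lambda>x. of_real x powr \<omega> / \<omega>) \<phi>))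
             (D - e)"
    unfolding distribution_bigo_def
  proof (intro allI impI)
    fix \<phi> assume "test_function \<phi>"
    then obtain d \<alpha> \<beta> M where "test_data \<phi> d \<alpha> \<beta> M" using test_function_data by blast
    then interpret smoothed_zeros N w e A B \<phi> d \<alpha> \<beta> M
      by (intro smoothed_zeros.intro zero_control_axioms)
    obtain K where K: "\<forall>W a. W \<subseteq> near_zeros \<longrightarrow> dominant_zeros \<subseteq> W \<longrightarrow> 1 / \<alpha> \<le> a \<longrightarrow>
      norm (pairing (\<lambda>x. of_real (psi N w x)) (dilate a \<phi>) - (\<Sum>\<^sub>\<infinity>\<omega>\<in>W. power_pairing a \<omega>)) \<le> K * a powr (D - 2 * e)"
      using smoothed_explicit_formula by (elim exE)
    let ?T = "\<lambda>a. pairing (\<lambda>x. of_real (psi N w x)) (dilate a \<phi>)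
                - pairing (\<lambda>x. of_real (x powr D / D)) (dilate a \<phi>)
                - (\<Sum>\<^sub>\<infinity>\<omega> \<in> W - {of_real D}. pairing (\<lambda>x. of_real x powr \<omega> / \<omega>) (dilate a \<phi>))"
    have T_eq: "?T a = pairing (\<lambda>x. of_real (psi N w x)) (dilate a \<phi>) - (\<Sum>\<^sub>\<infinity>\<omega>\<in>W. power_pairing a \<omega>)" if "0 < a" for a
    proof -
      have un: "{of_real D} \<union> (W - {of_real D}) = W" using D_in by auto
      have "infsum (power_pairing a) ({of_real D} \<union> (W - {of_real D})) =
          infsum (power_pairing a) {of_real D} + infsum (power_pairing a) (W - {of_real D})"
        using W(1) D_near_zero that by (intro infsum_Un_disjoint power_pairing_summable) auto
      then have "infsum (power_pairing a) W = power_pairing a (of_real D) + infsum (power_pairing a) (W - {of_real D})"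
        unfolding un by simp
      then show ?thesis unfolding D_term power_pairing_def[symmetric] by simp
    qed
    show "(\<lambda>a. norm (?T a)) \<in> O[at_top](\<lambda>a. a powr (D - e))"
    proof (rule bigoI)
      show "eventually (\<lambda>a. norm (norm (?T a)) \<le> \<bar>K\<bar> * norm (a powr (D - e))) at_top"
        using eventually_ge_at_top[of "1 / \<alpha>"] eventually_ge_at_top[of 1]
      proof eventually_elim
        case (elim a)
        have a0: "0 < a" using elim by simp
        have "norm (?T a) \<le> K * a powr (D - 2 * e)"
          unfolding T_eq[OF a0] by (rule K[rule_format, OF W elim(1)])
        also have "\<dots> \<le> \<bar>K\<bar> * a powr (D - e)"
          using elim pos by (intro mult_mono powr_mono) auto
        finally show ?case by simp
      qed
    qed
  qed
qed

end

theorem mainTheorem5: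
  fixes N :: nat and w :: "nat \<Rightarrow> real" and D :: real
  assumes flow: "self_similar_flow N w"
    and nonlat: "nonlattice N w"
    and dim: "D = flow_dimension N w"
  shows "(\<exists>\<delta>>0. \<exists>S. is_screen N w S \<and> (\<forall>t. S t < D - \<delta>) \<and>
           screen_curve S \<inter> complex_dimensions N w = {} \<and>
           bounded (neg_logderiv_zeta N w ` screen_curve S) \<and>
           (\<forall>\<omega> \<in> complex_dimensions N w \<inter> window S. residue (neg_logderiv_zeta N w) \<omega> = 1) \<and>
           (\<forall>\<phi>. test_function \<phi> \<longrightarrow>
              (\<lambda>\<omega>. pairing (\<lambda>x. of_real x powr \<omega> / \<omega>) \<phi>)
                summable_on (complex_dimensions N w \<inter> window S - {of_real D})) \<and>
           distribution_bigo
             (\<lambda>\<phi>. pairing (\<lambda>x. of_real (psi N w x)) \<phi>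
                - pairing (\<lambda>x. of_real (x powr D / D)) \<phi>
                - (\<Sum>\<^sub>\<infinity>\<omega> \<in> complex_dimensions N w \<inter> window S - {of_real D}.
                     pairing (\<lambda>x. of_real x powr \<omega> / \<omega>) \<phi>))
             (D - \<delta>))
       \<and> (\<lambda>x. psi N w x - x powr D / D) \<in> o[at_top](\<lambda>x. x powr D)"
proof -
  interpret self_similar N w by unfold_locales (rule flow)
  obtain e A B where zc: "zero_control N w e A B" using ex_zero_control by blast
  interpret zero_control N w e A B by (rule zc)
  obtain S where S_range: "\<And>t. flow_dimension N w - 4 * e \<le> S t" "\<And>t. S t \<le> flow_dimension N w - 2 * e"
    and S_lip: "1-lipschitz_on UNIV S"
    and S_far: "\<And>t z. norm (Complex (S t) t - z) \<le> e / 4 \<Longrightarrow> denom z \<noteq> 0"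
    using screen_exists by blast
  let ?W = "complex_dimensions N w \<inter> window S"
  have W_near: "?W \<subseteq> near_zeros"
  proof
    fix z assume z: "z \<in> ?W"
    then have "flow_dimension N w - 4 * e \<le> Re z"
      using S_range(1)[of "Im z"] by (simp add: window_def)
    then show "z \<in> near_zeros" using z complex_dimension_imp_zero[of z] pos by (simp add: near_zeros_def)
  qed
  have W_sup: "dominant_zeros \<subseteq> ?W"
  proof
    fix z assume z: "z \<in> dominant_zeros"
    then show "z \<in> ?W"
      using near_zeros_pole_residue(1)[of z] S_range(2)[of "Im z"] by (simp add: window_def)
  qed
  have screen: "is_screen N w S"
    unfolding is_screen_def
  proof (intro conjI allI exI[of _ 1] S_lip)
    show "bounded (range S)"
    proof (rule boundedI)
      fix x assume "x \<in> range S"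
      then show "norm x \<le> \<bar>flow_dimension N w - 4 * e\<bar> + \<bar>flow_dimension N w - 2 * e\<bar>"
        using S_range by (auto simp: abs_le_iff) (smt (verit))+
    qed
    show "S t < flow_dimension N w" for t using S_range(2)[of t] pos by simp
  qed
  have avoid: "screen_curve S \<inter> complex_dimensions N w = {}"
  proof -
    have "Complex (S t) t \<notin> complex_dimensions N w" for t
      using S_far[of t "Complex (S t) t"] complex_dimension_imp_zero[of "Complex (S t) t"] pos by auto
    then show ?thesis by (auto simp: screen_curve_def)
  qed
  have bdd: "bounded (neg_logderiv_zeta N w ` screen_curve S)"
  proof (rule boundedI)
    fix v assume "v \<in> neg_logderiv_zeta N w ` screen_curve S"
    then obtain t where v: "v = neg_logderiv_zeta N w (Complex (S t) t)" by (auto simp: screen_curve_def)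
    show "norm v \<le> B / (A * (e / 4))"
      unfolding v by (rule neg_logderiv_zeta_bounded_on_screen[where S = S and t = t, OF S_range(1) S_far])
  qed
  note formula = distributional_formula[OF W_near W_sup]
  have "\<exists>\<delta>>0. \<exists>S. is_screen N w S \<and> (\<forall>t. S t < flow_dimension N w - \<delta>) \<and>
           screen_curve S \<inter> complex_dimensions N w = {} \<and>
           bounded (neg_logderiv_zeta N w ` screen_curve S) \<and>
           (\<forall>\<omega> \<in> complex_dimensions N w \<inter> window S. residue (neg_logderiv_zeta N w) \<omega> = 1) \<and>
           (\<forall>\<phi>. test_function \<phi> \<longrightarrow>
              (\<lambda>\<omega>. pairing (\<lambda>x. of_real x powr \<omega> / \<omega>) \<phi>)
                summable_on (complex_dimensions N w \<inter> window S - {of_real (flow_dimension N w)})) \<and>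
           distribution_bigo
             (\<lambda>\<phi>. pairing (\<lambda>x. of_real (psi N w x)) \<phi>
                - pairing (\<lambda>x. of_real (x powr flow_dimension N w / flow_dimension N w)) \<phi>
                - (\<Sum>\<^sub>\<infinity>\<omega> \<in> complex_dimensions N w \<inter> window S - {of_real (flow_dimension N w)}.
                     pairing (\<lambda>x. of_real x powr \<omega> / \<omega>) \<phi>))
             (flow_dimension N w - \<delta>)"
  proof (intro exI[of _ e] exI[of _ S] conjI screen avoid bdd formula)
    show "0 < e" by (rule pos)
    show "\<forall>t. S t < flow_dimension N w - e"
    proof
      fix t show "S t < flow_dimension N w - e" using S_range(2)[of t] pos by simp
    qed
    show "\<forall>\<omega> \<in> ?W. residue (neg_logderiv_zeta N w) \<omega> = 1"
      using W_near near_zeros_pole_residue(2) by blast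
  qed
  then show ?thesis unfolding dim using psi_asymptotics[OF nonlat] by blast
qed

end
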